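(* Let $\mathcal{A}$ be a properly infinite von Neumann algebra acting on a Hilbert space $H$, let $F\in\mathcal{A}$, and suppose that $0$ is an isolated point of $\sigma(F)$. Then $F$ is $\mathcal{A}$-Fredholm if and only if $F$ is generalized $\mathcal{A}$-Browder.
   Context: For closed subspaces, $H=M\tilde\oplus N$ means $M\cap N=\{0\}$ and $M+N=H$ (not necessarily orthogonal). For a closed subspace $L$ of $H$, $P_L$ is the orthogonal projection onto $L$. A projection of $\mathcal{A}$ is finite if it is not Murray–von Neumann equivalent in $\mathcal{A}$ to any of its proper subprojections; $\mathrm{Proj}_0(\mathcal{A})$ is the set of finite projections of $\mathcal{A}$. $F\in\mathcal{A}$ is generalized $\mathcal{A}$-Browder if there is a decomposition $H=M\tilde\oplus N$ into closed subspaces with respect to which (on both domain and codomain) $F$ has the matrix $\begin{pmatrix}F_1&0\\0&F_4\end{pmatrix}$ where $F_1:M\to M$ is an isomorphism, and such that $P_N\in\mathrm{Proj}_0(\mathcal{A})$. $T\in\mathcal{A}$ is $\mathcal{A}$-Fredholm (in the sense of Breuer) if $P_{\ker T}\in\mathrm{Proj}_0(\mathcal{A})$ and there is $E\in\mathrm{Proj}_0(\mathcal{A})$ with $\operatorname{Im}(I-E)\subseteq\operatorname{Im}T$. *)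

theory Defs
  imports "HOL-Analysis.Analysis"
begin

section \<open>Complex Hilbert spaces\<close>

text \<open>
  The real structure of a complex Hilbert space (norm, \<^const>\<open>scaleR\<close>, \<^const>\<open>inner\<close>) is the one
  underlying the complex structure, so that the library on \<^class>\<open>real_inner\<close> and \<^class>\<open>banach\<close>
  applies. The complex inner product is linear in its first argument. Positivity and definiteness
  of the complex inner product are inherited from \<^const>\<open>inner\<close> by the last axiom.
\<close>

class chilbert_space = real_inner + banach +
  fixes scaleC :: "complex \<Rightarrow> 'a \<Rightarrow> 'a"  (infixr \<open>*\<^sub>C\<close> 75)
    and cinner :: "'a \<Rightarrow> 'a \<Rightarrow> complex"
  assumes scaleC_add_right: "c *\<^sub>C (x + y) = c *\<^sub>C x + c *\<^sub>C y"
    and scaleC_add_left: "(c + d) *\<^sub>C x = c *\<^sub>C x + d *\<^sub>C x"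
    and scaleC_scaleC: "c *\<^sub>C (d *\<^sub>C x) = (c * d) *\<^sub>C x"
    and scaleC_one: "1 *\<^sub>C x = x"
    and scaleR_scaleC: "r *\<^sub>R x = complex_of_real r *\<^sub>C x"
    and cinner_commute: "cinner x y = cnj (cinner y x)"
    and cinner_add_left: "cinner (x + y) z = cinner x z + cinner y z"
    and cinner_scaleC_left: "cinner (c *\<^sub>C x) y = c * cinner x y"
    and inner_eq_Re_cinner: "inner x y = Re (cinner x y)"

instantiation complex :: chilbert_space
begin

definition scaleC_complex :: "complex \<Rightarrow> complex \<Rightarrow> complex"
  where "scaleC_complex c x = c * x"

definition cinner_complex :: "complex \<Rightarrow> complex \<Rightarrow> complex"
  where "cinner_complex x y = x * cnj y"

instance
  by standard
    (auto simp: scaleC_complex_def cinner_complex_def algebra_simps scaleR_conv_of_real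
      inner_complex_def)

end

global_interpretation complex_vector: vector_space "scaleC :: complex \<Rightarrow> 'a \<Rightarrow> 'a::chilbert_space"
  defines csubspace = complex_vector.subspace
  by standard (auto simp: scaleC_add_right scaleC_add_left scaleC_scaleC scaleC_one)

definition closed_csubspace :: "'a::chilbert_space set \<Rightarrow> bool"
  where "closed_csubspace L \<longleftrightarrow> csubspace L \<and> closed L"

lemma norm_scaleC: "norm (c *\<^sub>C x) = cmod c * norm (x::'a::chilbert_space)"
proof -
  have n: "(norm y)\<^sup>2 = Re (cinner y y)" for y :: 'a
    by (simp add: power2_norm_eq_inner inner_eq_Re_cinner)
  have im: "Im (cinner x x) = 0"
    using cinner_commute[of x x] by (simp add: complex_eq_iff)
  have r: "cinner y (c *\<^sub>C z) = cnj c * cinner y z" for y z :: 'a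
    by (metis cinner_commute cinner_scaleC_left complex_cnj_cnj complex_cnj_mult)
  have "(norm (c *\<^sub>C x))\<^sup>2 = Re ((c * cnj c) * cinner x x)"
    by (simp add: n r cinner_scaleC_left algebra_simps)
  also have "\<dots> = (cmod c * norm x)\<^sup>2"
    by (simp add: complex_norm_square[symmetric] n power_mult_distrib im)
  finally show ?thesis
    by (metis norm_ge_zero mult_nonneg_nonneg power2_eq_iff_nonneg)
qed


section \<open>Bounded complex-linear operators\<close>

text \<open>The library type \<open>'a \<Rightarrow>\<^sub>L 'a\<close> consists of the bounded real-linear operators.\<close>

definition bounded_clinear_ops :: "('a::chilbert_space \<Rightarrow>\<^sub>L 'a) set"
  where "bounded_clinear_ops = {T. Vector_Spaces.linear scaleC scaleC (blinfun_apply T)}"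

lift_definition scaleC_blinfun ::
    "complex \<Rightarrow> ('a::chilbert_space \<Rightarrow>\<^sub>L 'a) \<Rightarrow> ('a \<Rightarrow>\<^sub>L 'a)"  (infixr \<open>*\<^sub>C\<^sub>L\<close> 75)
  is "\<lambda>c T x. c *\<^sub>C T x"
proof -
  fix c and T :: "'a \<Rightarrow> 'a" assume T: "bounded_linear T"
  have "bounded_linear (\<lambda>x::'a. c *\<^sub>C x)"
    by (rule bounded_linear_intro[where K = "cmod c"])
      (simp_all add: scaleC_add_right scaleR_scaleC scaleC_scaleC mult.commute norm_scaleC)
  then show "bounded_linear (\<lambda>x. c *\<^sub>C T x)"
    using T by (rule bounded_linear_compose)
qed

text \<open>
  The two descriptions below denote for complex-linear \<open>T\<close> (Riesz) and for closed complex
  subspaces \<open>L\<close> (projection theorem), respectively; other arguments are not of interest.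
\<close>

definition cadjoint :: "('a::chilbert_space \<Rightarrow>\<^sub>L 'a) \<Rightarrow> ('a \<Rightarrow>\<^sub>L 'a)"
  where "cadjoint T = (THE S :: 'a \<Rightarrow>\<^sub>L 'a. \<forall>x y. cinner (T x) y = cinner x (S y))"

definition orth_proj :: "'a::chilbert_space set \<Rightarrow> ('a \<Rightarrow>\<^sub>L 'a)"
  where "orth_proj L = (THE P :: 'a \<Rightarrow>\<^sub>L 'a. \<forall>x. P x \<in> L \<and> (\<forall>y\<in>L. cinner (x - P x) y = 0))"

definition spectrum :: "('a::chilbert_space \<Rightarrow>\<^sub>L 'a) \<Rightarrow> complex set"
  where "spectrum F = {\<mu>. \<not> (\<exists>G \<in> bounded_clinear_ops.
      G o\<^sub>L (F - \<mu> *\<^sub>C\<^sub>L id_blinfun) = id_blinfun \<and>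
      (F - \<mu> *\<^sub>C\<^sub>L id_blinfun) o\<^sub>L G = id_blinfun)}"

definition kernel :: "('a::chilbert_space \<Rightarrow>\<^sub>L 'a) \<Rightarrow> 'a set"
  where "kernel T = {x. T x = 0}"



section \<open>Von Neumann algebras\<close>

definition commutant :: "('a::chilbert_space \<Rightarrow>\<^sub>L 'a) set \<Rightarrow> ('a \<Rightarrow>\<^sub>L 'a) set"
  where "commutant S = {T \<in> bounded_clinear_ops. \<forall>X\<in>S. T o\<^sub>L X = X o\<^sub>L T}"

text \<open>
  Dixmier's definition: a \<open>*\<close>-algebra of bounded operators that equals its bicommutant
  (in particular it contains the identity).
\<close>

definition von_neumann_algebra :: "('a::chilbert_space \<Rightarrow>\<^sub>L 'a) set \<Rightarrow> bool"
  where "von_neumann_algebra A \<longleftrightarrow>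
    A \<subseteq> bounded_clinear_ops \<and>
    0 \<in> A \<and>
    (\<forall>S\<in>A. \<forall>T\<in>A. S + T \<in> A) \<and>
    (\<forall>c. \<forall>T\<in>A. c *\<^sub>C\<^sub>L T \<in> A) \<and>
    (\<forall>S\<in>A. \<forall>T\<in>A. S o\<^sub>L T \<in> A) \<and>
    (\<forall>T\<in>A. cadjoint T \<in> A) \<and>
    commutant (commutant A) = A"

definition projections :: "('a::chilbert_space \<Rightarrow>\<^sub>L 'a) set \<Rightarrow> ('a \<Rightarrow>\<^sub>L 'a) set"
  where "projections A = {P \<in> A. P o\<^sub>L P = P \<and> cadjoint P = P}"

definition subprojection :: "('a::chilbert_space \<Rightarrow>\<^sub>L 'a) \<Rightarrow> ('a \<Rightarrow>\<^sub>L 'a) \<Rightarrow> bool"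
  where "subprojection Q P \<longleftrightarrow> range (blinfun_apply Q) \<subseteq> range (blinfun_apply P)"

definition mvn_equivalent ::
    "('a::chilbert_space \<Rightarrow>\<^sub>L 'a) set \<Rightarrow> ('a \<Rightarrow>\<^sub>L 'a) \<Rightarrow> ('a \<Rightarrow>\<^sub>L 'a) \<Rightarrow> bool"
  where "mvn_equivalent A P Q \<longleftrightarrow>
    (\<exists>V\<in>A. cadjoint V o\<^sub>L V = P \<and> V o\<^sub>L cadjoint V = Q)"

definition finite_projections :: "('a::chilbert_space \<Rightarrow>\<^sub>L 'a) set \<Rightarrow> ('a \<Rightarrow>\<^sub>L 'a) set"
  where "finite_projections A = {P \<in> projections A.
    \<not> (\<exists>Q \<in> projections A. subprojection Q P \<and> Q \<noteq> P \<and> mvn_equivalent A P Q)}"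

text \<open>Finiteness of a central projection is relative to \<open>A\<close>, not to the centre.\<close>

definition properly_infinite :: "('a::chilbert_space \<Rightarrow>\<^sub>L 'a) set \<Rightarrow> bool"
  where "properly_infinite A \<longleftrightarrow>
    (\<forall>Z \<in> projections (A \<inter> commutant A). Z \<noteq> 0 \<longrightarrow> Z \<notin> finite_projections A)"


section \<open>Fredholm and generalized Browder operators\<close>

definition direct_decomposition :: "'a::chilbert_space set \<Rightarrow> 'a set \<Rightarrow> bool"
  where "direct_decomposition M N \<longleftrightarrow>
    closed_csubspace M \<and> closed_csubspace N \<and>
    M \<inter> N = {0} \<and> {x + y | x y. x \<in> M \<and> y \<in> N} = UNIV"

text \<open>
  Diagonality of the matrix of \<open>F\<close> with respect to \<open>M\<close> and \<open>N\<close> says that both subspaces are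
  invariant; an isomorphism of closed subspaces is a linear homeomorphism.
\<close>

definition generalized_browder ::
    "('a::chilbert_space \<Rightarrow>\<^sub>L 'a) set \<Rightarrow> ('a \<Rightarrow>\<^sub>L 'a) \<Rightarrow> bool"
  where "generalized_browder A F \<longleftrightarrow> F \<in> A \<and>
    (\<exists>M N. direct_decomposition M N \<and>
      blinfun_apply F ` M \<subseteq> M \<and> blinfun_apply F ` N \<subseteq> N \<and>
      (\<exists>G. homeomorphism M M (blinfun_apply F) G) \<and>
      orth_proj N \<in> finite_projections A)"

definition breuer_fredholm ::
    "('a::chilbert_space \<Rightarrow>\<^sub>L 'a) set \<Rightarrow> ('a \<Rightarrow>\<^sub>L 'a) \<Rightarrow> bool"
  where "breuer_fredholm A T \<longleftrightarrow> T \<in> A \<and>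
    orth_proj (kernel T) \<in> finite_projections A \<and>
    (\<exists>E \<in> finite_projections A.
      range (blinfun_apply (id_blinfun - E)) \<subseteq> range (blinfun_apply T))"

end

theory Submission
  imports Defs
begin

text \<open>
  If \<open>F\<close> is Browder with respect to \<open>M\<close> and \<open>N\<close>, then \<open>F\<close> is bounded below on the orthogonal
  complement of \<open>N\<close>, and the orthogonal complement of \<open>F (N\<^sup>\<bottom>)\<close> is projected
  injectively into \<open>N\<close>; so it is finite, although \<open>M\<close> itself need not belong to the algebra.

  Conversely, let \<open>P\<close> be the spectral idempotent of \<open>F\<close> for a small disc of radius \<open>r\<close> around \<open>0\<close>, and let
  \<open>e\<close> be finite with \<open>e\<^sup>\<bottom>\<close> contained in the range of \<open>F\<close>. The adjoint \<open>F*\<close> is bounded below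
  on \<open>e\<^sup>\<bottom>\<close>, by \<open>c\<close> say. If \<open>r \<le> c\<close>, then \<open>(F*)^n\<close> is smaller than \<open>c^n\<close> on the range of \<open>P*\<close> for some \<open>n\<close>,
  so no nonzero vector of that range is orthogonal to all \<open>F^j e\<close> with \<open>j < n\<close>. Hence the range of \<open>P*\<close>
  embeds into a finite supremum of finite subspaces, which is finite.
\<close>

section \<open>Projections and adjoints in real Hilbert spaces\<close>

text \<open>Relative finiteness admits no dimension count. Its substitute: an element of the algebra
  that is injective on an invariant closed subspace yields, through its polar decomposition, an
  isometric embedding inside the algebra, and finiteness descends along such embeddings. The costly
  ingredient is that two finite subspaces have a finite supremum, which rests on comparing subspaces
  up to a central summand. The adjoint enters because a range inclusion for \<open>F\<close> gives a
  lower bound for \<open>adj F\<close>, not for \<open>F\<close>. So the range of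
  \<open>adj P\<close> is shown to be finite, and the range of \<open>P\<close> follows because
  \<open>adj P\<close> is injective on it. The idempotent \<open>P\<close> is oblique, while
  finiteness is about orthogonal projections; what links them is that \<open>P\<close> commutes with
  every operator that commutes with \<open>F\<close>, so its range and kernel are invariant under
  the commutant and have their orthogonal projections in the algebra.\<close>

lemma nearest_point_exists:
  fixes L :: "'a::{real_inner,banach} set"
  assumes L: "subspace L" "closed L"
  shows "\<exists>p\<in>L. \<forall>y\<in>L. norm (x - p) \<le> norm (x - y)"
proof -
  have "L \<noteq> {}" using subspace_0[OF L(1)] by auto
  define d where "d = infdist x L"
  have d0: "d \<ge> 0" by (simp add: d_def infdist_nonneg)
  have dle: "d \<le> norm (x - y)" if "y \<in> L" for y
    using infdist_le[OF that, of x] by (simp add: d_def dist_norm)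
  have "\<exists>y\<in>L. norm (x - y) < d + e" if "e > 0" for e
  proof -
    have "infdist x L < d + e" using that by (simp add: d_def)
    then show ?thesis using \<open>L \<noteq> {}\<close>
      using cInf_lessD[of "dist x ` L" "d + e"] by (auto simp: infdist_notempty dist_norm)
  qed
  then have "\<forall>n::nat. \<exists>y\<in>L. norm (x - y) < d + inverse (real (Suc n))" by simp
  then obtain p where p: "\<And>n. p n \<in> L" "\<And>n. norm (x - p n) < d + inverse (real (Suc n))"
    by metis
  \<comment> \<open>By the parallelogram law, with the midpoint in \<open>L\<close> and hence at
    distance at least \<open>d\<close> from \<open>x\<close>, the left side is at most
    \<open>4 * (d + e)^2 - 4 * d^2\<close>; \<open>e \<le> 1\<close> makes this linear in
    \<open>e\<close>.\<close>
  have pd: "(norm (p m - p n))\<^sup>2 \<le> (8 * d + 4) * e"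
    if e: "inverse (real (Suc m)) \<le> e" "inverse (real (Suc n)) \<le> e" "e \<le> 1" for m n e
  proof -
    have mid: "(1/2) *\<^sub>R (p m + p n) \<in> L"
      using p L by (simp add: subspace_add subspace_scale)
    have e0: "0 \<le> e" using e(1) by (meson inverse_nonnegative_iff_nonnegative of_nat_0_le_iff order_trans)
    have "(norm (p m - p n))\<^sup>2 = 2 * (norm (x - p m))\<^sup>2 + 2 * (norm (x - p n))\<^sup>2
        - 4 * (norm (x - (1/2) *\<^sub>R (p m + p n)))\<^sup>2"
      by (simp add: power2_norm_eq_inner algebra_simps inner_commute)
    moreover have "(norm (x - p k))\<^sup>2 \<le> (d + e)\<^sup>2" if "inverse (real (Suc k)) \<le> e" for k
      using p(2)[of k] that by (intro power_mono) auto
    moreover have "d\<^sup>2 \<le> (norm (x - (1/2) *\<^sub>R (p m + p n)))\<^sup>2"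
      using dle[OF mid] d0 by (intro power_mono) auto
    ultimately have "(norm (p m - p n))\<^sup>2 \<le> 4 * (d + e)\<^sup>2 - 4 * d\<^sup>2"
      using e(1,2) by (smt (verit, best))
    also have "\<dots> = 8 * d * e + 4 * (e * e)" by (simp add: power2_eq_square algebra_simps)
    also have "\<dots> \<le> (8 * d + 4) * e" using e0 e(3) by (simp add: algebra_simps mult_left_le)
    finally show ?thesis .
  qed
  have "Cauchy p"
  proof (rule metric_CauchyI)
    fix r :: real assume r: "r > 0"
    define e where "e = min 1 (r\<^sup>2 / (2 * (8 * d + 4)))"
    have e: "e > 0" "e \<le> 1" using r d0 by (auto simp: e_def)
    have "(8 * d + 4) * e \<le> (8 * d + 4) * (r\<^sup>2 / (2 * (8 * d + 4)))"
      using d0 by (intro mult_left_mono) (auto simp: e_def)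
    also have "\<dots> = r\<^sup>2 / 2" using d0 by (simp add: field_simps)
    also have "\<dots> < r\<^sup>2" using r by simp
    finally have small: "(8 * d + 4) * e < r\<^sup>2" .
    obtain N where N: "inverse (real (Suc N)) < e" using reals_Archimedean[OF e(1)] by blast
    have le: "inverse (real (Suc n)) \<le> e" if "n \<ge> N" for n
      using N that by (smt (verit) inverse_le_iff_le of_nat_0_less_iff of_nat_mono Suc_le_mono zero_less_Suc)
    show "\<exists>M. \<forall>m\<ge>M. \<forall>n\<ge>M. dist (p m) (p n) < r"
    proof (intro exI allI impI)
      fix m n assume "m \<ge> N" "n \<ge> N"
      then have "(norm (p m - p n))\<^sup>2 < r\<^sup>2" using pd[OF le le e(2)] small by (meson le_less_trans)
      then show "dist (p m) (p n) < r" using r by (simp add: dist_norm power_less_imp_less_base)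
    qed
  qed
  then obtain q where q: "p \<longlonglongrightarrow> q" using Cauchy_convergent convergent_def by blast
  have "q \<in> L" using closed_sequentially[OF L(2) _ q] p(1) by blast
  have "(\<lambda>n. norm (x - p n)) \<longlonglongrightarrow> norm (x - q)" by (intro tendsto_intros q)
  moreover have "(\<lambda>n. d + inverse (real (Suc n))) \<longlonglongrightarrow> d + 0"
    by (intro tendsto_intros LIMSEQ_inverse_real_of_nat)
  ultimately have "norm (x - q) \<le> d + 0"
    by (rule LIMSEQ_le) (use p(2) less_imp_le in blast)
  then show ?thesis using \<open>q \<in> L\<close> dle by force
qed

text \<open>Moving the nearest point by \<open>t *\<^sub>R y\<close> cannot bring it closer to
  \<open>x\<close>. At the minimising \<open>t\<close> this says that the square of
  \<open>(x - p) \<bullet> y\<close> is at most \<open>0\<close>.\<close>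

lemma orthogonal_decomposition_exists:
  fixes L :: "'a::{real_inner,banach} set"
  assumes L: "subspace L" "closed L"
  shows "\<exists>p\<in>L. \<forall>y\<in>L. (x - p) \<bullet> y = 0"
proof -
  obtain p where p: "p \<in> L" "\<And>y. y \<in> L \<Longrightarrow> norm (x - p) \<le> norm (x - y)"
    using nearest_point_exists[OF L] by metis
  have "(x - p) \<bullet> y = 0" if y: "y \<in> L" for y
  proof (cases "y = 0")
    case False
    define t where "t = ((x - p) \<bullet> y) / (y \<bullet> y)"
    have yy: "y \<bullet> y > 0" using False by simp
    have "p + t *\<^sub>R y \<in> L" using p(1) y L by (simp add: subspace_add subspace_scale)
    then have "(norm (x - p))\<^sup>2 \<le> (norm ((x - p) - t *\<^sub>R y))\<^sup>2"
      using p(2) by (metis diff_diff_eq norm_ge_zero power_mono)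
    also have "\<dots> = (norm (x - p))\<^sup>2 - 2 * t * ((x - p) \<bullet> y) + t * t * (y \<bullet> y)"
      by (simp add: power2_norm_eq_inner inner_diff_left inner_diff_right inner_commute algebra_simps)
    also have "t * t * (y \<bullet> y) = t * ((x - p) \<bullet> y)" using yy by (simp add: t_def)
    finally have "t * ((x - p) \<bullet> y) \<le> 0" by simp
    then have "((x - p) \<bullet> y)\<^sup>2 \<le> 0" using yy by (simp add: t_def power2_eq_square divide_le_0_iff)
    then show ?thesis by simp
  qed simp
  with p(1) show ?thesis by blast
qed

section \<open>Orthogonal complements and orthogonal projections\<close>

lemma in_orthogonal_comp_iff: "x \<in> L\<^sup>\<bottom> \<longleftrightarrow> (\<forall>y\<in>L. y \<bullet> x = 0)"
  by (simp add: orthogonal_comp_def orthogonal_def)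

lemma closed_orthogonal_comp: "closed (L\<^sup>\<bottom>)"
proof -
  have "L\<^sup>\<bottom> = (\<Inter>y\<in>L. {x. y \<bullet> x = 0})" by (auto simp: in_orthogonal_comp_iff)
  then show ?thesis by (simp add: closed_INT closed_Collect_eq continuous_intros)
qed

text \<open>Only the real inner product is used, so that the algebra can be treated over the real
  structure; \<open>orth_proj_eq_oproj\<close> identifies it with \<open>orth_proj\<close> on closed
  complex subspaces.\<close>

definition oproj :: "'a::{real_inner,banach} set \<Rightarrow> 'a \<Rightarrow>\<^sub>L 'a"
  where "oproj L = Blinfun (\<lambda>x. THE p. p \<in> L \<and> (\<forall>y\<in>L. (x - p) \<bullet> y = 0))"

lemma oproj_the:
  fixes L :: "'a::{real_inner,banach} set"
  assumes L: "subspace L" "closed L"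
  shows "blinfun_apply (oproj L) = (\<lambda>x. THE p. p \<in> L \<and> (\<forall>y\<in>L. (x - p) \<bullet> y = 0))" (is "_ = ?f")
    and "oproj L x \<in> L \<and> (\<forall>y\<in>L. (x - oproj L x) \<bullet> y = 0)"
    and "p \<in> L \<Longrightarrow> (\<And>y. y \<in> L \<Longrightarrow> (x - p) \<bullet> y = 0) \<Longrightarrow> oproj L x = p"
proof -
  have uniq: "p = q" if "p \<in> L" "q \<in> L" "\<forall>y\<in>L. (x - p) \<bullet> y = 0" "\<forall>y\<in>L. (x - q) \<bullet> y = 0" for p q x
  proof -
    have "p - q \<in> L" using that L by (simp add: subspace_diff)
    then have "(x - p) \<bullet> (p - q) = 0" "(x - q) \<bullet> (p - q) = 0" using that(3,4) by blast+
    then have "(p - q) \<bullet> (p - q) = 0" by (simp add: inner_diff_left)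
    then show ?thesis by simp
  qed
  have P: "?f x \<in> L \<and> (\<forall>y\<in>L. (x - ?f x) \<bullet> y = 0)" for x
    by (rule theI') (use orthogonal_decomposition_exists[OF L, of x] uniq in blast)
  have fI: "?f x = p" if "p \<in> L" "\<forall>y\<in>L. (x - p) \<bullet> y = 0" for x p
    using uniq[OF _ that(1) _ that(2)] P by blast
  have "bounded_linear ?f"
  proof (rule bounded_linear_intro[where K = 1])
    fix x y :: 'a and r :: real
    show "?f (x + y) = ?f x + ?f y"
    proof (rule fI)
      show "?f x + ?f y \<in> L" using P L by (intro subspace_add) auto
      show "\<forall>z\<in>L. (x + y - (?f x + ?f y)) \<bullet> z = 0"
        using P[of x] P[of y] unfolding inner_diff_left inner_add_left by force
    qed
    show "?f (r *\<^sub>R x) = r *\<^sub>R ?f x"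
    proof (rule fI)
      show "r *\<^sub>R ?f x \<in> L" using P L by (intro subspace_scale) auto
      show "\<forall>z\<in>L. (r *\<^sub>R x - r *\<^sub>R ?f x) \<bullet> z = 0"
        using P[of x] unfolding inner_diff_left inner_scaleR_left by simp
    qed
    have "(norm x)\<^sup>2 = (norm (x - ?f x + ?f x))\<^sup>2" by simp
    also have "\<dots> = (norm (x - ?f x))\<^sup>2 + (norm (?f x))\<^sup>2"
      unfolding power2_norm_eq_inner inner_add_left inner_add_right using P[of x]
      by (simp add: inner_commute[of "?f x" "x - ?f x"])
    finally have "(norm (?f x))\<^sup>2 \<le> (norm x)\<^sup>2" by simp
    then show "norm (?f x) \<le> norm x * 1" by (simp only: mult_1_right power2_le_imp_le[OF _ norm_ge_zero])
  qed
  then show *: "blinfun_apply (oproj L) = ?f"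
    by (simp add: oproj_def bounded_linear_Blinfun_apply)
  show "oproj L x \<in> L \<and> (\<forall>y\<in>L. (x - oproj L x) \<bullet> y = 0)" unfolding * by (rule P)
  show "p \<in> L \<Longrightarrow> (\<And>y. y \<in> L \<Longrightarrow> (x - p) \<bullet> y = 0) \<Longrightarrow> oproj L x = p" unfolding * by (intro fI) auto
qed

lemmas oproj_eqI = oproj_the(3)

context
  fixes L :: "'a::{real_inner,banach} set"
  assumes L: "subspace L" "closed L"
begin

lemma oproj_in: "oproj L x \<in> L"
  using oproj_the(2)[OF L] by blast

lemma oproj_orth: "y \<in> L \<Longrightarrow> oproj L x \<bullet> y = x \<bullet> y"
  using oproj_the(2)[OF L, of x] by (simp add: inner_diff_left)

lemma oproj_orth': "y \<in> L \<Longrightarrow> y \<bullet> oproj L x = y \<bullet> x"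
  using oproj_orth by (simp add: inner_commute)

lemma oproj_diff_in: "x - oproj L x \<in> L\<^sup>\<bottom>"
  by (simp add: in_orthogonal_comp_iff inner_diff_right oproj_orth')

lemma oproj_id: "x \<in> L \<Longrightarrow> oproj L x = x"
  by (rule oproj_eqI[OF L]) auto

lemma oproj_eq_id_iff: "oproj L x = x \<longleftrightarrow> x \<in> L"
  using oproj_id oproj_in by metis

lemma range_oproj: "range (oproj L) = L"
  using oproj_in oproj_id by (metis (no_types, opaque_lifting) image_subsetI rangeI subset_antisym subsetI)

lemma oproj_eq_0_iff: "oproj L x = 0 \<longleftrightarrow> x \<in> L\<^sup>\<bottom>"
proof
  assume "oproj L x = 0" then show "x \<in> L\<^sup>\<bottom>" using oproj_diff_in[of x] by simp
next
  assume "x \<in> L\<^sup>\<bottom>" then show "oproj L x = 0"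
    by (intro oproj_eqI[OF L]) (auto simp: in_orthogonal_comp_iff inner_commute subspace_0 L)
qed

lemma oproj_symmetric: "oproj L x \<bullet> y = x \<bullet> oproj L y"
  using oproj_orth[OF oproj_in, of x y] oproj_orth'[OF oproj_in, of x y] by simp

lemma norm_oproj_le: "norm (oproj L x) \<le> norm x"
proof (cases "oproj L x = 0")
  case False
  have "norm (oproj L x) * norm (oproj L x) \<le> norm x * norm (oproj L x)"
    using oproj_orth[OF oproj_in, of x x] norm_cauchy_schwarz[of x "oproj L x"]
    by (simp flip: power2_norm_eq_inner power2_eq_square)
  then show ?thesis using False by simp
qed simp

text \<open>The component of \<open>x\<close> outside \<open>L\<close> is orthogonal both to
  \<open>x\<close> and to its projection, hence to itself.\<close>

lemma orthogonal_comp_orthogonal_comp: "L\<^sup>\<bottom>\<^sup>\<bottom> = L"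
proof
  show "L\<^sup>\<bottom>\<^sup>\<bottom> \<subseteq> L"
  proof
    fix x assume x: "x \<in> L\<^sup>\<bottom>\<^sup>\<bottom>"
    have "(x - oproj L x) \<bullet> x = 0" "(x - oproj L x) \<bullet> oproj L x = 0"
      using oproj_diff_in[of x] x oproj_in[of x]
      by (auto simp: in_orthogonal_comp_iff inner_commute)
    then have "(x - oproj L x) \<bullet> (x - oproj L x) = 0" by (simp add: inner_diff_right)
    then show "x \<in> L" using oproj_in[of x] by simp
  qed
qed (rule orthogonal_comp_subset)

lemma oproj_comp: "oproj (L\<^sup>\<bottom>) x = x - oproj L x"
  by (rule oproj_eqI[OF subspace_orthogonal_comp closed_orthogonal_comp oproj_diff_in])
    (use oproj_in in \<open>auto simp: in_orthogonal_comp_iff\<close>)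

end

lemma orthogonal_comp_closure: "(closure L)\<^sup>\<bottom> = L\<^sup>\<bottom>"
proof
  show "L\<^sup>\<bottom> \<subseteq> (closure L)\<^sup>\<bottom>"
  proof
    fix x assume "x \<in> L\<^sup>\<bottom>"
    then have "L \<subseteq> {y. y \<bullet> x = 0}" by (auto simp: in_orthogonal_comp_iff)
    then have "closure L \<subseteq> {y. y \<bullet> x = 0}"
      by (rule closure_minimal) (simp add: closed_Collect_eq continuous_intros)
    then show "x \<in> (closure L)\<^sup>\<bottom>" by (auto simp: in_orthogonal_comp_iff)
  qed
qed (simp add: orthogonal_comp_anti_mono closure_subset)

lemma orthogonal_comp_inter_self: "x \<in> L \<Longrightarrow> x \<in> L\<^sup>\<bottom> \<Longrightarrow> x = 0"
  by (auto simp: in_orthogonal_comp_iff)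

lemma subspace_closure:
  fixes L :: "'a::real_normed_vector set"
  assumes "subspace L"
  shows "subspace (closure L)"
proof (rule subspaceI)
  show "0 \<in> closure L" using subspace_0[OF assms] closure_subset by blast
next
  fix x y assume "x \<in> closure L" "y \<in> closure L"
  then obtain f g where "\<forall>n. f n \<in> L" "f \<longlonglongrightarrow> x" "\<forall>n. g n \<in> L" "g \<longlonglongrightarrow> y"
    unfolding closure_sequential by blast
  then have "\<forall>n. f n + g n \<in> L" "(\<lambda>n. f n + g n) \<longlonglongrightarrow> x + y"
    by (auto intro: subspace_add[OF assms] tendsto_intros)
  then show "x + y \<in> closure L"
    unfolding closure_sequential by (intro exI[of _ "\<lambda>n. f n + g n"]) simp
next
  fix c :: real and x assume "x \<in> closure L"
  then obtain f where "\<forall>n. f n \<in> L" "f \<longlonglongrightarrow> x"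
    unfolding closure_sequential by blast
  then have "\<forall>n. c *\<^sub>R f n \<in> L" "(\<lambda>n. c *\<^sub>R f n) \<longlonglongrightarrow> c *\<^sub>R x"
    by (auto intro: subspace_scale[OF assms] tendsto_intros)
  then show "c *\<^sub>R x \<in> closure L"
    unfolding closure_sequential by (intro exI[of _ "\<lambda>n. c *\<^sub>R f n"]) simp
qed

text \<open>This turns closures into orthogonal complements, to which invariance under a star-closed
  set passes directly.\<close>

lemma closure_eq_orthogonal_comp:
  fixes L :: "'a::{real_inner,banach} set"
  shows "subspace L \<Longrightarrow> closure L = L\<^sup>\<bottom>\<^sup>\<bottom>"
  by (metis closed_closure orthogonal_comp_closure orthogonal_comp_orthogonal_comp subspace_closure)

section \<open>Riesz representation and adjoints\<close>

lemma riesz_representation: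
  fixes f :: "'a::{real_inner,banach} \<Rightarrow> real"
  assumes f: "bounded_linear f"
  shows "\<exists>z. \<forall>x. f x = x \<bullet> z"
proof (cases "\<forall>x. f x = 0")
  case True then show ?thesis by (auto intro: exI[of _ 0])
next
  case False
  then obtain u where u: "f u \<noteq> 0" by blast
  interpret f: bounded_linear f by fact
  define K where "K = {x. f x = 0}"
  have K: "subspace K" "closed K"
    by (auto simp: K_def subspace_def f.add f.scaleR intro!: closed_Collect_eq continuous_intros
        linear_continuous_on[OF f])
  \<comment> \<open>\<open>w\<close> is normal to the kernel: subtracting \<open>f x / f w\<close>
    times \<open>w\<close> from any \<open>x\<close> leaves a vector of \<open>K\<close>, which is
    orthogonal to \<open>w\<close>.\<close>
  define w where "w = u - oproj K u"
  have fw: "f w = f u" using oproj_in[OF K, of u] by (simp add: w_def f.diff K_def)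
  then have w0: "w \<bullet> w \<noteq> 0" using u by auto
  have w: "w \<in> K\<^sup>\<bottom>" unfolding w_def by (rule oproj_diff_in[OF K])
  have "f x = x \<bullet> ((f w / (w \<bullet> w)) *\<^sub>R w)" for x
  proof -
    have "x - (f x / f w) *\<^sub>R w \<in> K" using u fw by (simp add: K_def f.diff f.scaleR)
    then have "(x - (f x / f w) *\<^sub>R w) \<bullet> w = 0" using w by (simp add: in_orthogonal_comp_iff)
    then have "x \<bullet> w = f x / f w * (w \<bullet> w)" by (simp add: inner_diff_left)
    then show ?thesis using w0 u fw by simp
  qed
  then show ?thesis by blast
qed

text \<open>The adjoint for the real inner product; on complex-linear operators it agrees with
  \<open>cadjoint\<close>.\<close>

definition adj :: "('a::{real_inner,banach} \<Rightarrow>\<^sub>L 'a) \<Rightarrow> 'a \<Rightarrow>\<^sub>L 'a"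
  where "adj T = Blinfun (\<lambda>y. THE z. \<forall>x. T x \<bullet> y = x \<bullet> z)"

lemma inner_left_eqI: "(\<And>x. x \<bullet> y = x \<bullet> z) \<Longrightarrow> y = z"
  by (metis inner_commute vector_eq_ldot)

lemma adj_right:
  fixes T :: "'a::{real_inner,banach} \<Rightarrow>\<^sub>L 'a"
  shows "T x \<bullet> y = x \<bullet> adj T y"
proof -
  let ?f = "\<lambda>y. THE z. \<forall>x. T x \<bullet> y = x \<bullet> z"
  have P: "\<forall>x. T x \<bullet> y = x \<bullet> ?f y" for y
  proof (rule theI')
    have "bounded_linear (\<lambda>x. T x \<bullet> y)"
      by (rule bounded_linear_compose[OF bounded_linear_inner_left blinfun.bounded_linear_right])
    from riesz_representation[OF this] obtain z where z: "\<forall>x. T x \<bullet> y = x \<bullet> z" ..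
    then show "\<exists>!z. \<forall>x. T x \<bullet> y = x \<bullet> z"
      by (rule ex1I, rule_tac inner_left_eqI) (simp add: z)
  qed
  define g where "g = ?f"
  have g: "T x \<bullet> y = x \<bullet> g y" for x y unfolding g_def using P by blast
  have "bounded_linear g"
  proof (rule bounded_linear_intro[where K = "norm T"])
    fix y z :: 'a and r :: real
    show "g (y + z) = g y + g z"
      by (rule inner_left_eqI) (simp only: inner_add_right g[symmetric])
    show "g (r *\<^sub>R y) = r *\<^sub>R g y"
      by (rule inner_left_eqI) (simp only: inner_scaleR_right g[symmetric])
    show "norm (g y) \<le> norm y * norm T"
    proof (cases "g y = 0")
      case False
      have "norm (g y) * norm (g y) = T (g y) \<bullet> y"
        using g by (simp flip: power2_norm_eq_inner power2_eq_square)
      also have "\<dots> \<le> norm (T (g y)) * norm y" by (rule norm_cauchy_schwarz)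
      also have "\<dots> \<le> (norm T * norm (g y)) * norm y"
        by (intro mult_right_mono norm_blinfun) auto
      finally have "norm (g y) * norm (g y) \<le> (norm y * norm T) * norm (g y)"
        by (simp add: mult.commute mult.left_commute)
      then show ?thesis using False by (simp only: mult_le_cancel_right) auto
    qed simp
  qed
  then show ?thesis using g[of x y] by (simp add: adj_def bounded_linear_Blinfun_apply flip: g_def)
qed

lemma adj_left:
  fixes T :: "'a::{real_inner,banach} \<Rightarrow>\<^sub>L 'a"
  shows "adj T x \<bullet> y = x \<bullet> T y"
  by (metis adj_right inner_commute)

lemma adj_eqI:
  fixes S T :: "'a::{real_inner,banach} \<Rightarrow>\<^sub>L 'a"
  shows "(\<And>x y. T x \<bullet> y = x \<bullet> S y) \<Longrightarrow> adj T = S"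
  by (rule blinfun_eqI, rule inner_left_eqI) (metis adj_right)

lemma adj_adj [simp]: "adj (adj T) = T"
  by (rule adj_eqI) (rule adj_left)

lemma adj_compose: "adj (S o\<^sub>L T) = adj T o\<^sub>L adj S"
  by (rule adj_eqI) (simp add: adj_right)

lemma adj_diff: "adj (S - T) = adj S - adj T"
  by (rule adj_eqI) (simp add: adj_right blinfun.diff_left inner_diff_left inner_diff_right)

lemma adj_add: "adj (S + T) = adj S + adj T"
  by (rule adj_eqI) (simp add: adj_right blinfun.add_left inner_add_left inner_add_right)

lemma adj_scaleR: "adj (r *\<^sub>R T) = r *\<^sub>R adj T"
  by (rule adj_eqI) (simp add: adj_right blinfun.scaleR_left)

lemma adj_id: "adj id_blinfun = id_blinfun"
  by (rule adj_eqI) simp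

lemma adj_oproj: "subspace L \<Longrightarrow> closed L \<Longrightarrow> adj (oproj L) = oproj L"
  by (rule adj_eqI) (rule oproj_symmetric)

lemma norm_adj_le:
  fixes T :: "'a::{real_inner,banach} \<Rightarrow>\<^sub>L 'a"
  shows "norm (adj T x) \<le> norm T * norm x"
proof (cases "adj T x = 0")
  case False
  have "norm (adj T x) * norm (adj T x) = x \<bullet> T (adj T x)"
    by (simp flip: adj_left power2_norm_eq_inner power2_eq_square)
  also have "\<dots> \<le> norm x * norm (T (adj T x))" by (rule norm_cauchy_schwarz)
  also have "\<dots> \<le> norm x * (norm T * norm (adj T x))"
    by (intro mult_left_mono norm_blinfun) auto
  finally have "norm (adj T x) * norm (adj T x) \<le> (norm T * norm x) * norm (adj T x)"
    by (simp add: mult.commute mult.left_commute)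
  then show ?thesis using False by (simp only: mult_le_cancel_right) auto
qed simp

section \<open>Square roots\<close>

lemma compose_diff_left: "(A - B) o\<^sub>L X = (A o\<^sub>L X) - (B o\<^sub>L X)"
  and compose_diff_right: "X o\<^sub>L (A - B) = (X o\<^sub>L A) - (X o\<^sub>L B)"
  and compose_add_left: "(A + B) o\<^sub>L X = (A o\<^sub>L X) + (B o\<^sub>L X)"
  and compose_add_right: "X o\<^sub>L (A + B) = (X o\<^sub>L A) + (X o\<^sub>L B)"
  and compose_scaleR_left: "(r *\<^sub>R A) o\<^sub>L X = r *\<^sub>R (A o\<^sub>L X)"
  and compose_scaleR_right: "X o\<^sub>L (r *\<^sub>R A) = r *\<^sub>R (X o\<^sub>L A)"
  and compose_assoc: "(A o\<^sub>L X) o\<^sub>L Y = A o\<^sub>L (X o\<^sub>L Y)"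
  and compose_id_left: "id_blinfun o\<^sub>L X = X"
  and compose_id_right: "X o\<^sub>L id_blinfun = X"
  by (auto intro!: blinfun_eqI simp: blinfun.bilinear_simps)

lemma tendsto_compose_blinfun:
  "(f \<longlongrightarrow> A) F \<Longrightarrow> (g \<longlongrightarrow> B) F \<Longrightarrow> ((\<lambda>n. f n o\<^sub>L g n) \<longlongrightarrow> (A o\<^sub>L B)) F"
  by (rule bounded_bilinear.tendsto[OF bounded_bilinear_blinfun_compose])

text \<open>
  The iteration for \<open>1 - sqrt (1 - Y)\<close>; norms of its increments are dominated by
  the increments of the scalar iteration with \<open>Y = 1\<close>, which increases to \<open>1\<close>.
\<close>

primrec root_iter :: "('a::real_normed_vector \<Rightarrow>\<^sub>L 'a) \<Rightarrow> nat \<Rightarrow> 'a \<Rightarrow>\<^sub>L 'a" where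
  "root_iter Y 0 = 0"
| "root_iter Y (Suc n) = (1/2) *\<^sub>R (Y + (root_iter Y n o\<^sub>L root_iter Y n))"

primrec root_iter_real :: "nat \<Rightarrow> real" where
  "root_iter_real 0 = 0"
| "root_iter_real (Suc n) = (1 + (root_iter_real n)\<^sup>2) / 2"

lemma root_iter_real_bounds: "0 \<le> root_iter_real n \<and> root_iter_real n \<le> 1"
proof (induction n)
  case (Suc n)
  then have "(root_iter_real n)\<^sup>2 \<le> 1" by (simp add: power_le_one)
  then show ?case by simp
qed simp

text \<open>The difference of squares is factored as \<open>Z' (Z' - Z) + (Z' - Z) Z\<close>, which
  is valid without commutation; the scalar iteration satisfies the same formula, so norms are
  dominated factor by factor.\<close>

lemma root_iter_increment:
  assumes "norm Y \<le> 1"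
  shows "norm (root_iter Y n) \<le> root_iter_real n \<and>
    norm (root_iter Y (Suc n) - root_iter Y n) \<le> root_iter_real (Suc n) - root_iter_real n"
proof (induction n)
  case 0
  then show ?case using assms by simp
next
  case (Suc n)
  let ?Z = "root_iter Y" and ?z = root_iter_real
  have le: "norm (?Z (Suc n)) \<le> ?z (Suc n)"
    using norm_triangle_sub[of "?Z (Suc n)" "?Z n"] Suc.IH by linarith
  have "?Z (Suc (Suc n)) - ?Z (Suc n) =
    (1/2) *\<^sub>R (?Z (Suc n) o\<^sub>L ?Z (Suc n)) - (1/2) *\<^sub>R (?Z n o\<^sub>L ?Z n)"
    by (subst root_iter.simps(2)[of Y "Suc n"], subst (3) root_iter.simps(2)[of Y n])
      (simp only: scaleR_add_right add_diff_cancel_left)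
  also have "\<dots> = (1/2) *\<^sub>R ((?Z (Suc n) o\<^sub>L (?Z (Suc n) - ?Z n)) + ((?Z (Suc n) - ?Z n) o\<^sub>L ?Z n))"
    by (simp only: compose_diff_left compose_diff_right scaleR_add_right scaleR_diff_right
        add_diff_eq diff_add_cancel)
  finally have "norm (?Z (Suc (Suc n)) - ?Z (Suc n)) =
      (1/2) * norm ((?Z (Suc n) o\<^sub>L (?Z (Suc n) - ?Z n)) + ((?Z (Suc n) - ?Z n) o\<^sub>L ?Z n))"
    by (simp only: norm_scaleR)
  also have "\<dots> \<le> (1/2) * (norm (?Z (Suc n)) * norm (?Z (Suc n) - ?Z n)
      + norm (?Z (Suc n) - ?Z n) * norm (?Z n))"
    by (intro mult_left_mono order.trans[OF norm_triangle_ineq] add_mono norm_blinfun_compose) simp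
  also have "\<dots> \<le> (1/2) * (?z (Suc n) * (?z (Suc n) - ?z n) + (?z (Suc n) - ?z n) * ?z n)"
  proof -
    have d: "norm (?Z (Suc n) - ?Z n) \<le> ?z (Suc n) - ?z n" using Suc.IH by blast
    have d0: "0 \<le> ?z (Suc n) - ?z n" using d norm_ge_zero order.trans by blast
    have "norm (?Z (Suc n)) * norm (?Z (Suc n) - ?Z n) \<le> ?z (Suc n) * (?z (Suc n) - ?z n)"
      using le d root_iter_real_bounds[of "Suc n"] by (intro mult_mono) auto
    moreover have "norm (?Z (Suc n) - ?Z n) * norm (?Z n) \<le> (?z (Suc n) - ?z n) * ?z n"
      using Suc.IH d d0 by (intro mult_mono) auto
    ultimately show ?thesis by (intro mult_left_mono add_mono) simp_all
  qed
  also have "\<dots> = ((?z (Suc n))\<^sup>2 - (?z n)\<^sup>2) / 2"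
    by (simp add: power2_eq_square algebra_simps del: root_iter_real.simps)
  also have "\<dots> = ?z (Suc (Suc n)) - ?z (Suc n)"
    by (simp add: field_simps)
  finally show ?case using le by blast
qed

text \<open>The scalar iterates increase and stay below \<open>1\<close>, so their increments are
  summable and dominate those of \<open>root_iter Y\<close>.\<close>

lemma root_iter_convergent:
  fixes Y :: "'a::banach \<Rightarrow>\<^sub>L 'a"
  assumes "norm Y \<le> 1"
  obtains Z where "root_iter Y \<longlonglongrightarrow> Z"
proof -
  have "summable (\<lambda>n. root_iter Y (Suc n) - root_iter Y n)"
  proof (rule summable_comparison_test)
    have mono: "incseq root_iter_real"
    proof (rule incseq_SucI)
      fix n
      show "root_iter_real n \<le> root_iter_real (Suc n)"
        using root_iter_increment[OF assms, of n]
          norm_ge_zero[of "root_iter Y (Suc n) - root_iter Y n"] by linarith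
    qed
    obtain l where "root_iter_real \<longlonglongrightarrow> l"
      by (rule incseq_convergent[OF mono, of 1]) (use root_iter_real_bounds in auto)
    then show "summable (\<lambda>n. root_iter_real (Suc n) - root_iter_real n)"
      by (rule telescope_summable)
    show "\<exists>N. \<forall>n\<ge>N. norm (root_iter Y (Suc n) - root_iter Y n)
        \<le> root_iter_real (Suc n) - root_iter_real n"
      using root_iter_increment[OF assms] by blast
  qed
  then have "convergent (\<lambda>n. \<Sum>k<n. root_iter Y (Suc k) - root_iter Y k)"
    by (simp add: summable_iff_convergent)
  then have "convergent (root_iter Y)"
    by (simp only: sum_lessThan_telescope root_iter.simps(1) diff_zero)
  then show thesis using that by (auto simp: convergent_def)
qed

lemma root_iter_commute:
  assumes "X o\<^sub>L Y = Y o\<^sub>L X"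
  shows "X o\<^sub>L root_iter Y n = root_iter Y n o\<^sub>L X"
proof (induction n)
  case 0
  then show ?case by (auto intro!: blinfun_eqI)
next
  case (Suc n)
  then have "X o\<^sub>L (root_iter Y n o\<^sub>L root_iter Y n) = (root_iter Y n o\<^sub>L root_iter Y n) o\<^sub>L X"
    by (metis compose_assoc)
  with assms show ?case by (simp add: compose_add_left compose_add_right compose_scaleR_left compose_scaleR_right)
qed

lemma bounded_linear_adj: "bounded_linear (adj :: ('a::{real_inner,banach} \<Rightarrow>\<^sub>L 'a) \<Rightarrow> _)"
proof (rule bounded_linear_intro[where K = 1])
  show "norm (adj T) \<le> norm T * 1" for T :: "'a \<Rightarrow>\<^sub>L 'a"
    unfolding mult_1_right by (intro norm_blinfun_bound norm_adj_le norm_ge_zero)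
qed (simp_all add: adj_add adj_scaleR)

text \<open>\<open>S\<close> is a square root of \<open>adj T o\<^sub>L T\<close>, obtained as
  \<open>1 - Z\<close> with \<open>2 Z = Y + Z^2\<close> and
  \<open>Y = 1 - adj T o\<^sub>L T\<close>. As \<open>Z\<close> is a norm limit of polynomials in
  \<open>Y\<close>, it commutes with whatever commutes with \<open>T\<close> and
  \<open>adj T\<close>.\<close>

lemma operator_abs:
  fixes T :: "'a::{real_inner,banach} \<Rightarrow>\<^sub>L 'a"
  assumes "norm T \<le> 1"
  obtains S where "adj S = S" "\<And>x. norm (S x) = norm (T x)"
    "\<And>X. X o\<^sub>L T = T o\<^sub>L X \<Longrightarrow> X o\<^sub>L adj T = adj T o\<^sub>L X \<Longrightarrow> X o\<^sub>L S = S o\<^sub>L X"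
proof -
  define Y where "Y = id_blinfun - (adj T o\<^sub>L T)"
  have Yx: "Y x = x - adj T (T x)" for x by (simp add: Y_def blinfun.diff_left)
  \<comment> \<open>In the expanded square the term of \<open>adj T (T x)\<close> is at most
    \<open>(norm (T x))^2\<close>, which the cross term \<open>- 2 * (norm (T x))^2\<close>
    absorbs.\<close>
  have "norm Y \<le> 1"
  proof (rule norm_blinfun_bound)
    fix x
    have "norm (adj T (T x)) \<le> 1 * norm (T x)"
      using norm_adj_le[of T "T x"] mult_right_mono[OF assms norm_ge_zero[of "T x"]] by linarith
    then have "(norm (adj T (T x)))\<^sup>2 \<le> (norm (T x))\<^sup>2" by (intro power_mono) auto
    moreover have "(norm (Y x))\<^sup>2 = (norm x)\<^sup>2 - 2 * (norm (T x))\<^sup>2 + (norm (adj T (T x)))\<^sup>2"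
      using adj_right[of T x "T x"] adj_left[of T "T x" x]
      by (simp add: Yx power2_norm_eq_inner inner_diff_left inner_diff_right)
    ultimately have "(norm (Y x))\<^sup>2 \<le> (norm x)\<^sup>2" using zero_le_power2[of "norm (T x)"] by linarith
    then show "norm (Y x) \<le> 1 * norm x" by (simp only: mult_1_left power2_le_imp_le[OF _ norm_ge_zero])
  qed simp
  then obtain Z where Z: "root_iter Y \<longlonglongrightarrow> Z" by (rule root_iter_convergent)
  have "adj Y = Y" by (simp add: Y_def adj_diff adj_id adj_compose)
  then have "adj (root_iter Y n) = root_iter Y n" for n
    by (induction n) (auto simp: adj_scaleR adj_add adj_compose intro!: adj_eqI)
  then have "root_iter Y \<longlonglongrightarrow> adj Z"
    using bounded_linear.tendsto[OF bounded_linear_adj Z] by simp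
  then have adjZ: "adj Z = Z" by (rule LIMSEQ_unique[OF _ Z])
  have "(\<lambda>n. root_iter Y (Suc n)) \<longlonglongrightarrow> (1/2) *\<^sub>R (Y + (Z o\<^sub>L Z))"
    unfolding root_iter.simps by (intro tendsto_intros tendsto_compose_blinfun Z)
  then have Z_eq: "Z = (1/2) *\<^sub>R (Y + (Z o\<^sub>L Z))" by (rule LIMSEQ_unique[OF LIMSEQ_Suc[OF Z]])
  have Zx: "2 *\<^sub>R Z x = Y x + Z (Z x)" for x
    by (subst Z_eq) (simp add: blinfun.add_left blinfun.scaleR_left)
  define S where "S = id_blinfun - Z"
  show thesis
  proof
    show adjS: "adj S = S" by (simp add: S_def adj_diff adj_id adjZ)
    fix x
    have "S (S x) = x - 2 *\<^sub>R Z x + Z (Z x)"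
      by (simp add: S_def blinfun.diff_left blinfun.diff_right scaleR_2)
    also have "\<dots> = adj T (T x)" by (simp add: Zx Yx)
    finally have "S x \<bullet> S x = T x \<bullet> T x" by (simp add: adj_right adjS)
    then show "norm (S x) = norm (T x)" by (simp add: norm_eq_sqrt_inner)
  next
    fix X assume X: "X o\<^sub>L T = T o\<^sub>L X" "X o\<^sub>L adj T = adj T o\<^sub>L X"
    have "X o\<^sub>L (adj T o\<^sub>L T) = (adj T o\<^sub>L T) o\<^sub>L X" by (metis X compose_assoc)
    then have "X o\<^sub>L Y = Y o\<^sub>L X" by (simp add: Y_def compose_diff_left compose_diff_right compose_id_left compose_id_right)
    then have "X o\<^sub>L root_iter Y n = root_iter Y n o\<^sub>L X" for n by (rule root_iter_commute)
    moreover have "(\<lambda>n. X o\<^sub>L root_iter Y n) \<longlonglongrightarrow> (X o\<^sub>L Z)" "(\<lambda>n. root_iter Y n o\<^sub>L X) \<longlonglongrightarrow> (Z o\<^sub>L X)"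
      by (intro tendsto_compose_blinfun Z tendsto_const)+
    ultimately have "X o\<^sub>L Z = Z o\<^sub>L X" using LIMSEQ_unique by (simp only:) blast
    then show "X o\<^sub>L S = S o\<^sub>L X" by (simp add: S_def compose_diff_left compose_diff_right compose_id_left compose_id_right)
  qed
qed

section \<open>Algebras given as commutants\<close>

text \<open>
  A von Neumann algebra enters through its commutant \<open>C\<close> only. Since \<open>C\<close> contains the
  multiplication by the imaginary unit, complex linearity is a part of \<open>C\<close>-invariance, and it
  suffices to work with the real structure.
\<close>

locale star_closed =
  fixes C :: "('a::{real_inner,banach} \<Rightarrow>\<^sub>L 'a) set"
  assumes adj_in_C: "c \<in> C \<Longrightarrow> adj c \<in> C"
begin

text \<open>For \<open>C\<close> the commutant of a von Neumann algebra this is its bicommutant;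
  complex linearity of the elements then comes from the scalars in \<open>C\<close>.\<close>

definition alg :: "('a \<Rightarrow>\<^sub>L 'a) set"
  where "alg = {T :: 'a \<Rightarrow>\<^sub>L 'a. \<forall>c\<in>C. \<forall>x. T (c x) = c (T x)}"

text \<open>The closed subspaces whose orthogonal projections belong to \<^term>\<open>alg\<close>.\<close>

definition aff :: "'a set \<Rightarrow> bool"
  where "aff L \<longleftrightarrow> subspace L \<and> closed L \<and> (\<forall>c\<in>C. \<forall>x\<in>L. c x \<in> L)"

lemma algD: "T \<in> alg \<Longrightarrow> c \<in> C \<Longrightarrow> blinfun_apply T (c x) = c (T x)"
  by (simp add: alg_def)

lemma affD:
  assumes "aff L"
  shows "subspace L" "closed L" "c \<in> C \<Longrightarrow> x \<in> L \<Longrightarrow> c x \<in> L"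
  using assms by (auto simp: aff_def)

lemma alg_compose: "S \<in> alg \<Longrightarrow> T \<in> alg \<Longrightarrow> S o\<^sub>L T \<in> alg"
  and alg_add: "S \<in> alg \<Longrightarrow> T \<in> alg \<Longrightarrow> S + T \<in> alg"
  and alg_diff: "S \<in> alg \<Longrightarrow> T \<in> alg \<Longrightarrow> S - T \<in> alg"
  and alg_scaleR: "T \<in> alg \<Longrightarrow> r *\<^sub>R T \<in> alg"
  and alg_id: "id_blinfun \<in> alg"
  by (auto simp: alg_def blinfun.bilinear_simps)

lemma alg_adj:
  assumes T: "T \<in> alg"
  shows "adj T \<in> alg"
  unfolding alg_def
proof (intro CollectI ballI allI)
  fix c y assume c: "c \<in> C"
  show "adj T (c y) = c (adj T y)"
  proof (rule inner_left_eqI)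
    fix x
    have "x \<bullet> adj T (c y) = adj c (T x) \<bullet> y" by (simp add: adj_left flip: adj_right)
    also have "\<dots> = T (adj c x) \<bullet> y" using algD[OF T adj_in_C[OF c]] by simp
    also have "\<dots> = x \<bullet> c (adj T y)" by (simp add: adj_left adj_right)
    finally show "x \<bullet> adj T (c y) = x \<bullet> c (adj T y)" .
  qed
qed

lemma aff_0: "aff {0}"
  by (auto simp: aff_def)

lemma aff_Int: "aff L \<Longrightarrow> aff K \<Longrightarrow> aff (L \<inter> K)"
  by (auto simp: aff_def subspace_inter)

text \<open>\<open>L\<close> is an arbitrary invariant set, so that orbits are covered; invariance
  passes to the complement because \<open>C\<close> contains adjoints.\<close>

lemma aff_orthogonal_comp:
  assumes "\<And>c x. c \<in> C \<Longrightarrow> x \<in> L \<Longrightarrow> c x \<in> L"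
  shows "aff (L\<^sup>\<bottom>)"
  unfolding aff_def
proof (intro conjI subspace_orthogonal_comp closed_orthogonal_comp ballI)
  fix c x assume c: "c \<in> C" and x: "x \<in> L\<^sup>\<bottom>"
  show "c x \<in> L\<^sup>\<bottom>"
    using x assms[OF adj_in_C[OF c]] by (auto simp: in_orthogonal_comp_iff simp flip: adj_left)
qed

lemma aff_comp: "aff L \<Longrightarrow> aff (L\<^sup>\<bottom>)"
  by (rule aff_orthogonal_comp) (simp add: affD)

lemma aff_closure:
  assumes "subspace L" "\<And>c x. c \<in> C \<Longrightarrow> x \<in> L \<Longrightarrow> c x \<in> L"
  shows "aff (closure L)"
  using aff_comp[OF aff_orthogonal_comp[of L]] assms by (simp add: closure_eq_orthogonal_comp)

lemma oproj_in_alg: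
  assumes L: "aff L"
  shows "oproj L \<in> alg"
  unfolding alg_def
proof (intro CollectI ballI allI)
  note L' = affD(1,2)[OF L]
  fix c x assume c: "c \<in> C"
  show "oproj L (c x) = c (oproj L x)"
  proof (rule oproj_eqI[OF L'])
    show "c (oproj L x) \<in> L" using affD(3)[OF L c] oproj_in[OF L'] by blast
    fix y assume "y \<in> L"
    moreover have "c (x - oproj L x) \<in> L\<^sup>\<bottom>"
      using affD(3)[OF aff_comp[OF L] c] oproj_diff_in[OF L'] by blast
    ultimately show "(c x - c (oproj L x)) \<bullet> y = 0"
      by (simp add: in_orthogonal_comp_iff blinfun.diff_right inner_commute)
  qed
qed

lemma aff_kernel:
  assumes "T \<in> alg"
  shows "aff {x. T x = 0}"
  using algD[OF assms]
  by (auto simp: aff_def subspace_def blinfun.bilinear_simps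
      intro!: closed_Collect_eq continuous_intros blinfun.continuous_on)

lemma aff_image_closure:
  assumes "T \<in> alg" "aff L"
  shows "aff (closure (T ` L))"
proof (rule aff_closure)
  show "subspace (T ` L)"
    using affD(1)[OF assms(2)] by (rule linear_subspace_image[rotated]) (simp add: blinfun.bounded_linear_right bounded_linear.linear)
  show "c x \<in> T ` L" if "c \<in> C" "x \<in> T ` L" for c x
    using that(2) affD(3)[OF assms(2) that(1)] by (auto simp flip: algD[OF assms(1) that(1)])
qed

section \<open>Isometries in the algebra built from their graphs\<close>

lemma blinfun_closure_image:
  fixes T :: "'a \<Rightarrow>\<^sub>L 'a"
  shows "T ` closure X \<subseteq> closure (T ` X)"
  by (rule image_closure_subset)
    (auto intro: closure_subset[THEN subsetD] blinfun.continuous_on continuous_intros)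

text \<open>With a partial isometry given by its graph, commutation with \<open>C\<close> becomes
  invariance of \<open>G\<close>. The closure of \<open>G\<close> is still the graph of an isometry,
  now with closed domain, and \<open>V\<close> is this isometry preceded by the projection onto its
  domain.\<close>

lemma isometry_extension:
  assumes G: "subspace G" "\<And>x y. (x, y) \<in> G \<Longrightarrow> norm y = norm x"
    "\<And>c x y. c \<in> C \<Longrightarrow> (x, y) \<in> G \<Longrightarrow> (c x, c y) \<in> G"
  obtains V where "V \<in> alg" "\<And>x y. (x, y) \<in> G \<Longrightarrow> V x = y"
    "\<And>x. x \<in> closure (fst ` G) \<Longrightarrow> norm (V x) = norm x"
proof -
  define D where "D = closure (fst ` G)"
  have "subspace (fst ` G)"
    by (rule linear_subspace_image[OF bounded_linear.linear[OF bounded_linear_fst] G(1)])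
  moreover have "c x \<in> fst ` G" if "c \<in> C" "x \<in> fst ` G" for c x
    using that G(3) by force
  ultimately have D: "aff D" unfolding D_def by (rule aff_closure)
  have cG: "subspace (closure G)" by (rule subspace_closure[OF G(1)])
  have "closure G \<subseteq> {p. norm (snd p) = norm (fst p)}"
    by (rule closure_minimal) (use G(2) in \<open>auto intro!: closed_Collect_eq continuous_intros\<close>)
  then have iso: "norm y = norm x" if "(x, y) \<in> closure G" for x y
    using that by auto
  have inv: "(c x, c y) \<in> closure G" if "c \<in> C" "(x, y) \<in> closure G" for c x y
  proof -
    have "(\<lambda>p. (c (fst p), c (snd p))) ` closure G \<subseteq> closure G"
      using G(3)[OF that(1)] closure_subset[of G]
      by (intro image_closure_subset) (force intro!: continuous_intros blinfun.continuous_on)+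
    then show ?thesis using that(2) by force
  qed
  \<comment> \<open>Differences of points of \<open>G\<close> lie in \<open>G\<close>, so values
    along a convergent sequence of arguments form a Cauchy sequence.\<close>
  have ex: "\<exists>v. (x, v) \<in> closure G" if "x \<in> D" for x
  proof -
    have "\<exists>f. (\<forall>n. f n \<in> fst ` G) \<and> f \<longlonglongrightarrow> x"
      using that unfolding D_def by (simp only: closure_sequential)
    then obtain f where f: "\<forall>n. f n \<in> fst ` G" "f \<longlonglongrightarrow> x" by (elim exE conjE)
    have "\<forall>n. \<exists>y. (f n, y) \<in> G"
    proof
      fix n
      have "f n \<in> fst ` G" using f(1) ..
      then show "\<exists>y. (f n, y) \<in> G" by force
    qed
    from choice[OF this] obtain g where g: "\<And>n. (f n, g n) \<in> G" by blast
    have "norm (g m - g n) = norm (f m - f n)" for m n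
      using G(2)[of "f m - f n" "g m - g n"] subspace_diff[OF G(1) g[of m] g[of n]] by simp
    then have "Cauchy g"
      using LIMSEQ_imp_Cauchy[OF f(2)] by (simp add: Cauchy_def dist_norm)
    then obtain v where "g \<longlonglongrightarrow> v" using Cauchy_convergent convergent_def by blast
    then have "(\<lambda>n. (f n, g n)) \<longlonglongrightarrow> (x, v)" using f(2) by (intro tendsto_Pair)
    then have "\<exists>p. (\<forall>n. p n \<in> G) \<and> p \<longlonglongrightarrow> (x, v)"
      using g by (intro exI[of _ "\<lambda>n. (f n, g n)"]) simp
    then have "(x, v) \<in> closure G" by (simp only: closure_sequential)
    then show ?thesis ..
  qed
  have uniq: "v = w" if "(x, v) \<in> closure G" "(x, w) \<in> closure G" for x v w
    using iso[of 0 "v - w"] subspace_diff[OF cG that] by simp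
  define h where "h x = (THE v. (x, v) \<in> closure G)" for x
  have h: "(x, h x) \<in> closure G" if "x \<in> D" for x
    unfolding h_def by (rule theI') (use ex[OF that] uniq in blast)
  have hI: "h x = v" if "(x, v) \<in> closure G" for x v
    unfolding h_def by (rule the_equality) (use that uniq in blast)+
  note D' = affD(1,2)[OF D]
  have "bounded_linear (\<lambda>x. h (oproj D x))"
  proof (rule bounded_linear_intro[where K = 1])
    fix x y :: 'a and r :: real
    show "h (oproj D (x + y)) = h (oproj D x) + h (oproj D y)"
      using subspace_add[OF cG h h] oproj_in[OF D'] by (intro hI) (auto simp: blinfun.add_right)
    show "h (oproj D (r *\<^sub>R x)) = r *\<^sub>R h (oproj D x)"
      using subspace_scale[OF cG h, of _ r] oproj_in[OF D'] by (intro hI) (auto simp: blinfun.scaleR_right)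
    show "norm (h (oproj D x)) \<le> norm x * 1"
      using iso[OF h[OF oproj_in[OF D', of x]]] norm_oproj_le[OF D'] by simp
  qed
  then have V: "blinfun_apply (Blinfun (\<lambda>x. h (oproj D x))) = (\<lambda>x. h (oproj D x))"
    by (rule bounded_linear_Blinfun_apply)
  show thesis
  proof
    show "Blinfun (\<lambda>x. h (oproj D x)) \<in> alg"
      using algD[OF oproj_in_alg[OF D]] inv[OF _ h[OF oproj_in[OF D']]]
      by (auto simp: alg_def V intro!: hI)
    show "Blinfun (\<lambda>x. h (oproj D x)) x = y" if "(x, y) \<in> G" for x y
    proof -
      have "x \<in> D" using that closure_subset[of "fst ` G"] unfolding D_def by force
      then show ?thesis using that closure_subset[of G] unfolding V by (auto simp: oproj_id[OF D'] intro!: hI)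
    qed
    show "norm (Blinfun (\<lambda>x. h (oproj D x)) x) = norm x" if "x \<in> closure (fst ` G)" for x
      using that iso[OF h] unfolding V by (fold D_def) (simp add: oproj_id[OF D'])
  qed
qed

text \<open>Murray--von Neumann subequivalence of the projections onto \<open>L\<close> and \<open>K\<close>.\<close>

definition emb :: "'a set \<Rightarrow> 'a set \<Rightarrow> bool"
  where "emb L K \<longleftrightarrow> (\<exists>V\<in>alg. (\<forall>x\<in>L. norm (V x) = norm x) \<and> V ` L \<subseteq> K)"

text \<open>The isometry is the one in the polar decomposition of the restriction of \<open>T\<close> to \<open>L\<close>.\<close>

lemma emb_of_injective:
  assumes T: "T \<in> alg" and L: "aff L" and inj: "\<And>x. x \<in> L \<Longrightarrow> T x = 0 \<Longrightarrow> x = 0"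
    and K: "closed K" "subspace K" "T ` L \<subseteq> K"
  shows "emb L K"
proof -
  note L' = affD(1,2)[OF L]
  \<comment> \<open>The factor brings the norm of the compressed operator to at most
    \<open>1\<close>, as \<open>operator_abs\<close> requires; the summand \<open>1\<close> covers a
    zero operator.\<close>
  define r where "r = inverse (norm (T o\<^sub>L oproj L) + 1)"
  have r: "r > 0" unfolding r_def by (simp add: add_nonneg_pos)
  define T' where "T' = r *\<^sub>R (T o\<^sub>L oproj L)"
  have T': "T' \<in> alg" unfolding T'_def by (intro alg_scaleR alg_compose T oproj_in_alg L)
  have T'x: "T' x = r *\<^sub>R T (oproj L x)" for x by (simp add: T'_def blinfun.scaleR_left)
  have "norm T' \<le> 1" by (simp add: T'_def r_def divide_simps add_nonneg_pos)
  then obtain S where S: "adj S = S" "\<And>x. norm (S x) = norm (T' x)"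
    "\<And>X. X o\<^sub>L T' = T' o\<^sub>L X \<Longrightarrow> X o\<^sub>L adj T' = adj T' o\<^sub>L X \<Longrightarrow> X o\<^sub>L S = S o\<^sub>L X"
    by (rule operator_abs) blast
  have Sc: "S (c x) = c (S x)" if c: "c \<in> C" for c x
  proof -
    have "c o\<^sub>L S = S o\<^sub>L c"
      by (rule S(3)) (auto intro!: blinfun_eqI simp: algD[OF T' c] algD[OF alg_adj[OF T'] c])
    then show ?thesis by (metis blinfun_apply_blinfun_compose)
  qed
  define G where "G = range (\<lambda>x. (S x, T' x))"
  have G: "subspace G" unfolding G_def
    by (rule linear_subspace_image[OF _ subspace_UNIV]) (auto intro!: linearI simp: blinfun.bilinear_simps)
  obtain V where V: "V \<in> alg" "\<And>x y. (x, y) \<in> G \<Longrightarrow> V x = y"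
    "\<And>x. x \<in> closure (fst ` G) \<Longrightarrow> norm (V x) = norm x"
  proof (rule isometry_extension[OF G])
    show "norm y = norm x" if "(x, y) \<in> G" for x y
      using that S(2) by (auto simp: G_def)
    show "(c x, c y) \<in> G" if "c \<in> C" "(x, y) \<in> G" for c x y
      using that Sc[OF that(1), symmetric] algD[OF T' that(1), symmetric] by (auto simp: G_def)
  qed blast
  have rS: "fst ` G = range S" by (auto simp: G_def image_image)
  have "closure (range S) = (range S)\<^sup>\<bottom>\<^sup>\<bottom>"
    by (intro closure_eq_orthogonal_comp linear_subspace_image[OF _ subspace_UNIV])
      (simp add: blinfun.bounded_linear_right bounded_linear.linear)
  \<comment> \<open>Since \<open>S\<close> is self-adjoint, the complement of its range is its
    kernel, and injectivity of \<open>T\<close> on \<open>L\<close> makes this kernel the complement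
    of \<open>L\<close>. So the closed domain of the isometry is exactly \<open>L\<close>.\<close>
  also have "(range S)\<^sup>\<bottom> = L\<^sup>\<bottom>"
  proof -
    have "y \<in> (range S)\<^sup>\<bottom> \<longleftrightarrow> S y = 0" for y
      using S(1) by (auto simp: in_orthogonal_comp_iff adj_right) (metis inner_eq_zero_iff)
    moreover have "S y = 0 \<longleftrightarrow> y \<in> L\<^sup>\<bottom>" for y
    proof -
      have "S y = 0 \<longleftrightarrow> T (oproj L y) = 0"
        using S(2)[of y] r norm_eq_zero[of "S y"] norm_eq_zero[of "T' y"] by (simp add: T'x)
      also have "\<dots> \<longleftrightarrow> oproj L y = 0" using inj[OF oproj_in[OF L']] by auto
      finally show ?thesis by (simp add: oproj_eq_0_iff[OF L'])
    qed
    ultimately show ?thesis by blast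
  qed
  finally have cl: "closure (fst ` G) = L" unfolding rS by (simp add: orthogonal_comp_orthogonal_comp[OF L'])
  have "V ` L \<subseteq> closure (V ` fst ` G)" unfolding cl[symmetric] by (rule blinfun_closure_image)
  also have "\<dots> \<subseteq> K"
  proof (rule closure_minimal[OF _ K(1)])
    show "V ` fst ` G \<subseteq> K"
    proof clarsimp
      fix x y assume xy: "(x, y) \<in> G"
      then obtain z where "y = r *\<^sub>R T (oproj L z)" by (auto simp: G_def T'x)
      then show "V x \<in> K" using K(2,3) oproj_in[OF L'] V(2)[OF xy] by (auto intro!: subspace_scale)
    qed
  qed
  finally show ?thesis using V(1,3) unfolding emb_def cl by blast
qed

end

lemma isometry_inner:
  fixes V :: "'a::real_inner \<Rightarrow>\<^sub>L 'a"
  assumes "subspace L" "\<And>x. x \<in> L \<Longrightarrow> norm (V x) = norm x" "x \<in> L" "y \<in> L"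
  shows "V x \<bullet> V y = x \<bullet> y"
  using assms(2)[OF subspace_add[OF assms(1,3,4)]] assms(2)[OF assms(3)] assms(2)[OF assms(4)]
  by (simp add: dot_norm blinfun.add_right)

lemma norm_add_orthogonal:
  fixes x y x' y' :: "'a::real_inner"
  assumes "x \<bullet> y = 0" "x' \<bullet> y' = 0" "norm x' = norm x" "norm y' = norm y"
  shows "norm (x' + y') = norm (x + y)"
proof -
  have "x' \<bullet> x' = x \<bullet> x" "y' \<bullet> y' = y \<bullet> y" using assms(3,4) by (simp_all add: norm_eq)
  with assms(1,2) show ?thesis by (simp add: norm_eq inner_add_left inner_add_right inner_commute)
qed

context star_closed
begin

section \<open>Finite subspaces\<close>

text \<open>An isometry of \<open>L\<close> into itself, preceded by the projection onto
  \<open>L\<close>, is a partial isometry onto a subprojection. Thus this is Murray-von Neumann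
  finiteness in terms of subspaces; see \<open>finite_projections_oproj_iff\<close>.\<close>

definition fin :: "'a set \<Rightarrow> bool"
  where "fin L \<longleftrightarrow> aff L \<and>
    (\<forall>V\<in>alg. (\<forall>x\<in>L. norm (V x) = norm x) \<and> V ` L \<subseteq> L \<longrightarrow> V ` L = L)"

lemma fin_aff: "fin L \<Longrightarrow> aff L"
  by (simp add: fin_def)

lemma finD:
  assumes "fin L" "V \<in> alg" "\<And>x. x \<in> L \<Longrightarrow> norm (V x) = norm x" "\<And>x. x \<in> L \<Longrightarrow> V x \<in> L"
  shows "V ` L = L"
proof -
  have "V ` L \<subseteq> L" using assms(4) by auto
  then show ?thesis using assms(1-3) by (simp add: fin_def)
qed

lemma embI:
  assumes "V \<in> alg" "\<And>x. x \<in> L \<Longrightarrow> norm (V x) = norm x" "\<And>x. x \<in> L \<Longrightarrow> V x \<in> K"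
  shows "emb L K"
  unfolding emb_def using assms by (intro bexI[of _ V]) auto

lemma embE:
  assumes "emb L K"
  obtains V where "V \<in> alg" "\<And>x. x \<in> L \<Longrightarrow> norm (V x) = norm x" "\<And>x. x \<in> L \<Longrightarrow> V x \<in> K"
  using assms unfolding emb_def by auto

lemma isometry_left_inverse:
  assumes L: "aff L" and V: "V \<in> alg" "\<And>x. x \<in> L \<Longrightarrow> norm (V x) = norm x" and x: "x \<in> L"
  shows "(oproj L o\<^sub>L adj V) (V x) = x"
proof -
  note L' = affD(1,2)[OF L]
  have "oproj L (adj V (V x)) = x"
  proof (rule oproj_eqI[OF L' x])
    fix y assume "y \<in> L"
    then show "(adj V (V x) - x) \<bullet> y = 0"
      using isometry_inner[OF L'(1) V(2) x] by (simp add: inner_diff_left adj_left)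
  qed
  then show ?thesis by simp
qed

lemma aff_isometric_image:
  assumes L: "aff L" and V: "V \<in> alg" "\<And>x. x \<in> L \<Longrightarrow> norm (V x) = norm x"
  shows "aff (V ` L)"
proof -
  note L' = affD(1,2)[OF L]
  have "complete (V ` L)"
    by (rule complete_isometric_image[of 1, OF _ L'(1) blinfun.bounded_linear_right])
      (use V(2) L'(2) in \<open>auto simp: complete_eq_closed\<close>)
  then have "closure (V ` L) = V ` L" by (simp add: complete_eq_closed)
  then show ?thesis using aff_image_closure[OF V(1) L] by simp
qed

text \<open>A self-isometry \<open>V\<close> of \<open>L\<close> is carried by \<open>W\<close> to
  the copy \<open>W L\<close> inside \<open>K\<close> and extended by the identity on the rest of
  \<open>K\<close>. Finiteness of \<open>K\<close> makes the extension onto, and discarding the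
  identity part makes \<open>V\<close> onto.\<close>

lemma emb_fin:
  assumes L: "aff L" and K: "fin K" and emb: "emb L K"
  shows "fin L"
  unfolding fin_def
proof (intro conjI L ballI impI, elim conjE)
  fix V assume V: "V \<in> alg" "\<forall>x\<in>L. norm (V x) = norm x" "V ` L \<subseteq> L"
  obtain W where W: "W \<in> alg" "\<And>x. x \<in> L \<Longrightarrow> norm (W x) = norm x" "\<And>x. x \<in> L \<Longrightarrow> W x \<in> K"
    using emb by (rule embE) blast
  define K1 where "K1 = W ` L"
  have K1: "aff K1" unfolding K1_def by (rule aff_isometric_image[OF L W(1,2)])
  note L' = affD(1,2)[OF L] and K' = affD(1,2)[OF fin_aff[OF K]] and K1' = affD(1,2)[OF K1]
  \<comment> \<open>On \<open>K1\<close> the factor \<open>oproj L o\<^sub>L adj W\<close> inverts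
    \<open>W\<close>, so the first summand is the conjugate of \<open>V\<close>; the second is the
    identity off \<open>K1\<close>.\<close>
  define U where "U = (W o\<^sub>L V o\<^sub>L (oproj L o\<^sub>L adj W) o\<^sub>L oproj K1) + (id_blinfun - oproj K1)"
  have U: "U \<in> alg" unfolding U_def
    by (intro alg_add alg_diff alg_compose alg_id W V alg_adj oproj_in_alg L K1)
  have Ux: "\<exists>l\<in>L. oproj K1 x = W l \<and> U x = W (V l) + (x - oproj K1 x)" for x
  proof -
    obtain l where l: "l \<in> L" "oproj K1 x = W l" using oproj_in[OF K1', of x] by (auto simp: K1_def)
    then show ?thesis using isometry_left_inverse[OF L W(1,2) l(1)]
      by (intro bexI[of _ l]) (auto simp: U_def blinfun.bilinear_simps)
  qed
  have WV: "W (V l) \<in> K1" if "l \<in> L" for l using that V(3) by (auto simp: K1_def)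
  have "U ` K = K"
  proof (rule finD[OF K U])
    fix x assume x: "x \<in> K"
    obtain l where l: "l \<in> L" "oproj K1 x = W l" "U x = W (V l) + (x - oproj K1 x)" using Ux by blast
    have K1K: "K1 \<subseteq> K" using W(3) by (auto simp: K1_def)
    have "V l \<in> L" using l(1) V(3) by blast
    then have n: "norm (W (V l)) = norm (W l)" using W(2) V(2) l(1) by simp
    have o: "k \<bullet> (x - oproj K1 x) = 0" if "k \<in> K1" for k
      using oproj_diff_in[OF K1', of x] that by (simp add: in_orthogonal_comp_iff)
    have "norm (U x) = norm (oproj K1 x + (x - oproj K1 x))"
      unfolding l(3) by (rule norm_add_orthogonal[OF o[OF oproj_in[OF K1']] o[OF WV[OF l(1)]]]) (use n l(2) in simp_all)
    then show "norm (U x) = norm x" by simp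
    show "U x \<in> K" unfolding l(3)
      using WV[OF l(1)] K1K x oproj_in[OF K1', of x] by (intro subspace_add subspace_diff K'(1)) auto
  qed
  show "V ` L = L"
  proof
    show "L \<subseteq> V ` L"
    proof
      fix y assume y: "y \<in> L"
      then have "W y \<in> U ` K" using W(3) \<open>U ` K = K\<close> by simp
      then obtain x where x: "x \<in> K" "W y = U x" by blast
      obtain l where l: "l \<in> L" "U x = W (V l) + (x - oproj K1 x)" using Ux by blast
      \<comment> \<open>A preimage of \<open>W y\<close> under \<open>U\<close> has no component
        outside \<open>K1\<close>, since that component equals a vector of
        \<open>K1\<close>.\<close>
      have "x - oproj K1 x = W y - W (V l)" using x l by simp
      moreover have "W y - W (V l) \<in> K1"
        using WV[OF l(1)] y by (intro subspace_diff K1'(1)) (auto simp: K1_def)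
      moreover have "x - oproj K1 x \<in> K1\<^sup>\<bottom>" by (rule oproj_diff_in[OF K1'])
      ultimately have "W y - W (V l) = 0" using orthogonal_comp_inter_self by metis
      moreover have "y - V l \<in> L" using y l(1) V(3) by (intro subspace_diff L'(1)) auto
      ultimately have "norm (y - V l) = 0" using W(2)[of "y - V l"] by (simp add: blinfun.diff_right)
      then show "y \<in> V ` L" using l(1) by auto
    qed
  qed (rule V(3))
qed

lemma fin_subset: "aff L \<Longrightarrow> L \<subseteq> K \<Longrightarrow> fin K \<Longrightarrow> fin L"
  using embI[OF alg_id, of L K] emb_fin[of L K] by auto

text \<open>The operator \<open>oproj L o\<^sub>L adj T\<close> leads back into \<open>L\<close> and
  is injective on the closure, because a vector it kills is orthogonal to
  \<open>T L\<close>.\<close>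

lemma fin_image_closure:
  assumes T: "T \<in> alg" and L: "fin L"
  shows "fin (closure (T ` L))"
proof (rule emb_fin[OF aff_image_closure[OF T fin_aff[OF L]] L])
  note L' = affD(1,2)[OF fin_aff[OF L]]
  show "emb (closure (T ` L)) L"
  proof (rule emb_of_injective[of "oproj L o\<^sub>L adj T", OF _ _ _ L'(2,1)])
    show "oproj L o\<^sub>L adj T \<in> alg" "aff (closure (T ` L))"
      by (intro alg_compose oproj_in_alg alg_adj aff_image_closure T fin_aff L)+
    fix x assume x: "x \<in> closure (T ` L)" and "(oproj L o\<^sub>L adj T) x = 0"
    then have "adj T x \<in> L\<^sup>\<bottom>" by (simp add: oproj_eq_0_iff[OF L'])
    then have "x \<in> (T ` L)\<^sup>\<bottom>" by (auto simp: in_orthogonal_comp_iff adj_right)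
    then have "x \<in> (closure (T ` L))\<^sup>\<bottom>" by (simp add: orthogonal_comp_closure)
    then show "x = 0" using x by (metis orthogonal_comp_inter_self)
  qed (use oproj_in[OF L'] in auto)
qed

section \<open>Comparison\<close>

lemma aff_Inter: "(\<And>L. L \<in> \<L> \<Longrightarrow> aff L) \<Longrightarrow> aff (\<Inter>\<L>)"
  by (auto simp: aff_def subspace_Inter)

lemma invariant_orthogonal_comp:
  assumes "\<And>T x. T \<in> alg \<Longrightarrow> x \<in> w \<Longrightarrow> T x \<in> w" "T \<in> alg" "x \<in> w\<^sup>\<bottom>"
  shows "T x \<in> w\<^sup>\<bottom>"
  using assms(3) assms(1)[OF alg_adj[OF assms(2)]]
  by (auto simp: in_orthogonal_comp_iff simp flip: adj_left)

text \<open>A subspace invariant under all of \<open>alg\<close> has an invariant complement,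
  because \<open>alg\<close> contains adjoints; hence its projection is central.\<close>

lemma oproj_central:
  assumes w: "aff w" "\<And>T x. T \<in> alg \<Longrightarrow> x \<in> w \<Longrightarrow> T x \<in> w" and T: "T \<in> alg"
  shows "oproj w (T x) = T (oproj w x)"
proof (rule oproj_eqI)
  note w' = affD(1,2)[OF w(1)]
  show "subspace w" "closed w" by (fact w')+
  show "T (oproj w x) \<in> w" using w(2)[OF T] oproj_in[OF w'] by blast
  have "T (x - oproj w x) \<in> w\<^sup>\<bottom>"
    by (rule invariant_orthogonal_comp[OF w(2) T oproj_diff_in[OF w']])
  then show "(T x - T (oproj w x)) \<bullet> y = 0" if "y \<in> w" for y
    using that by (simp add: in_orthogonal_comp_iff blinfun.diff_right inner_commute)
qed

text \<open>Zorn's lemma gives a partial isometry from part of \<open>a\<close> to part of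
  \<open>b\<close> that cannot be enlarged. An element of \<open>alg\<close> acting non-trivially
  from the remainder of \<open>a\<close> to the remainder of \<open>b\<close> would enlarge it, by
  the isometry obtained from its restriction to the complement of its kernel.\<close>

lemma maximal_isometry:
  assumes a: "aff a" and b: "aff b"
  obtains a1 V where "aff a1" "a1 \<subseteq> a" "V \<in> alg" "\<And>x. x \<in> a1 \<Longrightarrow> norm (V x) = norm x"
    "\<And>x. x \<in> a1 \<Longrightarrow> V x \<in> b"
    "\<And>T x. T \<in> alg \<Longrightarrow> x \<in> a \<inter> a1\<^sup>\<bottom> \<Longrightarrow> oproj (b \<inter> (V ` a1)\<^sup>\<bottom>) (T x) = 0"
proof -
  \<comment> \<open>Graphs in this family are not assumed closed, so unions of chains stay in it;
    the domain is closed up only for the maximal element.\<close>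
  define \<G> where "\<G> = {G. subspace G \<and> (\<forall>p\<in>G. norm (snd p) = norm (fst p) \<and> fst p \<in> a \<and> snd p \<in> b)
    \<and> (\<forall>c\<in>C. \<forall>p\<in>G. (blinfun_apply c (fst p), blinfun_apply c (snd p)) \<in> G)}"
  have "\<exists>M\<in>\<G>. \<forall>X\<in>\<G>. M \<subseteq> X \<longrightarrow> X = M"
  proof (rule subset_Zorn_nonempty)
    have "{0} \<in> \<G>" using subspace_0[OF affD(1)[OF a]] subspace_0[OF affD(1)[OF b]]
      by (auto simp: \<G>_def subspace_def blinfun.zero_right zero_prod_def)
    then show "\<G> \<noteq> {}" by blast
    fix \<C> assume ne: "\<C> \<noteq> {}" and ch: "subset.chain \<G> \<C>"
    then have sub: "\<C> \<subseteq> \<G>" and lin: "\<And>X Y. X \<in> \<C> \<Longrightarrow> Y \<in> \<C> \<Longrightarrow> X \<subseteq> Y \<or> Y \<subseteq> X"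
      by (auto simp: subset_chain_def)
    have sp: "subspace X" if "X \<in> \<C>" for X using that sub by (auto simp: \<G>_def)
    have "subspace (\<Union>\<C>)"
    proof (rule subspaceI)
      show "0 \<in> \<Union>\<C>" using ne subspace_0[OF sp] by blast
      fix x y assume "x \<in> \<Union>\<C>" "y \<in> \<Union>\<C>"
      then obtain X Y where XY: "X \<in> \<C>" "Y \<in> \<C>" "x \<in> X" "y \<in> Y" by blast
      then obtain Z where "Z \<in> \<C>" "x \<in> Z" "y \<in> Z" using lin[OF XY(1,2)] by blast
      then show "x + y \<in> \<Union>\<C>" using subspace_add[OF sp] by blast
    next
      fix c :: real and x assume "x \<in> \<Union>\<C>"
      then show "c *\<^sub>R x \<in> \<Union>\<C>" using subspace_scale[OF sp] by blast
    qed
    moreover have "\<forall>p\<in>\<Union>\<C>. norm (snd p) = norm (fst p) \<and> fst p \<in> a \<and> snd p \<in> b"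
      using sub by (auto simp: \<G>_def)
    moreover have "\<forall>c\<in>C. \<forall>p\<in>\<Union>\<C>. (blinfun_apply c (fst p), blinfun_apply c (snd p)) \<in> \<Union>\<C>"
      using sub by (fastforce simp: \<G>_def)
    ultimately show "\<Union>\<C> \<in> \<G>" by (simp add: \<G>_def)
  qed
  then obtain G where G: "G \<in> \<G>" and max: "\<And>X. X \<in> \<G> \<Longrightarrow> G \<subseteq> X \<Longrightarrow> X = G" by blast
  have sG: "subspace G" and G1: "\<And>x y. (x, y) \<in> G \<Longrightarrow> norm y = norm x"
    and G2: "\<And>x y. (x, y) \<in> G \<Longrightarrow> x \<in> a" "\<And>x y. (x, y) \<in> G \<Longrightarrow> y \<in> b"
    and G3: "\<And>c x y. c \<in> C \<Longrightarrow> (x, y) \<in> G \<Longrightarrow> (c x, c y) \<in> G"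
    using G by (force simp: \<G>_def)+
  obtain V where V: "V \<in> alg" "\<And>x y. (x, y) \<in> G \<Longrightarrow> V x = y"
    "\<And>x. x \<in> closure (fst ` G) \<Longrightarrow> norm (V x) = norm x"
    by (rule isometry_extension[OF sG G1 G3]) auto
  define a1 where "a1 = closure (fst ` G)"
  have fstG: "x \<in> a1" if "(x, y) \<in> G" for x y
    using that closure_subset[of "fst ` G"] unfolding a1_def by force
  have a1: "aff a1" unfolding a1_def
  proof (rule aff_closure)
    show "subspace (fst ` G)"
      by (rule linear_subspace_image[OF bounded_linear.linear[OF bounded_linear_fst] sG])
    show "c x \<in> fst ` G" if "c \<in> C" "x \<in> fst ` G" for c x
      using that G3 by force
  qed
  have a1a: "a1 \<subseteq> a" unfolding a1_def
    by (rule closure_minimal) (use G2(1) affD(2)[OF a] in auto)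
  have "V ` a1 \<subseteq> closure (V ` fst ` G)" unfolding a1_def by (rule blinfun_closure_image)
  also have "\<dots> \<subseteq> b"
    by (rule closure_minimal) (use G2(2) V(2) affD(2)[OF b] in auto)
  finally have Vb: "V x \<in> b" if "x \<in> a1" for x using that by blast
  have Va1: "aff (V ` a1)" by (rule aff_isometric_image[OF a1 V(1)]) (simp add: a1_def V(3))
  define a2 where "a2 = a \<inter> a1\<^sup>\<bottom>"
  define b2 where "b2 = b \<inter> (V ` a1)\<^sup>\<bottom>"
  have a2: "aff a2" and b2: "aff b2" unfolding a2_def b2_def by (intro aff_Int a b aff_comp a1 Va1)+
  note a2' = affD(1,2)[OF a2] and b2' = affD(1,2)[OF b2]
  have "oproj b2 (T x) = 0" if T: "T \<in> alg" and x: "x \<in> a2" for T x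
  proof -
    define T' where "T' = oproj b2 o\<^sub>L T o\<^sub>L oproj a2"
    have T': "T' \<in> alg" unfolding T'_def by (intro alg_compose oproj_in_alg a2 b2 T)
    define L where "L = {x. T' x = 0}\<^sup>\<bottom>"
    have L: "aff L" unfolding L_def by (rule aff_comp[OF aff_kernel[OF T']])
    have "a2\<^sup>\<bottom> \<subseteq> {x. T' x = 0}"
      by (auto simp: T'_def simp flip: oproj_eq_0_iff[OF a2'] simp: blinfun.zero_right)
    then have La2: "L \<subseteq> a2"
      using orthogonal_comp_anti_mono orthogonal_comp_orthogonal_comp[OF a2'] unfolding L_def by metis
    have "emb L b2"
    proof (rule emb_of_injective[OF T' L _ b2'(2,1)])
      show "z = 0" if "z \<in> L" "T' z = 0" for z
        using that orthogonal_comp_inter_self[of z "{x. T' x = 0}"] by (simp add: L_def)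
      show "T' ` L \<subseteq> b2" using oproj_in[OF b2'] by (auto simp: T'_def)
    qed
    then obtain W where W: "W \<in> alg" "\<And>x. x \<in> L \<Longrightarrow> norm (W x) = norm x" "\<And>x. x \<in> L \<Longrightarrow> W x \<in> b2"
      by (rule embE) blast
    \<comment> \<open>The old graph plus the graph of \<open>W\<close> on \<open>L\<close>: the new
      arguments and values are orthogonal to the old ones, so norms still agree.\<close>
    define G' where "G' = (\<lambda>(p, l). (fst p + l, snd p + W l)) ` (G \<times> L)"
    have "G' \<in> \<G>" unfolding \<G>_def
    proof (intro CollectI conjI ballI)
      show "subspace G'" unfolding G'_def
        by (intro linear_subspace_image subspace_Times sG affD(1)[OF L])
          (auto intro!: linearI simp: blinfun.bilinear_simps scaleR_add_right)
    next
      fix p assume "p \<in> G'"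
      then obtain x y l where p: "p = (x + l, y + W l)" "(x, y) \<in> G" "l \<in> L" by (auto simp: G'_def)
      have l: "l \<in> a2" "W l \<in> b2" using La2 p(3) W(3) by auto
      have "y \<in> V ` a1" using V(2)[OF p(2)] fstG[OF p(2)] by blast
      then have "x \<bullet> l = 0" "y \<bullet> W l = 0"
        using l fstG[OF p(2)] by (auto simp: a2_def b2_def in_orthogonal_comp_iff)
      then have "norm (y + W l) = norm (x + l)"
        by (intro norm_add_orthogonal G1 W(2) p)
      then show "norm (snd p) = norm (fst p)" by (simp add: p(1))
      show "fst p \<in> a" "snd p \<in> b"
        using G2[OF p(2)] l subspace_add[OF affD(1)[OF a]] subspace_add[OF affD(1)[OF b]]
        by (auto simp: p(1) a2_def b2_def)
      fix c assume c: "c \<in> C"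
      have "(c (fst p), c (snd p)) = (c x + c l, c y + W (c l))"
        by (simp add: p(1) blinfun.add_right algD[OF W(1) c])
      then show "(c (fst p), c (snd p)) \<in> G'"
        using G3[OF c p(2)] affD(3)[OF L c p(3)] unfolding G'_def by force
    qed
    moreover have "G \<subseteq> G'"
      using subspace_0[OF affD(1)[OF L]] unfolding G'_def by (force simp: blinfun.zero_right)
    ultimately have eq: "G' = G" by (rule max)
    \<comment> \<open>Maximality puts \<open>L\<close> inside \<open>a1\<close>, while by
      construction it is orthogonal to \<open>a1\<close>.\<close>
    have L0: "l = 0" if l: "l \<in> L" for l
    proof -
      have "(l, W l) \<in> G'"
        using subspace_0[OF sG] l unfolding G'_def by (force simp: zero_prod_def)
      then have "l \<in> a1" unfolding eq by (rule fstG)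
      moreover have "l \<in> a1\<^sup>\<bottom>" using La2 l by (auto simp: a2_def)
      ultimately show ?thesis by (rule orthogonal_comp_inter_self)
    qed
    note N' = affD(1,2)[OF aff_kernel[OF T']]
    have "x - oproj {x. T' x = 0} x \<in> L" unfolding L_def by (rule oproj_diff_in[OF N'])
    from L0[OF this] have "x \<in> {x. T' x = 0}" using oproj_in[OF N', of x] by simp
    then show ?thesis using oproj_id[OF a2' x] by (simp add: T'_def)
  qed
  then show thesis
    using that[OF a1 a1a V(1) _ Vb] V(3) unfolding a1_def[symmetric] a2_def b2_def by blast
qed

text \<open>Take a maximal partial isometry from \<open>a1\<close> onto \<open>b1\<close> and let
  \<open>w\<close> be the central support of the unmatched part \<open>b2\<close> of
  \<open>b\<close>. By maximality the unmatched part of \<open>a\<close> is orthogonal to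
  \<open>w\<close>. So \<open>a \<inter> w\<close> is wholly matched into \<open>b\<close>, and the
  part of \<open>b\<close> orthogonal to \<open>w\<close> is wholly matched into \<open>a\<close> by
  the inverse.\<close>

lemma comparison:
  assumes a: "aff a" and b: "aff b"
  obtains w where "aff w" "\<And>T x. T \<in> alg \<Longrightarrow> x \<in> w \<Longrightarrow> T x \<in> w"
    "emb (a \<inter> w) (b \<inter> w)" "emb (b \<inter> w\<^sup>\<bottom>) (a \<inter> w\<^sup>\<bottom>)"
proof -
  obtain a1 V where a1: "aff a1" "a1 \<subseteq> a" and V: "V \<in> alg" "\<And>x. x \<in> a1 \<Longrightarrow> norm (V x) = norm x"
    "\<And>x. x \<in> a1 \<Longrightarrow> V x \<in> b"
    and max: "\<And>T x. T \<in> alg \<Longrightarrow> x \<in> a \<inter> a1\<^sup>\<bottom> \<Longrightarrow> oproj (b \<inter> (V ` a1)\<^sup>\<bottom>) (T x) = 0"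
    by (rule maximal_isometry[OF a b]) blast
  define b1 where "b1 = V ` a1"
  have b1: "aff b1" unfolding b1_def by (rule aff_isometric_image[OF a1(1) V(1,2)])
  have b1b: "b1 \<subseteq> b" using V(3) by (auto simp: b1_def)
  define b2 where "b2 = b \<inter> b1\<^sup>\<bottom>"
  have b2: "aff b2" unfolding b2_def by (intro aff_Int b aff_comp b1)
  note a1' = affD(1,2)[OF a1(1)] and b1' = affD(1,2)[OF b1] and b2' = affD(1,2)[OF b2]
  define K where "K = (\<Inter>T\<in>alg. {x. (oproj b2 o\<^sub>L T) x = 0})"
  have K: "aff K" unfolding K_def
    by (rule aff_Inter) (auto intro!: aff_kernel alg_compose oproj_in_alg b2 simp del: blinfun_apply_blinfun_compose)
  note K' = affD(1,2)[OF K]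
  have Kiff: "x \<in> K \<longleftrightarrow> (\<forall>T\<in>alg. oproj b2 (T x) = 0)" for x by (simp add: K_def)
  have Kinv: "T x \<in> K" if T: "T \<in> alg" and x: "x \<in> K" for T x
    unfolding Kiff
  proof
    fix S assume "S \<in> alg"
    then have "S o\<^sub>L T \<in> alg" using T by (rule alg_compose)
    then have "oproj b2 ((S o\<^sub>L T) x) = 0" using x unfolding Kiff by blast
    then show "oproj b2 (S (T x)) = 0" by simp
  qed
  define w where "w = K\<^sup>\<bottom>"
  have wK: "w\<^sup>\<bottom> = K" unfolding w_def by (rule orthogonal_comp_orthogonal_comp[OF K'])
  have w: "aff w" unfolding w_def by (rule aff_comp[OF K])
  have winv: "T x \<in> w" if "T \<in> alg" "x \<in> w" for T x
    using that unfolding w_def by (rule invariant_orthogonal_comp[rotated]) (rule Kinv)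
  have b2w: "b2 \<subseteq> w"
  proof
    fix x assume x: "x \<in> b2"
    have "y \<bullet> x = 0" if "y \<in> K" for y
    proof -
      have "oproj b2 (id_blinfun y) = 0" using that alg_id unfolding Kiff by blast
      then show ?thesis using oproj_orth[OF b2' x, of y] by simp
    qed
    then show "x \<in> w" by (simp add: w_def in_orthogonal_comp_iff)
  qed
  have aw: "x \<in> a1" if x: "x \<in> a \<inter> w" for x
  proof -
    let ?y = "x - oproj a1 x"
    have "?y \<in> a \<inter> a1\<^sup>\<bottom>"
      using x oproj_diff_in[OF a1', of x] oproj_in[OF a1', of x] a1(2)
      by (auto intro: subspace_diff[OF affD(1)[OF a]])
    then have "?y \<in> K" using max by (simp add: Kiff b2_def b1_def)
    moreover have "?y \<in> w"
      using x winv[OF oproj_in_alg[OF a1(1)]] by (intro subspace_diff affD(1)[OF w]) auto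
    ultimately have "?y = 0" unfolding w_def by (rule orthogonal_comp_inter_self)
    then show ?thesis using oproj_in[OF a1', of x] by simp
  qed
  have bw: "y \<in> b1" if y: "y \<in> b \<inter> K" for y
  proof -
    let ?y = "y - oproj b1 y"
    have "?y \<in> b2"
      using y oproj_diff_in[OF b1', of y] oproj_in[OF b1', of y] b1b
      by (auto simp: b2_def intro: subspace_diff[OF affD(1)[OF b]])
    then have "?y \<in> w" using b2w by blast
    moreover have "?y \<in> K"
      using y Kinv[OF oproj_in_alg[OF b1]] by (intro subspace_diff K'(1)) auto
    ultimately have "?y = 0" unfolding w_def by (metis orthogonal_comp_inter_self)
    then show ?thesis using oproj_in[OF b1', of y] by simp
  qed
  show thesis
  proof (rule that[OF w winv])
    show "emb (a \<inter> w) (b \<inter> w)"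
      by (rule embI[OF V(1)]) (use aw V(2,3) winv[OF V(1)] in auto)
    show "emb (b \<inter> w\<^sup>\<bottom>) (a \<inter> w\<^sup>\<bottom>)" unfolding wK
    proof (rule embI)
      let ?W = "oproj a1 o\<^sub>L adj V"
      show W: "?W \<in> alg" by (intro alg_compose oproj_in_alg a1 alg_adj V)
      fix y assume y: "y \<in> b \<inter> K"
      then obtain x where x: "x \<in> a1" "y = V x" using bw[OF y] by (auto simp: b1_def)
      have Wy: "?W y = x" unfolding x(2) by (rule isometry_left_inverse[OF a1(1) V(1,2) x(1)])
      then show "norm (?W y) = norm y" using V(2)[OF x(1)] x(2) by simp
      show "?W y \<in> a \<inter> K" using Wy x(1) a1(2) Kinv[OF W, of y] y by auto
    qed
  qed auto
qed

section \<open>Sums of finite subspaces\<close>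

text \<open>\<open>g \<inter> w\<close> is split into \<open>L1\<close>, its part inside
  \<open>e\<close>, and the rest \<open>L2\<close>. The projection onto \<open>f\<close> is
  injective on \<open>L2\<close>, and its values are orthogonal to \<open>g' \<inter> f\<close>
  because \<open>g\<close> and \<open>g'\<close> are orthogonal; this leaves
  \<open>g' \<inter> f\<close> free to receive \<open>L1\<close>.\<close>

lemma emb_complement:
  assumes aff: "aff e" "aff f" "aff g" "aff g'" "aff w"
    and ker: "\<And>x. x \<in> g \<Longrightarrow> oproj f x = 0 \<Longrightarrow> x \<in> e"
    and orth: "\<And>x y. x \<in> g \<Longrightarrow> y \<in> g' \<Longrightarrow> y \<bullet> x = 0"
    and winv: "\<And>T x. T \<in> alg \<Longrightarrow> x \<in> w \<Longrightarrow> T x \<in> w"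
    and emb: "emb (g \<inter> e \<inter> w) (g' \<inter> f \<inter> w)"
  shows "emb (g \<inter> w) (f \<inter> w)"
proof -
  define L1 where "L1 = g \<inter> e \<inter> w"
  define L2 where "L2 = g \<inter> w \<inter> L1\<^sup>\<bottom>"
  define K2 where "K2 = f \<inter> w \<inter> (g' \<inter> f)\<^sup>\<bottom>"
  have L1: "aff L1" and L2: "aff L2" and K2: "aff K2" and fw: "aff (f \<inter> w)"
    unfolding L1_def L2_def K2_def by (intro aff_Int aff_comp aff)+
  note L1' = affD(1,2)[OF L1] and L2' = affD(1,2)[OF L2] and f' = affD(1,2)[OF aff(2)]
  have "emb L2 K2"
  proof (rule emb_of_injective[OF oproj_in_alg[OF aff(2)] L2 _ affD(2,1)[OF K2]])
    fix x assume x: "x \<in> L2" "oproj f x = 0"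
    then have "x \<in> L1" using ker by (auto simp: L1_def L2_def)
    then show "x = 0" using x by (auto simp: L2_def intro: orthogonal_comp_inter_self)
  next
    show "oproj f ` L2 \<subseteq> K2"
      using winv[OF oproj_in_alg[OF aff(2)]] oproj_in[OF f'] orth
      by (auto simp: L2_def K2_def in_orthogonal_comp_iff oproj_orth'[OF f'])
  qed
  then obtain V2 where V2: "V2 \<in> alg" "\<And>x. x \<in> L2 \<Longrightarrow> norm (V2 x) = norm x"
    "\<And>x. x \<in> L2 \<Longrightarrow> V2 x \<in> K2"
    by (rule embE) blast
  obtain V1 where V1: "V1 \<in> alg" "\<And>x. x \<in> L1 \<Longrightarrow> norm (V1 x) = norm x"
    "\<And>x. x \<in> L1 \<Longrightarrow> V1 x \<in> g' \<inter> f \<inter> w"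
    using emb unfolding L1_def[symmetric] by (rule embE) blast
  define V where "V = (V1 o\<^sub>L oproj L1) + (V2 o\<^sub>L (id_blinfun - oproj L1))"
  have Vx: "V x = V1 (oproj L1 x) + V2 (x - oproj L1 x)" for x
    by (simp add: V_def blinfun.bilinear_simps)
  have L2I: "x - oproj L1 x \<in> L2" if "x \<in> g \<inter> w" for x
    using that oproj_in[OF L1', of x] oproj_diff_in[OF L1', of x]
    by (auto simp: L2_def L1_def intro: subspace_diff affD(1)[OF aff(3)] affD(1)[OF aff(5)])
  show ?thesis
  proof (rule embI[of V])
    show "V \<in> alg" unfolding V_def by (intro alg_add alg_compose alg_diff alg_id V1 V2 oproj_in_alg L1)
    fix x assume x: "x \<in> g \<inter> w"
    let ?x1 = "oproj L1 x" and ?x2 = "x - oproj L1 x"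
    have x1: "?x1 \<in> L1" and x2: "?x2 \<in> L2" by (rule oproj_in[OF L1'], rule L2I[OF x])
    have "V1 ?x1 \<bullet> V2 ?x2 = 0"
      using V1(3)[OF x1] V2(3)[OF x2] by (simp add: K2_def in_orthogonal_comp_iff)
    moreover have "?x1 \<bullet> ?x2 = 0"
      using x1 x2 by (simp add: L2_def in_orthogonal_comp_iff)
    ultimately have "norm (V x) = norm (?x1 + ?x2)"
      unfolding Vx by (intro norm_add_orthogonal V1(2) V2(2) x1 x2)
    then show "norm (V x) = norm x" by simp
    show "V x \<in> f \<inter> w" unfolding Vx
      by (rule subspace_add[OF affD(1)[OF fw]]) (use V1(3)[OF x1] V2(3)[OF x2] in \<open>auto simp: K2_def\<close>)
  qed
qed

text \<open>
  A proper isometry of \<open>q\<close> into itself splits \<open>q\<close> into \<open>g\<close> and \<open>g'\<close>, both of which are infinite on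
  every central summand that matters. Comparing \<open>g \<inter> e\<close> with \<open>g' \<inter> f\<close> embeds, on
  complementary central summands, \<open>g\<close> into \<open>f\<close> and \<open>g'\<close> into \<open>e\<close>.
\<close>

lemma fin_orthogonal_sum:
  assumes e: "fin e" and f: "fin f" and q: "aff q"
    and orth: "\<And>x y. x \<in> e \<Longrightarrow> y \<in> f \<Longrightarrow> x \<bullet> y = 0"
    and sum: "\<And>x. x \<in> q \<Longrightarrow> \<exists>y\<in>e. \<exists>z\<in>f. x = y + z"
  shows "fin q"
  unfolding fin_def
proof (intro conjI q ballI impI, elim conjE)
  note q' = affD(1,2)[OF q] and e' = affD(1,2)[OF fin_aff[OF e]] and f' = affD(1,2)[OF fin_aff[OF f]]
  fix V assume V: "V \<in> alg" "\<forall>x\<in>q. norm (V x) = norm x" "V ` q \<subseteq> q"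
  then have Viso: "norm (V x) = norm x" and Vq: "V x \<in> q" if "x \<in> q" for x using that by auto
  \<comment> \<open>The defect of \<open>V\<close>, which has to be shown trivial.\<close>
  define p where "p = q \<inter> (V ` q)\<^sup>\<bottom>"
  have aVq: "aff (V ` q)" by (rule aff_isometric_image[OF q V(1) Viso])
  have p: "aff p" unfolding p_def by (intro aff_Int q aff_comp aVq)
  have pV: "z \<bullet> V x = 0" if "z \<in> p" "x \<in> q" for z x
    using that by (auto simp: p_def in_orthogonal_comp_iff inner_commute)
  \<comment> \<open>Squaring \<open>V\<close> leaves room for two defects: \<open>p\<close> and
    \<open>V p\<close> are both orthogonal to \<open>v q\<close>. The orbit of \<open>p\<close>
    under \<open>v\<close> spans \<open>g\<close>, and \<open>V p\<close> falls into its complement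
    \<open>g'\<close>, so \<open>v\<close> is a proper self-isometry of both \<open>g\<close> and
    \<open>g'\<close> unless \<open>p\<close> vanishes.\<close>
  define v where "v = V o\<^sub>L V"
  have vx: "v x = V (V x)" for x by (simp add: v_def)
  have v: "v \<in> alg" unfolding v_def by (intro alg_compose V)
  have viso: "norm (v x) = norm x" and vq: "v x \<in> q" if "x \<in> q" for x
    using that Viso Vq by (auto simp: vx)
  have Vin: "V x \<bullet> V y = x \<bullet> y" if "x \<in> q" "y \<in> q" for x y
    by (rule isometry_inner[OF q'(1) Viso that])
  have vin: "v x \<bullet> v y = x \<bullet> y" if "x \<in> q" "y \<in> q" for x y
    by (rule isometry_inner[OF q'(1) viso that])
  define D where "D = (\<Union>k. (blinfun_apply v ^^ k) ` p)"
  have DI: "(blinfun_apply v ^^ k) z \<in> D" if "z \<in> p" for k z using that by (auto simp: D_def)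
  have D_cases: "d \<in> p \<or> (\<exists>d'\<in>D. d = v d')" if d: "d \<in> D" for d
  proof -
    obtain k z where kz: "z \<in> p" "d = (blinfun_apply v ^^ k) z" using d unfolding D_def by blast
    show ?thesis
    proof (cases k)
      case 0 then show ?thesis using kz by simp
    next
      case (Suc m) then show ?thesis using kz DI[OF kz(1), of m] by auto
    qed
  qed
  have vD: "v d \<in> D" if d: "d \<in> D" for d
  proof -
    obtain k z where kz: "z \<in> p" "d = (blinfun_apply v ^^ k) z" using d unfolding D_def by blast
    then show ?thesis using DI[OF kz(1), of "Suc k"] by simp
  qed
  have "(blinfun_apply v ^^ k) z \<in> q" if "z \<in> p" for k z
    using that by (induction k) (auto simp: p_def vq)
  then have Dq: "d \<in> q" if "d \<in> D" for d using that by (auto simp: D_def)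
  have Dc: "c d \<in> D" if c: "c \<in> C" and d: "d \<in> D" for c d
  proof -
    obtain k z where kz: "z \<in> p" "d = (blinfun_apply v ^^ k) z" using d unfolding D_def by blast
    have "c ((blinfun_apply v ^^ k) z) = (blinfun_apply v ^^ k) (c z)"
      by (induction k) (simp_all flip: algD[OF v c])
    then show ?thesis using DI[OF affD(3)[OF p c kz(1)]] kz(2) by simp
  qed
  define g' where "g' = q \<inter> D\<^sup>\<bottom>"
  define g where "g = q \<inter> g'\<^sup>\<bottom>"
  have g': "aff g'" unfolding g'_def by (intro aff_Int q aff_orthogonal_comp Dc)
  have g: "aff g" unfolding g_def by (intro aff_Int q aff_comp g')
  have g'D: "d \<bullet> y = 0" if "d \<in> D" "y \<in> g'" for d y
    using that by (auto simp: g'_def in_orthogonal_comp_iff)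
  have g'I: "y \<in> g'" if "y \<in> q" "\<And>d. d \<in> D \<Longrightarrow> d \<bullet> y = 0" for y
    using that by (auto simp: g'_def in_orthogonal_comp_iff)
  have gg': "y \<bullet> x = 0" if "x \<in> g" "y \<in> g'" for x y
    using that by (auto simp: g_def in_orthogonal_comp_iff)
  have gI: "x \<in> g" if "x \<in> q" "\<And>y. y \<in> g' \<Longrightarrow> y \<bullet> x = 0" for x
    using that by (auto simp: g_def in_orthogonal_comp_iff)
  have gq: "x \<in> q" if "x \<in> g" for x using that by (simp add: g_def)
  have g'q: "x \<in> q" if "x \<in> g'" for x using that by (simp add: g'_def)
  have vg': "v y \<in> g'" if y: "y \<in> g'" for y
  proof (rule g'I)
    show "v y \<in> q" by (rule vq[OF g'q[OF y]])
    fix d assume "d \<in> D"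
    then consider "d \<in> p" | d' where "d' \<in> D" "d = v d'" using D_cases by blast
    then show "d \<bullet> v y = 0"
    proof cases
      case 1 then show ?thesis using pV Vq[OF g'q[OF y]] by (simp add: vx)
    next
      case 2 then show ?thesis using vin[OF Dq g'q[OF y]] g'D[OF _ y] by simp
    qed
  qed
  have vg: "v x \<in> g" if x: "x \<in> g" for x
  proof (rule gI)
    show "v x \<in> q" by (rule vq[OF gq[OF x]])
    fix y assume y: "y \<in> g'"
    have "oproj q (adj v y) \<in> g'"
    proof (rule g'I[OF oproj_in[OF q']])
      fix d assume d: "d \<in> D"
      show "d \<bullet> oproj q (adj v y) = 0"
        using g'D[OF vD[OF d] y] by (simp add: oproj_orth'[OF q' Dq[OF d]] adj_right)
    qed
    from gg'[OF x this] show "y \<bullet> v x = 0"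
      by (simp add: oproj_orth[OF q' gq[OF x]] adj_left)
  qed
  have pg: "z \<in> g" if z: "z \<in> p" for z
  proof (rule gI)
    show "z \<in> q" using z by (simp add: p_def)
    show "y \<bullet> z = 0" if "y \<in> g'" for y
      using g'D[OF DI[OF z, of 0] that] by (simp add: inner_commute)
  qed
  have Vpg': "V z \<in> g'" if z: "z \<in> p" for z
  proof (rule g'I)
    have zq: "z \<in> q" using z by (simp add: p_def)
    show "V z \<in> q" by (rule Vq[OF zq])
    fix d assume "d \<in> D"
    then consider "d \<in> p" | d' where "d' \<in> D" "d = v d'" using D_cases by blast
    then show "d \<bullet> V z = 0"
    proof cases
      case 1 then show ?thesis by (rule pV[OF _ zq])
    next
      case 2
      then show ?thesis using Vin[OF Vq[OF Dq[OF 2(1)]] zq] pV[OF z Dq[OF 2(1)]]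
        by (simp add: vx inner_commute)
    qed
  qed
  obtain w where w: "aff w" and winv: "\<And>T x. T \<in> alg \<Longrightarrow> x \<in> w \<Longrightarrow> T x \<in> w"
    and emb1: "emb (g \<inter> e \<inter> w) (g' \<inter> f \<inter> w)" and emb2: "emb (g' \<inter> f \<inter> w\<^sup>\<bottom>) (g \<inter> e \<inter> w\<^sup>\<bottom>)"
    by (rule comparison[of "g \<inter> e" "g' \<inter> f"]) (auto intro: aff_Int g g' fin_aff e f)
  note w' = affD(1,2)[OF w]
  have winv': "T x \<in> w\<^sup>\<bottom>" if "T \<in> alg" "x \<in> w\<^sup>\<bottom>" for T x
    by (rule invariant_orthogonal_comp[OF winv that])
  have kerf: "x \<in> e" if x: "x \<in> q" "oproj f x = 0" for x
  proof -
    obtain y z where yz: "y \<in> e" "z \<in> f" "x = y + z" using sum[OF x(1)] by blast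
    have "oproj f x = z" by (rule oproj_eqI[OF f' yz(2)]) (simp add: yz(3) orth[OF yz(1)])
    then show ?thesis using x(2) yz by simp
  qed
  have kere: "x \<in> f" if x: "x \<in> q" "oproj e x = 0" for x
  proof -
    obtain y z where yz: "y \<in> e" "z \<in> f" "x = y + z" using sum[OF x(1)] by blast
    have "oproj e x = y"
      by (rule oproj_eqI[OF e' yz(1)]) (use orth[OF _ yz(2)] in \<open>simp add: yz(3) inner_commute\<close>)
    then show ?thesis using x(2) yz by simp
  qed
  have "emb (g \<inter> w) (f \<inter> w)"
    by (rule emb_complement[OF fin_aff[OF e] fin_aff[OF f] g g' w _ _ winv emb1])
      (use kerf gq gg' in auto)
  then have fin1: "fin (g \<inter> w)"
    by (rule emb_fin[rotated 2]) (auto intro: fin_subset[OF _ _ f] aff_Int g w fin_aff[OF f])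
  have "emb (g' \<inter> w\<^sup>\<bottom>) (e \<inter> w\<^sup>\<bottom>)"
    by (rule emb_complement[OF fin_aff[OF f] fin_aff[OF e] g' g aff_comp[OF w] _ _ winv' emb2])
      (use kere g'q gg' inner_commute in metis)+
  then have fin2: "fin (g' \<inter> w\<^sup>\<bottom>)"
    by (rule emb_fin[rotated 2]) (auto intro: fin_subset[OF _ _ e] aff_Int g' aff_comp w fin_aff[OF e])
  have v1: "v ` (g \<inter> w) = g \<inter> w"
    by (rule finD[OF fin1 v]) (use viso gq vg winv[OF v] in auto)
  have v2: "v ` (g' \<inter> w\<^sup>\<bottom>) = g' \<inter> w\<^sup>\<bottom>"
    by (rule finD[OF fin2 v]) (use viso g'q vg' winv'[OF v] in auto)
  \<comment> \<open>Surjectivity of \<open>v\<close> on the finite piece writes \<open>z\<close> as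
    \<open>V (V x)\<close>, yet \<open>z\<close> is orthogonal to the range of \<open>V\<close> on
    \<open>q\<close>.\<close>
  have pw: "z = 0" if z: "z \<in> p" "z \<in> w" for z
  proof -
    have "z \<in> v ` (g \<inter> w)" unfolding v1 using pg z by simp
    then obtain x where x: "x \<in> g" "z = v x" by auto
    then have "z \<bullet> z = 0" using pV[OF z(1) Vq[OF gq[OF x(1)]]] by (simp add: vx)
    then show ?thesis by simp
  qed
  \<comment> \<open>Here it is \<open>V z\<close> that equals \<open>V (V x)\<close>; cancelling one
    \<open>V\<close> puts \<open>z\<close> in the range to which it is orthogonal.\<close>
  have pw': "z = 0" if z: "z \<in> p" "z \<in> w\<^sup>\<bottom>" for z
  proof -
    have zq: "z \<in> q" using z by (simp add: p_def)
    have "V z \<in> v ` (g' \<inter> w\<^sup>\<bottom>)" unfolding v2 using Vpg' z winv'[OF V(1)] by simp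
    then obtain x where x: "x \<in> g'" "V z = v x" by auto
    have "norm (z - V x) = norm (V (z - V x))"
      using zq Vq[OF g'q[OF x(1)]] by (intro Viso[symmetric] subspace_diff q'(1))
    also have "\<dots> = 0" using x(2) by (simp add: blinfun.diff_right vx)
    finally have "z = V x" by simp
    then have "z \<bullet> z = 0" using pV[OF z(1) g'q[OF x(1)]] by simp
    then show ?thesis by simp
  qed
  \<comment> \<open>The projections onto \<open>p\<close> and \<open>w\<close> commute as
    \<open>w\<close> is central, so both components of \<open>z\<close> remain in
    \<open>p\<close>.\<close>
  have p0: "z = 0" if z: "z \<in> p" for z
  proof -
    note p' = affD(1,2)[OF p]
    have "oproj p (oproj w z) = oproj w z"
      using oproj_central[OF w winv oproj_in_alg[OF p], of z] oproj_id[OF p' z] by simp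
    then have zw: "oproj w z \<in> p" by (simp add: oproj_eq_id_iff[OF p'])
    then have "oproj w z = 0" using oproj_in[OF w'] by (rule pw)
    moreover have "z - oproj w z = 0"
      using subspace_diff[OF p'(1) z zw] oproj_diff_in[OF w'] by (rule pw')
    ultimately show ?thesis by simp
  qed
  show "V ` q = q"
  proof
    show "q \<subseteq> V ` q"
    proof
      fix x assume x: "x \<in> q"
      note Vq' = affD(1,2)[OF aVq]
      have "x - oproj (V ` q) x \<in> p"
        unfolding p_def using x V(3) oproj_in[OF Vq', of x] oproj_diff_in[OF Vq', of x]
        by (auto intro: subspace_diff[OF q'(1)])
      then show "x \<in> V ` q" using p0 oproj_in[OF Vq', of x] by force
    qed
  qed (rule V(3))
qed

text \<open>The supremum \<open>q\<close> is \<open>f\<close> plus the part \<open>h\<close> of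
  \<open>q\<close> orthogonal to \<open>f\<close>. A vector of \<open>h\<close> orthogonal to
  \<open>e\<close> is zero, so \<open>h\<close> projects injectively into \<open>e\<close>, and the
  case of orthogonal summands applies.\<close>

lemma fin_sup:
  assumes e: "fin e" and f: "fin f"
  obtains q where "fin q" "e \<subseteq> q" "f \<subseteq> q"
proof -
  note e' = affD(1,2)[OF fin_aff[OF e]] and f' = affD(1,2)[OF fin_aff[OF f]]
  define q where "q = (e\<^sup>\<bottom> \<inter> f\<^sup>\<bottom>)\<^sup>\<bottom>"
  define h where "h = q \<inter> f\<^sup>\<bottom>"
  have q: "aff q" unfolding q_def by (intro aff_comp aff_Int fin_aff e f)
  have h: "aff h" unfolding h_def by (intro aff_comp aff_Int fin_aff q f)
  have eq: "e \<subseteq> q" and fq: "f \<subseteq> q"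
    using orthogonal_comp_subset[of e] orthogonal_comp_subset[of f]
      orthogonal_comp_anti_mono[of "e\<^sup>\<bottom> \<inter> f\<^sup>\<bottom>" "e\<^sup>\<bottom>"]
      orthogonal_comp_anti_mono[of "e\<^sup>\<bottom> \<inter> f\<^sup>\<bottom>" "f\<^sup>\<bottom>"]
    by (auto simp: q_def)
  have "emb h e"
  proof (rule emb_of_injective[OF oproj_in_alg[OF fin_aff[OF e]] h _ e'(2,1)])
    fix x assume x: "x \<in> h" "oproj e x = 0"
    then have "x \<in> e\<^sup>\<bottom> \<inter> f\<^sup>\<bottom>" by (simp add: h_def oproj_eq_0_iff[OF e'])
    moreover have "x \<in> (e\<^sup>\<bottom> \<inter> f\<^sup>\<bottom>)\<^sup>\<bottom>" using x by (simp add: h_def q_def)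
    ultimately show "x = 0" by (rule orthogonal_comp_inter_self)
  qed (use oproj_in[OF e'] in auto)
  then have "fin h" by (rule emb_fin[OF h e])
  then have "fin q"
  proof (rule fin_orthogonal_sum[OF _ f q])
    show "x \<bullet> y = 0" if "x \<in> h" "y \<in> f" for x y
      using that by (auto simp: h_def in_orthogonal_comp_iff inner_commute)
    show "\<exists>y\<in>h. \<exists>z\<in>f. x = y + z" if "x \<in> q" for x
      using that fq oproj_in[OF f', of x] oproj_diff_in[OF f', of x]
      by (intro bexI[of _ "x - oproj f x"] bexI[of _ "oproj f x"])
        (auto simp: h_def intro: subspace_diff[OF affD(1)[OF q]])
  qed
  then show thesis using eq fq by (rule that)
qed

end

section \<open>A range containing a closed subspace\<close>

text \<open>If \<open>T z\<close> is the projection of \<open>x\<close> onto \<open>L\<close>, the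
  pairing of \<open>x\<close> with \<open>y\<close> in \<open>L\<close> is at most
  \<open>norm z * norm (adj T y)\<close>. So the closed sets \<open>B n\<close> cover the space, and
  by Baire's theorem one of them contains a ball; the resulting uniform bound is tested on multiples
  of \<open>y\<close> itself.\<close>

lemma adj_bounded_below:
  fixes T :: "'a::{real_inner,banach} \<Rightarrow>\<^sub>L 'a"
  assumes L: "subspace L" "closed L" "L \<subseteq> range T"
  obtains c where "c > 0" "\<And>y. y \<in> L \<Longrightarrow> c * norm y \<le> norm (adj T y)"
proof -
  define B where "B n = (\<Inter>y\<in>L. {x. \<bar>x \<bullet> y\<bar> \<le> real n * norm (adj T y)})" for n
  have clB: "closed (B n)" for n
    unfolding B_def by (intro closed_INT ballI closed_Collect_le continuous_intros)
  have UB: "\<Union>(range B) = UNIV"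
  proof (intro set_eqI iffI UNIV_I)
    fix x
    obtain z where z: "oproj L x = T z" using oproj_in[OF L(1,2), of x] L(3) by blast
    obtain n where n: "norm z \<le> real n" using real_arch_simple by blast
    have "x \<in> B n"
      unfolding B_def
    proof (intro INT_I CollectI)
      fix y assume "y \<in> L"
      then have "\<bar>x \<bullet> y\<bar> = \<bar>z \<bullet> adj T y\<bar>"
        using oproj_orth[OF L(1,2), of y x] by (simp add: z adj_right)
      also have "\<dots> \<le> norm z * norm (adj T y)" by (rule Cauchy_Schwarz_ineq2)
      also have "\<dots> \<le> real n * norm (adj T y)" using n by (intro mult_right_mono) auto
      finally show "\<bar>x \<bullet> y\<bar> \<le> real n * norm (adj T y)" .
    qed
    then show "x \<in> \<Union>(range B)" by blast
  qed
  have "\<exists>n. interior (B n) \<noteq> {}"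
  proof (rule ccontr)
    assume "\<nexists>n. interior (B n) \<noteq> {}"
    then have "euclidean interior_of \<Union>(range B) = {}"
      using clB by (intro Baire_category_alt disjI1 completely_metrizable_space_euclidean) auto
    then show False unfolding UB by simp
  qed
  then obtain n x0 where "x0 \<in> interior (B n)" by blast
  then obtain e where e: "e > 0" "ball x0 e \<subseteq> B n" by (auto simp: mem_interior)
  show thesis
  proof
    show c: "e / (4 * (real n + 1)) > 0" using e(1) by simp
    fix y assume y: "y \<in> L"
    show "e / (4 * (real n + 1)) * norm y \<le> norm (adj T y)"
    proof (cases "y = 0")
      case False
      \<comment> \<open>A vector of length \<open>e / 2\<close> along \<open>y\<close>, so that
        \<open>x0\<close> and \<open>x0 + x\<close> both lie in the ball. Subtracting the two
        estimates costs the factor \<open>2 * real n\<close>; \<open>n + 1\<close> in the constant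
        avoids division by zero.\<close>
      define x where "x = (e / (2 * norm y)) *\<^sub>R y"
      have "norm x < e" using e(1) False by (simp add: x_def)
      then have "x0 \<in> B n" "x0 + x \<in> B n" using e by (auto simp: dist_norm intro!: subsetD[OF e(2)])
      then have "\<bar>x0 \<bullet> y\<bar> \<le> real n * norm (adj T y)" "\<bar>(x0 + x) \<bullet> y\<bar> \<le> real n * norm (adj T y)"
        using y by (auto simp: B_def)
      moreover have "x \<bullet> y = e / 2 * norm y"
        using False by (simp add: x_def flip: power2_norm_eq_inner) (simp add: power2_eq_square)
      ultimately have "e / 2 * norm y \<le> 2 * real n * norm (adj T y)"
        by (simp add: inner_add_left)
      also have "\<dots> \<le> 2 * (real n + 1) * norm (adj T y)" by (intro mult_right_mono) auto
      finally show ?thesis by (simp add: field_simps)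
    qed simp
  qed
qed

section \<open>The spectral idempotent of an isolated point\<close>

lemma bounded_clinear_ops_iff: "T \<in> bounded_clinear_ops \<longleftrightarrow> (\<forall>c x. T (c *\<^sub>C x) = c *\<^sub>C T x)"
proof
  assume "T \<in> bounded_clinear_ops"
  then have "Vector_Spaces.linear scaleC scaleC (blinfun_apply T)" by (simp add: bounded_clinear_ops_def)
  then show "\<forall>c x. T (c *\<^sub>C x) = c *\<^sub>C T x"
    by (simp add: Vector_Spaces.linear_def module_hom_def module_hom_axioms_def)
next
  assume "\<forall>c x. T (c *\<^sub>C x) = c *\<^sub>C T x"
  then have "Vector_Spaces.linear scaleC scaleC (blinfun_apply T)"
    by unfold_locales (auto simp: blinfun.add_right)
  then show "T \<in> bounded_clinear_ops" by (simp add: bounded_clinear_ops_def)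
qed

lemma scaleC_blinfun_apply [simp]: "(c *\<^sub>C\<^sub>L T) x = c *\<^sub>C T x"
  by (simp add: scaleC_blinfun.rep_eq)

text \<open>The equations below say that \<open>X\<close> is a two-sided inverse of \<open>1 - a\<close>.\<close>

definition inverse_one_minus :: "('a::real_normed_vector \<Rightarrow>\<^sub>L 'a) \<Rightarrow> ('a \<Rightarrow>\<^sub>L 'a) \<Rightarrow> bool"
  where "inverse_one_minus X a \<longleftrightarrow> (\<forall>v. X (a v) = X v - v \<and> a (X v) = X v - v)"

lemma inverse_one_minusD:
  assumes "inverse_one_minus X a"
  shows "X (a v) = X v - v" "a (X v) = X v - v"
  using assms by (simp_all add: inverse_one_minus_def)

lemma inverse_one_minus_unique:
  assumes X: "inverse_one_minus X a" and Y: "inverse_one_minus Y a"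
  shows "X = Y"
proof (rule blinfun_eqI)
  fix v
  have "X (Y v) - Y v = X (Y v) - X v"
    using inverse_one_minusD(1)[OF X, of "Y v"]
    by (simp add: inverse_one_minusD(2)[OF Y] blinfun.diff_right)
  then show "X v = Y v" by simp
qed

lemma inverse_one_minus_commute:
  fixes S :: "'a::real_normed_vector \<Rightarrow>\<^sub>L 'a"
  assumes X: "inverse_one_minus X a" and S: "\<And>v. S (a v) = blinfun_apply a (S v)"
  shows "S (X v) = blinfun_apply X (S v)"
proof -
  have "X (S (X v - a (X v))) = X (S (X v)) - X (a (S (X v)))"
    by (simp add: blinfun.diff_right S)
  also have "\<dots> = S (X v)" by (simp add: inverse_one_minusD(1)[OF X])
  finally show ?thesis by (simp add: inverse_one_minusD(2)[OF X])
qed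

text \<open>Passage from \<open>a\<close> and \<open>-a\<close> to \<open>a\<^sup>2\<close>: partial fractions.\<close>

lemma inverse_one_minus_square:
  assumes X: "inverse_one_minus X a" and Y: "inverse_one_minus Y (- a)"
  defines "Z \<equiv> (1/2) *\<^sub>R (X + Y)"
  shows "inverse_one_minus Z (a o\<^sub>L a)"
    and "(Z o\<^sub>L Z) - Z = (1/4) *\<^sub>R (((X o\<^sub>L X) - X) + ((Y o\<^sub>L Y) - Y))"
    and "Z - X = (X - (X o\<^sub>L X)) o\<^sub>L (2 *\<^sub>R Y - id_blinfun)"
proof -
  have Xa: "X (a v) = X v - v" and aX: "a (X v) = X v - v"
    and Ya: "Y (a v) = v - Y v" and aY: "a (Y v) = v - Y v" for v
    using inverse_one_minusD[OF X, of v] inverse_one_minusD[OF Y, of v]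
    by (auto simp: blinfun.minus_left blinfun.minus_right algebra_simps)
  have Zv: "Z v = (1/2) *\<^sub>R (X v + Y v)" for v by (simp add: Z_def blinfun.bilinear_simps)
  \<comment> \<open>The product of the two inverses is their mean, as in
    \<open>1/((1-t)(1+t)) = (1/(1-t) + 1/(1+t))/2\<close>.\<close>
  have XY: "X (Y v) = Z v" for v
  proof -
    have "X v - X (Y v) = X (Y v) - Y v"
      using Xa[of "Y v"] by (simp add: aY blinfun.diff_right)
    then have "2 *\<^sub>R X (Y v) = X v + Y v" by (simp add: scaleR_2 algebra_simps)
    then show ?thesis unfolding Zv by (metis scaleR_half_double scaleR_2)
  qed
  have YX: "Y (X v) = Z v" for v
  proof -
    have "Y (X v) - Y v = X v - Y (X v)"
      using Ya[of "X v"] by (simp add: aX blinfun.diff_right)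
    then have "2 *\<^sub>R Y (X v) = X v + Y v" by (simp add: scaleR_2 algebra_simps)
    then show ?thesis unfolding Zv by (metis scaleR_half_double scaleR_2)
  qed
  show "inverse_one_minus Z (a o\<^sub>L a)"
    unfolding inverse_one_minus_def
    by (simp add: Zv Xa Ya aX aY blinfun.bilinear_simps algebra_simps flip: scaleR_left_distrib)
  \<comment> \<open>The idempotency defect of \<open>Z\<close> is a quarter of the sum of the two
    old ones, so a common bound is halved by each squaring.\<close>
  show "(Z o\<^sub>L Z) - Z = (1/4) *\<^sub>R (((X o\<^sub>L X) - X) + ((Y o\<^sub>L Y) - Y))"
  proof (rule blinfun_eqI)
    fix v
    have "Z (Z v) = (1/2) *\<^sub>R ((1/2) *\<^sub>R (X (X v)) + (1/2) *\<^sub>R X (Y v) + ((1/2) *\<^sub>R Y (X v) + (1/2) *\<^sub>R Y (Y v)))"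
      unfolding Zv[of v] by (simp add: Zv[of "X v + Y v"] Zv blinfun.bilinear_simps scaleR_add_right)
    also have "\<dots> = (1/4) *\<^sub>R (X (X v) + Y (Y v)) + (1/2) *\<^sub>R Z v"
      unfolding XY YX by (simp add: scaleR_add_right flip: scaleR_left_distrib)
    finally have ZZ: "Z (Z v) = (1/4) *\<^sub>R (X (X v) + Y (Y v)) + (1/2) *\<^sub>R Z v" .
    have "(1/2) *\<^sub>R Z v - Z v = - ((1/4) *\<^sub>R (X v + Y v))"
    proof -
      have "Z v = (1/2) *\<^sub>R Z v + (1/2) *\<^sub>R Z v" by (simp flip: scaleR_left_distrib)
      then have "(1/2) *\<^sub>R Z v - Z v = - ((1/2) *\<^sub>R Z v)" by (simp add: algebra_simps)
      then show ?thesis by (simp add: Zv)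
    qed
    then show "((Z o\<^sub>L Z) - Z) v = ((1/4) *\<^sub>R (((X o\<^sub>L X) - X) + ((Y o\<^sub>L Y) - Y))) v"
      by (simp add: ZZ blinfun.bilinear_simps algebra_simps)
  qed
  \<comment> \<open>The increment contains the idempotency defect of \<open>X\<close> as a factor,
    which makes the sequence of inverses converge geometrically.\<close>
  show "Z - X = (X - (X o\<^sub>L X)) o\<^sub>L (2 *\<^sub>R Y - id_blinfun)"
  proof (rule blinfun_eqI)
    fix v
    have 2: "2 *\<^sub>R Z u = X u + Y u" for u by (simp add: Zv)
    have XZ: "2 *\<^sub>R X (Z v) = X (X v) + Z v"
    proof -
      have "2 *\<^sub>R X (Z v) = X (2 *\<^sub>R Z v)" by (simp only: blinfun.scaleR_right)
      also have "\<dots> = X (X v) + Z v" by (simp only: 2 blinfun.add_right XY)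
      finally show ?thesis .
    qed
    have "((X - (X o\<^sub>L X)) o\<^sub>L (2 *\<^sub>R Y - id_blinfun)) v = 2 *\<^sub>R Z v - X v - 2 *\<^sub>R X (Z v) + X (X v)"
      by (simp add: blinfun.bilinear_simps XY algebra_simps)
    also have "\<dots> = (Z - X) v" unfolding XZ by (simp add: blinfun.diff_left scaleR_2)
    finally show "(Z - X) v = ((X - (X o\<^sub>L X)) o\<^sub>L (2 *\<^sub>R Y - id_blinfun)) v" by simp
  qed
qed

section \<open>Repeated squares and their inverses on the unit circle\<close>

primrec square_iter :: "('a::real_normed_vector \<Rightarrow>\<^sub>L 'a) \<Rightarrow> nat \<Rightarrow> 'a \<Rightarrow>\<^sub>L 'a" where
  "square_iter z 0 = z"
| "square_iter z (Suc k) = square_iter z k o\<^sub>L square_iter z k"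

lemma square_iter_apply: "square_iter z k v = (blinfun_apply z ^^ (2 ^ k)) v"
  by (induction k arbitrary: v) (simp_all add: mult_2 funpow_add)

text \<open>\<open>b\<close> is the power with one factor fewer. Through it, facts about
  \<open>z\<close> itself can be read off from the inverses of \<open>1 - z^(2^k)\<close>.\<close>

lemma square_iter_factor:
  fixes z :: "'a::real_normed_vector \<Rightarrow>\<^sub>L 'a"
  obtains b where "\<And>v. square_iter z k v = blinfun_apply b (z v)" "\<And>v. square_iter z k v = z (b v)"
proof -
  have "\<exists>b. \<forall>v. square_iter z k v = blinfun_apply b (z v) \<and> square_iter z k v = z (b v)"
  proof (induction k)
    case 0
    show ?case by (rule exI[of _ id_blinfun]) simp
  next
    case (Suc k)
    then obtain b where b: "\<And>v. square_iter z k v = blinfun_apply b (z v)" "\<And>v. square_iter z k v = z (b v)" by blast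
    show ?case
    proof (rule exI[of _ "b o\<^sub>L z o\<^sub>L b"], intro allI conjI)
      show "square_iter z (Suc k) v = (b o\<^sub>L z o\<^sub>L b) (z v)" for v by (simp add: b(1))
      show "square_iter z (Suc k) v = z ((b o\<^sub>L z o\<^sub>L b) v)" for v by (simp add: b(2))
    qed
  qed
  then show thesis using that by blast
qed

text \<open>Compactness is combined with the resolvent identity
  \<open>X v = Y v + X ((\<zeta> - \<eta>) *\<^sub>C z (Y v))\<close>: near a limit point
  \<open>\<eta>\<close> the last term is at most half of \<open>norm X * norm v\<close>, so
  \<open>norm X\<close> stays below \<open>2 * norm Y\<close>.\<close>

lemma resolvent_bounded_on_circle:
  fixes z :: "'a::chilbert_space \<Rightarrow>\<^sub>L 'a"
  assumes ex: "\<And>\<zeta>. cmod \<zeta> = 1 \<Longrightarrow> \<exists>X. inverse_one_minus X (\<zeta> *\<^sub>C\<^sub>L z)"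
  shows "\<exists>K. \<forall>\<zeta> X. cmod \<zeta> = 1 \<longrightarrow> inverse_one_minus X (\<zeta> *\<^sub>C\<^sub>L z) \<longrightarrow> norm X \<le> K"
proof (rule ccontr)
  assume "\<not> ?thesis"
  then have "\<exists>\<zeta> X. cmod \<zeta> = 1 \<and> inverse_one_minus X (\<zeta> *\<^sub>C\<^sub>L z) \<and> norm X > K" for K
    by (meson not_le)
  then have "\<forall>n::nat. \<exists>\<zeta> X. cmod \<zeta> = 1 \<and> inverse_one_minus X (\<zeta> *\<^sub>C\<^sub>L z) \<and> norm X > real n" by blast
  then obtain \<zeta> X where zX: "\<And>n::nat. cmod (\<zeta> n) = 1"
    "\<And>n. inverse_one_minus (X n) (\<zeta> n *\<^sub>C\<^sub>L z)" "\<And>n. norm (X n) > real n"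
    by metis
  have "seq_compact (sphere (0::complex) 1)" by (simp add: compact_imp_seq_compact)
  moreover have "\<forall>n. \<zeta> n \<in> sphere 0 1" using zX(1) by simp
  ultimately obtain \<eta> r where \<eta>: "\<eta> \<in> sphere 0 1" "strict_mono r" "(\<zeta> \<circ> r) \<longlonglongrightarrow> \<eta>"
    by (rule seq_compactE) blast
  obtain Y where Y: "inverse_one_minus Y (\<eta> *\<^sub>C\<^sub>L z)" using ex \<eta>(1) by force
  have "\<forall>\<^sub>F n in sequentially. norm ((\<zeta> \<circ> r) n - \<eta>) < 1 / (2 * (norm z * norm Y + 1))"
    using \<eta>(3) unfolding tendsto_iff dist_norm by (simp add: add_nonneg_pos)
  then obtain N where N: "\<And>n. n \<ge> N \<Longrightarrow> norm (\<zeta> (r n) - \<eta>) < 1 / (2 * (norm z * norm Y + 1))"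
    by (auto simp: eventually_sequentially)
  \<comment> \<open>For this index \<open>norm (X (r m))\<close> exceeds \<open>real (r m)\<close>,
    hence \<open>2 * norm Y\<close>, against the bound derived below.\<close>
  obtain m where m: "m \<ge> N" "real m \<ge> 2 * norm Y"
  proof -
    obtain m0 where "real m0 \<ge> 2 * norm Y" using real_arch_simple by blast
    then show thesis using that[of "max N m0"] by (simp add: max_def)
  qed
  let ?\<zeta> = "\<zeta> (r m)" and ?X = "X (r m)"
  have "norm (?X v) \<le> (norm Y + norm ?X / 2) * norm v" for v
  proof -
    let ?u = "Y v"
    have "?X (?\<zeta> *\<^sub>C z ?u) = ?X ?u - ?u"
      using inverse_one_minusD(1)[OF zX(2), of "r m" ?u] by simp
    moreover have "\<eta> *\<^sub>C z ?u = ?u - v"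
      using inverse_one_minusD(2)[OF Y, of v] by simp
    moreover have "(?\<zeta> - \<eta>) *\<^sub>C z ?u = ?\<zeta> *\<^sub>C z ?u - \<eta> *\<^sub>C z ?u"
      by (rule complex_vector.scale_left_diff_distrib)
    ultimately have "?X v = ?u + ?X ((?\<zeta> - \<eta>) *\<^sub>C z ?u)" by (simp add: blinfun.diff_right)
    then have "norm (?X v) \<le> norm ?u + norm (?X ((?\<zeta> - \<eta>) *\<^sub>C z ?u))"
      by (metis norm_triangle_ineq)
    moreover have "norm (?X ((?\<zeta> - \<eta>) *\<^sub>C z ?u)) \<le> norm ?X * (1/2 * norm v)"
    proof (rule order.trans[OF norm_blinfun], rule mult_left_mono)
      have "norm ((?\<zeta> - \<eta>) *\<^sub>C z ?u) \<le> norm (?\<zeta> - \<eta>) * (norm z * (norm Y * norm v))"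
        unfolding norm_scaleC
        by (intro mult_left_mono order.trans[OF norm_blinfun[of z]] norm_blinfun[of Y]) auto
      also have "\<dots> = norm (?\<zeta> - \<eta>) * (norm z * norm Y) * norm v" by simp
      also have "\<dots> \<le> 1/2 * norm v"
      proof (rule mult_right_mono)
        have "norm (?\<zeta> - \<eta>) * (norm z * norm Y) \<le> 1 / (2 * (norm z * norm Y + 1)) * (norm z * norm Y)"
          using N[OF m(1)] by (intro mult_right_mono) auto
        also have "\<dots> \<le> 1/2" by (simp add: divide_simps add_nonneg_pos)
        finally show "norm (?\<zeta> - \<eta>) * (norm z * norm Y) \<le> 1/2" .
      qed simp
      finally show "norm ((?\<zeta> - \<eta>) *\<^sub>C z ?u) \<le> 1/2 * norm v" .
    qed simp
    moreover have "norm ?u \<le> norm Y * norm v" by (rule norm_blinfun)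
    ultimately have "norm (?X v) \<le> norm Y * norm v + norm ?X * (1/2 * norm v)" by linarith
    also have "\<dots> = (norm Y + norm ?X / 2) * norm v" by (simp add: algebra_simps)
    finally show ?thesis .
  qed
  then have "norm ?X \<le> norm Y + norm ?X / 2" by (intro norm_blinfun_bound) auto
  then have "norm ?X \<le> 2 * norm Y" by simp
  moreover have "real m \<le> real (r m)" using seq_suble[OF \<eta>(2)] by simp
  ultimately show False using zX(3)[of "r m"] m(2) by linarith
qed

text \<open>For \<open>\<eta>^2 = \<zeta>\<close> the inverse at \<open>\<zeta>\<close> for the
  squared power is the mean of those at \<open>\<eta>\<close> and \<open>- \<eta>\<close>. The mean
  keeps the bound \<open>K\<close> and halves the defect; the induction runs over the whole circle
  because both square roots occur.\<close>

lemma inverse_one_minus_powers: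
  fixes z :: "'a::chilbert_space \<Rightarrow>\<^sub>L 'a"
  assumes z: "z \<in> bounded_clinear_ops"
    and ex: "\<And>\<zeta>. cmod \<zeta> = 1 \<Longrightarrow> \<exists>X. inverse_one_minus X (\<zeta> *\<^sub>C\<^sub>L z) \<and> norm X \<le> K"
  shows "cmod \<zeta> = 1 \<Longrightarrow> \<exists>X. inverse_one_minus X (\<zeta> *\<^sub>C\<^sub>L square_iter z k) \<and> norm X \<le> K \<and>
    norm ((X o\<^sub>L X) - X) \<le> (K * K + K) / 2 ^ k"
proof (induction k arbitrary: \<zeta>)
  case 0
  then obtain X where X: "inverse_one_minus X (\<zeta> *\<^sub>C\<^sub>L z)" "norm X \<le> K" using ex by blast
  have "norm ((X o\<^sub>L X) - X) \<le> norm (X o\<^sub>L X) + norm X" by (rule norm_triangle_ineq4)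
  also have "\<dots> \<le> K * K + K"
    using X(2) by (intro add_mono order.trans[OF norm_blinfun_compose] mult_mono) (auto intro: order.trans[OF norm_ge_zero])
  finally show ?case using X by auto
next
  case (Suc k)
  define \<eta> where "\<eta> = csqrt \<zeta>"
  have \<eta>2: "\<eta> * \<eta> = \<zeta>" using power2_csqrt[of \<zeta>] by (simp add: \<eta>_def power2_eq_square)
  then have \<eta>: "cmod \<eta> = 1" using Suc.prems by (metis norm_ge_zero norm_mult power2_eq_square power2_eq_1_iff norm_minus_cancel one_neq_neg_one le_minus_one_simps(3))
  let ?a = "\<eta> *\<^sub>C\<^sub>L square_iter z k"
  obtain X where X: "inverse_one_minus X ?a" "norm X \<le> K" "norm ((X o\<^sub>L X) - X) \<le> (K * K + K) / 2 ^ k"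
    using Suc.IH[OF \<eta>] by blast
  have "cmod (- \<eta>) = 1" using \<eta> by simp
  then obtain Y where Y': "inverse_one_minus Y ((- \<eta>) *\<^sub>C\<^sub>L square_iter z k)" "norm Y \<le> K"
    "norm ((Y o\<^sub>L Y) - Y) \<le> (K * K + K) / 2 ^ k"
    using Suc.IH by blast
  have "(- \<eta>) *\<^sub>C\<^sub>L square_iter z k = - ?a"
    by (rule blinfun_eqI) (simp add: blinfun.minus_left)
  then have Y: "inverse_one_minus Y (- ?a)" using Y'(1) by simp
  have "square_iter z k (c *\<^sub>C x) = c *\<^sub>C square_iter z k x" for c x
    using z unfolding bounded_clinear_ops_iff by (induction k arbitrary: x) simp_all
  then have "?a o\<^sub>L ?a = \<zeta> *\<^sub>C\<^sub>L square_iter z (Suc k)"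
    by (intro blinfun_eqI) (simp add: \<eta>2 complex_vector.scale_scale)
  then have inv: "inverse_one_minus ((1/2) *\<^sub>R (X + Y)) (\<zeta> *\<^sub>C\<^sub>L square_iter z (Suc k))"
    using inverse_one_minus_square(1)[OF X(1) Y] by simp
  have "norm (X + Y) \<le> K + K" by (rule order.trans[OF norm_triangle_ineq add_mono[OF X(2) Y'(2)]])
  then have n: "norm ((1/2) *\<^sub>R (X + Y)) \<le> K" by simp
  have "norm (((X o\<^sub>L X) - X) + ((Y o\<^sub>L Y) - Y)) \<le> (K * K + K) / 2 ^ k + (K * K + K) / 2 ^ k"
    by (rule order.trans[OF norm_triangle_ineq add_mono[OF X(3) Y'(3)]])
  then have "norm ((((1/2) *\<^sub>R (X + Y)) o\<^sub>L ((1/2) *\<^sub>R (X + Y))) - (1/2) *\<^sub>R (X + Y)) \<le> (K * K + K) / 2 ^ Suc k"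
  proof -
    have "(K * K + K) / 2 ^ k + (K * K + K) / 2 ^ k = 4 * ((K * K + K) / 2 ^ Suc k)"
      by (simp add: field_simps)
    moreover assume "norm (((X o\<^sub>L X) - X) + ((Y o\<^sub>L Y) - Y)) \<le> (K * K + K) / 2 ^ k + (K * K + K) / 2 ^ k"
    ultimately show ?thesis
      unfolding inverse_one_minus_square(2)[OF X(1) Y] norm_scaleR abs_divide abs_one abs_numeral
      by linarith
  qed
  then show ?case using inv n by blast
qed

text \<open>
  With \<open>z\<close> a multiple of \<open>F\<close> having no spectrum on the unit circle, \<open>(1 - z^n)\<inverse>\<close> converges along
  \<open>n = 2^k\<close> to the spectral idempotent for the part of the spectrum inside the circle.
\<close>

lemma spectral_idempotent:
  fixes z :: "'a::chilbert_space \<Rightarrow>\<^sub>L 'a"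
  assumes z: "z \<in> bounded_clinear_ops"
    and ex: "\<And>\<zeta>. cmod \<zeta> = 1 \<Longrightarrow> \<exists>X. inverse_one_minus X (\<zeta> *\<^sub>C\<^sub>L z)"
  obtains P n c where "\<And>x. blinfun_apply P (P x) = P x"
    "\<And>S. S o\<^sub>L z = z o\<^sub>L S \<Longrightarrow> S o\<^sub>L P = P o\<^sub>L S"
    "\<And>x. norm ((blinfun_apply z ^^ n) (P x)) \<le> 1/2 * norm x"
    "c > 0" "\<And>x. P x = 0 \<Longrightarrow> c * norm x \<le> norm (z x)"
    "\<And>x. P x = 0 \<Longrightarrow> \<exists>y. P y = 0 \<and> z y = x"
proof -
  obtain K where K: "\<And>\<zeta> X. cmod \<zeta> = 1 \<Longrightarrow> inverse_one_minus X (\<zeta> *\<^sub>C\<^sub>L z) \<Longrightarrow> norm X \<le> K"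
    using resolvent_bounded_on_circle[OF ex] by blast
  have ex': "\<exists>X. inverse_one_minus X (\<zeta> *\<^sub>C\<^sub>L z) \<and> norm X \<le> K" if "cmod \<zeta> = 1" for \<zeta>
    using ex[OF that] K[OF that] by blast
  have K0: "K \<ge> 0" using ex'[of 1] norm_ge_zero order.trans by (metis norm_one)
  let ?a = "square_iter z"
  note pow = inverse_one_minus_powers[OF z ex']
  have "\<forall>k. \<exists>X. inverse_one_minus X (?a k) \<and> norm X \<le> K \<and> norm ((X o\<^sub>L X) - X) \<le> (K * K + K) / 2 ^ k"
    using pow[of 1] by (metis (no_types, lifting) blinfun_eqI norm_one scaleC_blinfun_apply scaleC_one)
  then obtain Q where Q: "\<And>k. inverse_one_minus (Q k) (?a k)" "\<And>k. norm (Q k) \<le> K"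
    "\<And>k. norm ((Q k o\<^sub>L Q k) - Q k) \<le> (K * K + K) / 2 ^ k"
    by metis
  have "\<forall>k. \<exists>X. inverse_one_minus X (- ?a k) \<and> norm X \<le> K"
  proof
    fix k
    have "(-1) *\<^sub>C\<^sub>L ?a k = - ?a k" by (rule blinfun_eqI) (simp add: blinfun.minus_left scaleC_one)
    then show "\<exists>X. inverse_one_minus X (- ?a k) \<and> norm X \<le> K" using pow[of "-1" k] by auto
  qed
  then obtain R where R: "\<And>k. inverse_one_minus (R k) (- ?a k)" "\<And>k. norm (R k) \<le> K" by metis
  have step: "norm (Q (Suc k) - Q k) \<le> (K * K + K) * (2 * K + 1) * (1/2) ^ k" for k
  proof -
    have "Q (Suc k) = (1/2) *\<^sub>R (Q k + R k)"
      using inverse_one_minus_unique[OF Q(1)[of "Suc k"]] inverse_one_minus_square(1)[OF Q(1) R(1), of k]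
      by simp
    then have "Q (Suc k) - Q k = (Q k - (Q k o\<^sub>L Q k)) o\<^sub>L (2 *\<^sub>R R k - id_blinfun)"
      using inverse_one_minus_square(3)[OF Q(1) R(1), of k] by simp
    then have "norm (Q (Suc k) - Q k) \<le> norm (Q k - (Q k o\<^sub>L Q k)) * norm (2 *\<^sub>R R k - id_blinfun)"
      by (simp add: norm_blinfun_compose)
    also have "\<dots> \<le> ((K * K + K) / 2 ^ k) * (2 * K + 1)"
    proof (rule mult_mono)
      show "norm (Q k - (Q k o\<^sub>L Q k)) \<le> (K * K + K) / 2 ^ k" using Q(3)[of k] by (simp add: norm_minus_commute)
      have "norm (id_blinfun :: 'a \<Rightarrow>\<^sub>L 'a) \<le> 1" by (rule norm_blinfun_id_le)
      then show "norm (2 *\<^sub>R R k - id_blinfun) \<le> 2 * K + 1"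
        using norm_triangle_ineq4[of "2 *\<^sub>R R k" id_blinfun] R(2)[of k] by simp
    qed (use K0 in auto)
    finally show ?thesis by (simp add: power_divide field_simps)
  qed
  have "summable (\<lambda>k. Q (Suc k) - Q k)"
  proof (rule summable_comparison_test)
    show "\<exists>N. \<forall>n\<ge>N. norm (Q (Suc n) - Q n) \<le> (K * K + K) * (2 * K + 1) * (1/2) ^ n"
      using step by blast
    show "summable (\<lambda>k. (K * K + K) * (2 * K + 1) * (1/2) ^ k)"
      by (intro summable_mult summable_geometric) simp
  qed
  then have "convergent (\<lambda>n. Q n - Q 0)"
    by (simp only: summable_iff_convergent sum_lessThan_telescope)
  then obtain P0 where "(\<lambda>n. Q n - Q 0) \<longlonglongrightarrow> P0" by (auto simp: convergent_def)
  then have "(\<lambda>n. Q n - Q 0 + Q 0) \<longlonglongrightarrow> P0 + Q 0" by (intro tendsto_intros)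
  then obtain P where P: "Q \<longlonglongrightarrow> P" by auto
  have Px: "(\<lambda>k. Q k x) \<longlonglongrightarrow> P x" for x
    by (intro blinfun.tendsto P tendsto_const)
  have PP: "P (P x) = P x" for x
  proof -
    have "(\<lambda>k. (Q k o\<^sub>L Q k) - Q k) \<longlonglongrightarrow> (P o\<^sub>L P) - P"
      by (intro tendsto_diff tendsto_compose_blinfun P)
    moreover have "(\<lambda>k. (Q k o\<^sub>L Q k) - Q k) \<longlonglongrightarrow> 0"
    proof (rule tendsto_norm_zero_cancel, rule real_tendsto_sandwich[of "\<lambda>_. 0"])
      show "(\<lambda>k. (K * K + K) * (1/2) ^ k) \<longlonglongrightarrow> 0"
        by (intro tendsto_mult_right_zero LIMSEQ_power_zero) simp
      show "\<forall>\<^sub>F k in sequentially. norm ((Q k o\<^sub>L Q k) - Q k) \<le> (K * K + K) * (1/2) ^ k"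
        using Q(3) by (simp add: power_divide)
    qed auto
    ultimately have "(P o\<^sub>L P) - P = 0" by (rule LIMSEQ_unique)
    then have "((P o\<^sub>L P) - P) x = 0" by simp
    then show ?thesis by (simp add: blinfun.diff_left)
  qed
  have Sa: "S (?a k v) = ?a k (S v)" if "\<And>v. blinfun_apply S (z v) = z (S v)" for S k v
    by (induction k arbitrary: v) (simp_all add: that)
  have SQ: "S (Q k v) = Q k (S v)" if "\<And>v. blinfun_apply S (z v) = z (S v)" for S k v
    by (rule inverse_one_minus_commute[OF Q(1)]) (rule Sa[OF that])
  have SP: "S (P v) = P (S v)" if S: "\<And>v. blinfun_apply S (z v) = z (S v)" for S v
  proof -
    have "(\<lambda>k. S (Q k v)) \<longlonglongrightarrow> S (P v)" by (intro blinfun.tendsto tendsto_const Px)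
    moreover have "(\<lambda>k. S (Q k v)) \<longlonglongrightarrow> P (S v)" using Px[of "S v"] by (simp add: SQ[OF S])
    ultimately show ?thesis by (rule LIMSEQ_unique)
  qed
  have az: "?a k (z v) = z (?a k v)" for k v using Sa[of z] by simp
  have close: "\<exists>k. norm (Q k - P) \<le> e" if "e > 0" for e
  proof -
    have "\<forall>\<^sub>F k in sequentially. dist (Q k) P < e" using P that by (rule tendstoD)
    then show ?thesis by (auto simp: eventually_sequentially dist_norm intro: less_imp_le)
  qed
  \<comment> \<open>The constant makes \<open>2 * (d * norm P)\<close> at most \<open>1/2\<close>
    for the decay estimate, and \<open>d \<le> 1/4\<close> lets a term in the estimated norm be
    absorbed.\<close>
  define d where "d = 1 / (4 * (norm P + 1))"
  have d: "d > 0" "d \<le> 1/4" by (auto simp: d_def divide_simps add_nonneg_pos)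
  obtain k where k: "norm (Q k - P) \<le> d" using close[OF d(1)] by blast
  \<comment> \<open>\<open>P\<close> fixes both \<open>P x\<close> and \<open>?w\<close>, and
    \<open>Q k\<close> takes \<open>?w\<close> to \<open>Q k (P x) - P x\<close>; comparing
    \<open>Q k\<close> with \<open>P\<close> expresses \<open>?w\<close> by the error
    \<open>Q k - P\<close> alone.\<close>
  have decay: "norm (?a k (P x)) \<le> 1/2 * norm x" for x
  proof -
    let ?w = "?a k (P x)"
    have Pw: "P ?w = ?w" using SP[OF az, of k "P x"] by (simp add: PP)
    have "Q k ?w = Q k (P x) - P x" by (rule inverse_one_minusD(1)[OF Q(1)])
    then have "?w = (Q k - P) (P x) - (Q k - P) ?w" by (simp add: blinfun.diff_left PP Pw)
    then have "norm ?w \<le> norm ((Q k - P) (P x)) + norm ((Q k - P) ?w)" by (metis norm_triangle_ineq4)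
    also have "\<dots> \<le> d * norm (P x) + d * norm ?w"
      using k by (intro add_mono order.trans[OF norm_blinfun] mult_right_mono) auto
    also have "\<dots> \<le> d * (norm P * norm x) + 1/4 * norm ?w"
      using d by (intro add_mono mult_left_mono mult_right_mono norm_blinfun) auto
    finally have "norm ?w \<le> d * (norm P * norm x) + 1/4 * norm ?w" .
    moreover have "0 \<le> d * (norm P * norm x)" using d(1) by simp
    ultimately have "norm ?w \<le> 2 * (d * (norm P * norm x))" by linarith
    also have "\<dots> = 2 * (d * norm P) * norm x" by simp
    also have "\<dots> \<le> 1/2 * norm x"
      by (intro mult_right_mono) (auto simp: d_def divide_simps add_nonneg_pos)
    finally show ?thesis .
  qed
  obtain b where b: "\<And>v. ?a k v = blinfun_apply b (z v)" by (rule square_iter_factor[of z k]) blast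
  define c where "c = 1 / (2 * (K * norm b + 1))"
  have Kb: "K * norm b \<ge> 0" using K0 by simp
  then have c: "c > 0" by (simp add: c_def add_nonneg_pos)
  \<comment> \<open>On the kernel of \<open>P\<close> the operator \<open>Q k\<close> is small, so
    in \<open>x = Q k x - Q k (?a k x)\<close> the second term must carry the norm, and
    \<open>?a k x\<close> is \<open>b (z x)\<close>.\<close>
  have below: "c * norm x \<le> norm (z x)" if x: "P x = 0" for x
  proof -
    have "x = (Q k - P) x - Q k (b (z x))"
      using inverse_one_minusD(1)[OF Q(1), of k x] by (simp add: b blinfun.diff_left x)
    then have "norm x \<le> norm ((Q k - P) x) + norm (Q k (b (z x)))" by (metis norm_triangle_ineq4)
    also have "\<dots> \<le> 1/4 * norm x + K * (norm b * norm (z x))"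
    proof (intro add_mono)
      show "norm ((Q k - P) x) \<le> 1/4 * norm x"
        using k d by (intro order.trans[OF norm_blinfun] mult_right_mono) auto
      show "norm (Q k (b (z x))) \<le> K * (norm b * norm (z x))"
        using K0 Q(2) by (intro order.trans[OF norm_blinfun] mult_mono norm_blinfun) auto
    qed
    finally have "norm x \<le> 1/4 * norm x + K * (norm b * norm (z x))" .
    then have "norm x \<le> 2 * (K * (norm b * norm (z x)))"
      using norm_ge_zero[of x] by linarith
    also have "\<dots> = 2 * (K * norm b) * norm (z x)" by simp
    also have "\<dots> \<le> 2 * (K * norm b + 1) * norm (z x)" by (intro mult_right_mono) auto
    finally show ?thesis using Kb by (simp add: c_def field_simps)
  qed
  define M where "M = {x. P x = 0}"
  have M: "subspace M" "closed M"
    by (auto simp: M_def subspace_def blinfun.bilinear_simps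
        intro!: closed_Collect_eq continuous_intros blinfun.continuous_on)
  have "complete (z ` M)"
    by (rule complete_isometric_image[OF c M(1) blinfun.bounded_linear_right])
      (use below M(2) in \<open>auto simp: M_def complete_eq_closed\<close>)
  then have zM: "closed (z ` M)" by (simp add: complete_eq_closed)
  \<comment> \<open>Every \<open>x - Q k x\<close> is the image under \<open>z\<close> of a vector
    of \<open>M\<close>, and these converge to \<open>x\<close>; the lower bound has made the image
    closed.\<close>
  have onto: "\<exists>y. P y = 0 \<and> z y = x" if x: "P x = 0" for x
  proof -
    have "(\<lambda>k. x - Q k x) \<longlonglongrightarrow> x - P x" by (intro tendsto_intros Px)
    moreover have "x - Q k x \<in> z ` M" for k
    proof -
      obtain b where b: "\<And>v. ?a k v = blinfun_apply b (z v)" "\<And>v. ?a k v = z (b v)"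
        by (rule square_iter_factor[of z k]) blast
      have bz: "b (z v) = z (b v)" for v using b by metis
      have "P (- b (Q k x)) = 0"
        using SP[OF bz, of "Q k x"] SP[of "Q k" x] SQ[of z k] x by (simp add: blinfun.minus_right blinfun.zero_right)
      moreover have "z (- b (Q k x)) = x - Q k x"
        using inverse_one_minusD(2)[OF Q(1), of k x] by (simp add: b(2) blinfun.minus_right)
      ultimately show ?thesis unfolding M_def by (metis (mono_tags) imageI mem_Collect_eq)
    qed
    ultimately have "x - P x \<in> z ` M" by (rule closed_sequentially[OF zM, rotated])
    then show ?thesis using x by (auto simp: M_def)
  qed
  show thesis
  proof (rule that[of P "2 ^ k" c])
    show "P (P x) = P x" for x by (rule PP)
    show "S o\<^sub>L P = P o\<^sub>L S" if S: "S o\<^sub>L z = z o\<^sub>L S" for S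
    proof -
      have "S (z v) = z (S v)" for v using arg_cong[OF S, of "\<lambda>T. blinfun_apply T v"] by simp
      then show ?thesis by (intro blinfun_eqI) (simp add: SP)
    qed
    show "norm ((blinfun_apply z ^^ 2 ^ k) (P x)) \<le> 1/2 * norm x" for x
      using decay[of x] by (simp only: square_iter_apply)
    show "c > 0" by (rule c)
    show "c * norm x \<le> norm (z x)" if "P x = 0" for x by (rule below[OF that])
    show "\<exists>y. P y = 0 \<and> z y = x" if "P x = 0" for x by (rule onto[OF that])
  qed
qed

section \<open>Von Neumann algebras\<close>

text \<open>Both parts are real inner products, so a real adjoint or orthogonality relation that
  respects multiplication by \<open>\<i>\<close> holds for \<open>cinner\<close> as well.\<close>

lemma cinner_eq_Complex: "cinner u v = Complex (u \<bullet> v) (((- \<i>) *\<^sub>C u) \<bullet> v)"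
  by (rule complex_eqI) (simp_all only: complex.sel inner_eq_Re_cinner cinner_scaleC_left, simp)

lemma cinner_scaleC_right: "cinner u (c *\<^sub>C v) = cnj c * cinner u v"
  by (metis cinner_commute cinner_scaleC_left complex_cnj_cnj complex_cnj_mult)

lemma inner_scaleC: "(c *\<^sub>C u) \<bullet> v = u \<bullet> (cnj c *\<^sub>C v)"
  by (simp add: inner_eq_Re_cinner cinner_scaleC_left cinner_scaleC_right)

lemma cadjoint_eq_adj:
  assumes "T \<in> bounded_clinear_ops"
  shows "cadjoint T = adj T"
  unfolding cadjoint_def
proof (rule the_equality)
  show "\<forall>x y. cinner (T x) y = cinner x (adj T y)"
  proof (intro allI)
    fix x y
    have "(- \<i>) *\<^sub>C T x = T ((- \<i>) *\<^sub>C x)"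
      using assms unfolding bounded_clinear_ops_iff by metis
    then show "cinner (T x) y = cinner x (adj T y)"
      unfolding cinner_eq_Complex by (simp only: adj_right)
  qed
next
  fix S assume S: "\<forall>x y. cinner (T x) y = cinner x (blinfun_apply S y)"
  show "S = adj T"
    by (rule adj_eqI[symmetric]) (simp add: inner_eq_Re_cinner S)
qed

lemma csubspace_iff:
  "csubspace L \<longleftrightarrow> subspace L \<and> (\<forall>c. \<forall>x\<in>L. c *\<^sub>C x \<in> L)"
  unfolding complex_vector.subspace_def subspace_def by (auto simp: scaleR_scaleC)

lemma orth_proj_eq_oproj:
  assumes "closed_csubspace L"
  shows "orth_proj L = oproj L"
proof -
  have L: "subspace L" "closed L" and Lc: "\<And>c x. x \<in> L \<Longrightarrow> c *\<^sub>C x \<in> L"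
    using assms by (auto simp: closed_csubspace_def csubspace_iff)
  show ?thesis unfolding orth_proj_def
  proof (rule the_equality)
    show "\<forall>x. oproj L x \<in> L \<and> (\<forall>y\<in>L. cinner (x - oproj L x) y = 0)"
    proof (intro allI conjI ballI oproj_in[OF L])
      fix x y assume y: "y \<in> L"
      have o: "(x - oproj L x) \<bullet> w = 0" if "w \<in> L" for w
        using oproj_orth[OF L that, of x] by (simp add: inner_diff_left)
      show "cinner (x - oproj L x) y = 0"
        unfolding cinner_eq_Complex inner_scaleC o[OF y] o[OF Lc[OF y]]
        by (simp add: zero_complex.code)
    qed
  next
    fix P assume P: "\<forall>x. blinfun_apply P x \<in> L \<and> (\<forall>y\<in>L. cinner (x - P x) y = 0)"
    show "P = oproj L"
    proof (rule blinfun_eqI, rule oproj_eqI[OF L, symmetric])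
      show "P x \<in> L" for x using P by blast
      show "(x - P x) \<bullet> y = 0" if "y \<in> L" for x y
        using P that by (simp add: inner_eq_Re_cinner)
    qed
  qed
qed

lemma adj_bounded_clinear:
  assumes "T \<in> bounded_clinear_ops"
  shows "adj T \<in> bounded_clinear_ops"
  unfolding bounded_clinear_ops_iff
proof (intro allI)
  fix k y
  show "adj T (k *\<^sub>C y) = k *\<^sub>C adj T y"
  proof (rule inner_left_eqI)
    fix x
    have s: "u \<bullet> (k *\<^sub>C v) = (cnj k *\<^sub>C u) \<bullet> v" for u v :: 'a by (simp add: inner_scaleC)
    have "x \<bullet> adj T (k *\<^sub>C y) = (cnj k *\<^sub>C T x) \<bullet> y" by (simp add: s flip: adj_right)
    also have "\<dots> = T (cnj k *\<^sub>C x) \<bullet> y" using assms by (simp add: bounded_clinear_ops_iff)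
    also have "\<dots> = x \<bullet> (k *\<^sub>C adj T y)" by (simp add: s adj_right)
    finally show "x \<bullet> adj T (k *\<^sub>C y) = x \<bullet> (k *\<^sub>C adj T y)" .
  qed
qed

section \<open>The dictionary between a von Neumann algebra and the invariant subspaces of its
  commutant\<close>

locale von_neumann =
  fixes A :: "('a::chilbert_space \<Rightarrow>\<^sub>L 'a) set"
  assumes vna: "von_neumann_algebra A"
begin

lemma A_clinear: "T \<in> A \<Longrightarrow> T \<in> bounded_clinear_ops"
  using vna by (auto simp: von_neumann_algebra_def)

lemma A_adj: "T \<in> A \<Longrightarrow> adj T \<in> A"
  using vna cadjoint_eq_adj[OF A_clinear] by (metis von_neumann_algebra_def)

sublocale star_closed "commutant A"
proof
  fix c assume c: "c \<in> commutant A"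
  have "adj c o\<^sub>L X = X o\<^sub>L adj c" if "X \<in> A" for X
  proof -
    have "c o\<^sub>L adj X = adj X o\<^sub>L c" using c A_adj[OF that] by (simp add: commutant_def)
    then have "adj (c o\<^sub>L adj X) = adj (adj X o\<^sub>L c)" by simp
    then show ?thesis by (simp add: adj_compose)
  qed
  then show "adj c \<in> commutant A"
    using c adj_bounded_clinear[of c] by (auto simp: commutant_def)
qed

text \<open>Scalars in the commutant make invariant subspaces complex and elements of
  \<open>alg\<close> complex-linear.\<close>

lemma scaleC_in_commutant: "k *\<^sub>C\<^sub>L id_blinfun \<in> commutant A"
proof -
  have "(k *\<^sub>C\<^sub>L id_blinfun) o\<^sub>L X = X o\<^sub>L (k *\<^sub>C\<^sub>L id_blinfun)" if "X \<in> A" for X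
    using A_clinear[OF that] by (intro blinfun_eqI) (simp add: bounded_clinear_ops_iff)
  then show ?thesis
    by (simp add: commutant_def bounded_clinear_ops_iff scaleC_scaleC mult.commute)
qed

lemma alg_eq: "alg = A"
proof -
  have "T \<in> alg \<longleftrightarrow> T \<in> commutant (commutant A)" for T
  proof
    assume T: "T \<in> alg"
    have "T \<in> bounded_clinear_ops"
      unfolding bounded_clinear_ops_iff using algD[OF T scaleC_in_commutant] by simp
    moreover have "T o\<^sub>L c = c o\<^sub>L T" if "c \<in> commutant A" for c
      using algD[OF T that] by (intro blinfun_eqI) simp
    ultimately show "T \<in> commutant (commutant A)" by (simp add: commutant_def)
  next
    assume T: "T \<in> commutant (commutant A)"
    show "T \<in> alg" unfolding alg_def
    proof (intro CollectI ballI allI)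
      fix c x assume "c \<in> commutant A"
      then have "T o\<^sub>L c = c o\<^sub>L T" using T by (simp add: commutant_def[of "commutant A"])
      then show "T (c x) = c (T x)" by (metis blinfun_apply_blinfun_compose)
    qed
  qed
  then show ?thesis using vna by (auto simp: von_neumann_algebra_def)
qed

lemma aff_closed_csubspace:
  assumes "aff L"
  shows "closed_csubspace L"
  unfolding closed_csubspace_def csubspace_iff
  using affD(1,2)[OF assms] affD(3)[OF assms scaleC_in_commutant] by simp

lemma projections_iff: "P \<in> projections A \<longleftrightarrow> (\<exists>L. aff L \<and> P = oproj L)"
proof
  assume "P \<in> projections A"
  then have P: "P \<in> alg" "P o\<^sub>L P = P" "adj P = P"
    using cadjoint_eq_adj[OF A_clinear] by (auto simp: projections_def alg_eq)
  have PP: "P (P x) = P x" for x using P(2) by (metis blinfun_apply_blinfun_compose)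
  have r: "range P = {x. (id_blinfun - P) x = 0}"
    using PP by (auto simp: blinfun.diff_left image_iff)
  have L: "aff (range P)" unfolding r by (intro aff_kernel alg_diff alg_id P)
  have "P = oproj (range P)"
  proof (rule blinfun_eqI, rule oproj_eqI[OF affD(1,2)[OF L], symmetric])
    fix x y assume "y \<in> range P"
    then obtain u where u: "y = P u" by blast
    have "P (x - P x) \<bullet> u = 0" by (simp add: blinfun.diff_right PP)
    then show "(x - P x) \<bullet> y = 0" unfolding u adj_right P(3) .
  qed simp
  then show "\<exists>L. aff L \<and> P = oproj L" using L by blast
next
  assume "\<exists>L. aff L \<and> P = oproj L"
  then obtain L where L: "aff L" "P = oproj L" by blast
  note L' = affD(1,2)[OF L(1)]
  have "P \<in> A" using oproj_in_alg[OF L(1)] L(2) by (simp add: alg_eq)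
  moreover have "P o\<^sub>L P = P"
    unfolding L(2) by (rule blinfun_eqI) (simp add: oproj_id[OF L' oproj_in[OF L']])
  ultimately show "P \<in> projections A"
    using cadjoint_eq_adj[OF A_clinear, of P] adj_oproj[OF L'] by (simp add: projections_def L(2))
qed

lemma mvn_equivalent_isometry:
  assumes L: "aff L" and V: "V \<in> alg" "\<And>x. x \<in> L \<Longrightarrow> norm (V x) = norm x"
  shows "mvn_equivalent A (oproj L) (oproj (V ` L))"
proof -
  note L' = affD(1,2)[OF L]
  note K' = affD(1,2)[OF aff_isometric_image[OF L V]]
  define W where "W = V o\<^sub>L oproj L"
  have W: "W \<in> alg" unfolding W_def by (intro alg_compose V oproj_in_alg L)
  have adjW: "adj W = oproj L o\<^sub>L adj V" by (simp add: W_def adj_compose adj_oproj[OF L'])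
  have "adj W o\<^sub>L W = oproj L"
    using isometry_left_inverse[OF L V oproj_in[OF L']]
    by (intro blinfun_eqI) (simp add: adjW, simp add: W_def)
  moreover have "W o\<^sub>L adj W = oproj (V ` L)"
  proof (rule blinfun_eqI, rule oproj_eqI[OF K', symmetric])
    fix x
    show "(W o\<^sub>L adj W) x \<in> V ` L" using oproj_in[OF L'] by (simp add: W_def)
    fix y assume "y \<in> V ` L"
    then obtain l where l: "l \<in> L" "y = V l" by blast
    have y: "W (adj W y) = y"
      using isometry_left_inverse[OF L V l(1)] by (simp add: adjW l(2)) (simp add: W_def oproj_id[OF L' l(1)])
    have "W (adj W x) \<bullet> y = x \<bullet> W (adj W y)" by (simp only: adj_right[of W] adj_left[of W])
    then show "(x - (W o\<^sub>L adj W) x) \<bullet> y = 0" by (simp add: inner_diff_left y)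
  qed
  ultimately show ?thesis
    unfolding mvn_equivalent_def using W cadjoint_eq_adj[OF A_clinear] by (metis alg_eq)
qed

text \<open>If \<open>V\<close> realises an equivalence of \<open>oproj L\<close> with a
  subprojection \<open>oproj K\<close>, it maps \<open>L\<close> isometrically into
  \<open>K \<subseteq> L\<close>, and finiteness gives \<open>L = V L \<subseteq> K\<close>.
  Conversely a self-isometry of \<open>L\<close> yields such an equivalence with
  \<open>V L\<close>.\<close>

lemma finite_projections_oproj_iff:
  assumes L: "aff L"
  shows "oproj L \<in> finite_projections A \<longleftrightarrow> fin L"
proof
  note L' = affD(1,2)[OF L]
  assume fp: "oproj L \<in> finite_projections A"
  show "fin L" unfolding fin_def
  proof (intro conjI L ballI impI, elim conjE)
    fix V assume V: "V \<in> alg" "\<forall>x\<in>L. norm (V x) = norm x" "V ` L \<subseteq> L"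
    then have iso: "norm (V x) = norm x" if "x \<in> L" for x using that by blast
    note K = aff_isometric_image[OF L V(1) iso]
    note K' = affD(1,2)[OF K]
    have "mvn_equivalent A (oproj L) (oproj (V ` L))"
      by (rule mvn_equivalent_isometry[OF L V(1) iso])
    moreover have "oproj (V ` L) \<in> projections A" using K projections_iff by blast
    moreover have "subprojection (oproj (V ` L)) (oproj L)"
      using V(3) range_oproj[OF L'] range_oproj[OF K'] by (simp add: subprojection_def)
    ultimately have "oproj (V ` L) = oproj L" using fp unfolding finite_projections_def by blast
    then show "V ` L = L" using range_oproj[OF L'] range_oproj[OF K'] by simp
  qed
next
  note L' = affD(1,2)[OF L]
  assume fin: "fin L"
  have "Q = oproj L" if Q: "Q \<in> projections A" "subprojection Q (oproj L)" "mvn_equivalent A (oproj L) Q" for Q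
  proof -
    obtain K where K: "aff K" "Q = oproj K" using Q(1) projections_iff by blast
    note K' = affD(1,2)[OF K(1)]
    have KL: "K \<subseteq> L" using Q(2) unfolding subprojection_def K(2) range_oproj[OF L'] range_oproj[OF K'] .
    obtain V where V: "V \<in> A" "adj V o\<^sub>L V = oproj L" "V o\<^sub>L adj V = oproj K"
      using Q(3) cadjoint_eq_adj[OF A_clinear] unfolding mvn_equivalent_def K(2) by metis
    have VV: "adj V (V x) = oproj L x" and VV': "V (adj V x) = oproj K x" for x
      using V(2,3) by (metis blinfun_apply_blinfun_compose)+
    have VL: "V ` L = L"
    proof (rule finD[OF fin])
      show "V \<in> alg" using V(1) by (simp add: alg_eq)
      fix x assume x: "x \<in> L"
      have "V x \<bullet> V x = x \<bullet> x" by (simp add: adj_right VV oproj_id[OF L' x])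
      then show "norm (V x) = norm x" by (simp add: norm_eq)
      have "oproj K (V x) = V x" by (simp add: VV oproj_id[OF L' x] flip: VV')
      then show "V x \<in> L" using KL by (auto simp: oproj_eq_id_iff[OF K'])
    qed
    have "V ` L \<subseteq> K"
    proof (rule image_subsetI)
      fix x assume x: "x \<in> L"
      have "oproj K (V x) = V x" by (simp add: VV oproj_id[OF L' x] flip: VV')
      then show "V x \<in> K" by (simp add: oproj_eq_id_iff[OF K'])
    qed
    then have "K = L" unfolding VL by (rule subset_antisym[OF KL])
    then show ?thesis by (simp add: K(2))
  qed
  moreover have "oproj L \<in> projections A" using L projections_iff by blast
  ultimately show "oproj L \<in> finite_projections A" unfolding finite_projections_def by blast
qed

lemma finite_projectionE:
  assumes "P \<in> finite_projections A"
  obtains L where "fin L" "P = oproj L"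
proof -
  have "P \<in> projections A" using assms by (simp add: finite_projections_def)
  then obtain L where L: "aff L" "P = oproj L" using projections_iff by blast
  then show thesis using that finite_projections_oproj_iff[OF L(1)] assms by blast
qed

end

section \<open>Generalized Browder operators are Fredholm\<close>

text \<open>
  The inclination of \<open>M\<close> to the orthogonal complement of \<open>N\<close> is positive, by the lower bound for adjoints
  applied to the compression from \<open>M\<close> to that complement and then to its adjoint.
\<close>

lemma complement_projection_bounded_below:
  fixes M N :: "'a::{real_inner,banach} set"
  assumes M: "subspace M" "closed M" and N: "subspace N" "closed N"
    and MN: "M \<inter> N = {0}" and sum: "\<And>x. \<exists>m\<in>M. \<exists>n\<in>N. x = m + n"
  obtains c where "c > 0" "\<And>m. m \<in> M \<Longrightarrow> c * norm m \<le> norm (oproj (N\<^sup>\<bottom>) m)"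
proof -
  note N' = subspace_orthogonal_comp[of N] closed_orthogonal_comp[of N]
  define T where "T = oproj (N\<^sup>\<bottom>) o\<^sub>L oproj M"
  have adjT: "adj T = oproj M o\<^sub>L oproj (N\<^sup>\<bottom>)"
    by (simp add: T_def adj_compose adj_oproj[OF M] adj_oproj[OF N'])
  have "N\<^sup>\<bottom> \<subseteq> range T"
  proof
    fix x assume x: "x \<in> N\<^sup>\<bottom>"
    obtain m n where mn: "m \<in> M" "n \<in> N" "x = m + n" using sum by blast
    have "oproj (N\<^sup>\<bottom>) n = 0" unfolding oproj_comp[OF N] using oproj_id[OF N mn(2)] by simp
    then have "oproj (N\<^sup>\<bottom>) m = oproj (N\<^sup>\<bottom>) x" by (simp add: mn(3) blinfun.add_right)
    then have "T m = x" by (simp add: T_def oproj_id[OF M mn(1)] oproj_id[OF N' x])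
    then show "x \<in> range T" by blast
  qed
  then obtain c where c: "c > 0" "\<And>y. y \<in> N\<^sup>\<bottom> \<Longrightarrow> c * norm y \<le> norm (adj T y)"
    by (rule adj_bounded_below[OF N']) blast
  have c': "c * norm y \<le> norm (oproj M y)" if "y \<in> N\<^sup>\<bottom>" for y
    using c(2)[OF that] by (simp add: adjT oproj_id[OF N' that])
  define R where "R = oproj M ` (N\<^sup>\<bottom>)"
  have "complete R" unfolding R_def
    by (rule complete_isometric_image[OF c(1) N'(1) blinfun.bounded_linear_right])
      (use c' N'(2) in \<open>auto simp: complete_eq_closed\<close>)
  then have R: "subspace R" "closed R"
    using linear_subspace_image[OF bounded_linear.linear[OF blinfun.bounded_linear_right] N'(1)]
    by (auto simp: complete_eq_closed R_def)
  \<comment> \<open>The first bound makes \<open>R\<close> closed, so it can be projected onto. A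
    vector of \<open>M\<close> orthogonal to \<open>R\<close> lies in \<open>N\<close> as well and
    vanishes, hence \<open>R\<close> fills \<open>M\<close>.\<close>
  have "M \<subseteq> range (adj T)"
  proof
    fix m assume m: "m \<in> M"
    let ?d = "m - oproj R m"
    have RM: "R \<subseteq> M" using oproj_in[OF M] by (auto simp: R_def)
    have dM: "?d \<in> M" using m RM oproj_in[OF R] by (intro subspace_diff M) auto
    have "y \<bullet> ?d = 0" if "y \<in> N\<^sup>\<bottom>" for y
    proof -
      have "oproj M y \<bullet> ?d = 0"
        using oproj_diff_in[OF R, of m] that by (auto simp: R_def in_orthogonal_comp_iff)
      then show ?thesis using oproj_orth[OF M dM, of y] by simp
    qed
    then have "?d \<in> N\<^sup>\<bottom>\<^sup>\<bottom>" by (simp add: in_orthogonal_comp_iff)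
    then have "?d \<in> N" unfolding orthogonal_comp_orthogonal_comp[OF N] .
    then have "?d = 0" using dM MN by blast
    then have "m \<in> R" using oproj_in[OF R, of m] by simp
    then obtain y where "y \<in> N\<^sup>\<bottom>" "m = oproj M y" by (auto simp: R_def)
    then have "adj T y = m" by (simp add: adjT oproj_id[OF N'])
    then show "m \<in> range (adj T)" by blast
  qed
  then obtain d where d: "d > 0" "\<And>y. y \<in> M \<Longrightarrow> d * norm y \<le> norm (adj (adj T) y)"
    by (rule adj_bounded_below[OF M]) blast
  show thesis
    by (rule that[OF d(1)]) (use d(2) in \<open>simp add: T_def oproj_id[OF M]\<close>)
qed

text \<open>Continuity of the inverse at \<open>0\<close> gives a radius \<open>d\<close>; each
  \<open>m\<close> is rescaled so that its image has norm \<open>d / 2\<close>, and homogeneity of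
  \<open>F\<close> spreads the estimate over \<open>M\<close>.\<close>

lemma homeomorphism_bounded_below:
  fixes F :: "'a::real_normed_vector \<Rightarrow>\<^sub>L 'a"
  assumes M: "subspace M" and G: "homeomorphism M M F G"
  obtains c where "c > 0" "\<And>m. m \<in> M \<Longrightarrow> c * norm m \<le> norm (F m)"
proof -
  have GF: "G (F m) = m" if "m \<in> M" for m using G that by (simp add: homeomorphism_def)
  have FM: "F m \<in> M" if "m \<in> M" for m using G that by (auto simp: homeomorphism_def)
  have 0: "0 \<in> M" by (rule subspace_0[OF M])
  have G0: "G 0 = 0" using GF[OF 0] by (simp add: blinfun.zero_right)
  have "continuous_on M G" using G by (simp add: homeomorphism_def)
  then obtain d where d: "d > 0" "\<And>y. y \<in> M \<Longrightarrow> dist y 0 < d \<Longrightarrow> dist (G y) (G 0) < 1"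
    unfolding continuous_on_iff using 0 zero_less_one by blast
  have "d / 2 * norm m \<le> norm (F m)" if m: "m \<in> M" for m
  proof (cases "m = 0")
    case False
    then have n: "norm (F m) > 0" using GF[OF m] G0 by auto
    define t where "t = d / (2 * norm (F m))"
    have t: "t > 0" using d(1) n by (simp add: t_def)
    have tm: "t *\<^sub>R m \<in> M" by (rule subspace_scale[OF M m])
    have "norm (F (t *\<^sub>R m)) = d / 2" using n d(1) by (simp add: blinfun.scaleR_right t_def)
    then have "dist (G (F (t *\<^sub>R m))) (G 0) < 1" using d(1) by (intro d(2) FM tm) simp
    then have "t * norm m < 1" using t by (simp add: GF[OF tm] G0)
    then show ?thesis using n by (simp add: t_def field_simps)
  qed simp
  then show thesis using d(1) by (intro that[of "d / 2"]) auto
qed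

context von_neumann
begin

lemma generalized_browder_imp_fredholm:
  assumes "generalized_browder A F"
  shows "breuer_fredholm A F"
proof -
  obtain M N G where FA: "F \<in> A" and dec: "direct_decomposition M N"
    and inv: "F ` M \<subseteq> M" "F ` N \<subseteq> N" and G: "homeomorphism M M F G"
    and fN: "orth_proj N \<in> finite_projections A"
    using assms unfolding generalized_browder_def by blast
  have F: "F \<in> alg" using FA by (simp add: alg_eq)
  have cM: "closed_csubspace M" and cN: "closed_csubspace N" and MN: "M \<inter> N = {0}"
    using dec unfolding direct_decomposition_def by blast+
  have sum: "\<exists>m\<in>M. \<exists>n\<in>N. x = m + n" for x
  proof -
    have "x \<in> {x + y |x y. x \<in> M \<and> y \<in> N}" using dec by (simp add: direct_decomposition_def)
    then show ?thesis by blast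
  qed
  have M: "subspace M" "closed M" and N: "subspace N" "closed N"
    using cM cN by (auto simp: closed_csubspace_def csubspace_iff)
  obtain N1 where N1: "fin N1" "oproj N = oproj N1"
    using fN unfolding orth_proj_eq_oproj[OF cN] by (rule finite_projectionE)
  have "range (oproj N) = range (oproj N1)" by (simp only: N1(2))
  then have "N1 = N"
    by (simp only: range_oproj[OF N] range_oproj[OF affD(1,2)[OF fin_aff[OF N1(1)]]])
  then have N_fin: "fin N" using N1 by simp
  note aN = fin_aff[OF N_fin]
  note aNc = aff_comp[OF aN]
  note N' = affD(1,2)[OF aNc]
  obtain c1 where c1: "c1 > 0" "\<And>m. m \<in> M \<Longrightarrow> c1 * norm m \<le> norm (F m)"
    by (rule homeomorphism_bounded_below[OF M(1) G]) blast
  obtain c2 where c2: "c2 > 0" "\<And>m. m \<in> M \<Longrightarrow> c2 * norm m \<le> norm (oproj (N\<^sup>\<bottom>) m)"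
    by (rule complement_projection_bounded_below[OF M N MN sum]) blast
  have projN: "oproj (N\<^sup>\<bottom>) n = 0" if "n \<in> N" for n
    unfolding oproj_comp[OF N] using oproj_id[OF N that] by simp

  \<comment> \<open>For \<open>x = m + n\<close> in the kernel, \<open>F m = - F n\<close> lies in
    both \<open>M\<close> and \<open>N\<close>, and \<open>F\<close> is injective on
    \<open>M\<close>.\<close>
  have ker: "kernel F \<subseteq> N"
  proof
    fix x assume "x \<in> kernel F"
    then have Fx: "F x = 0" by (simp add: kernel_def)
    obtain m n where mn: "m \<in> M" "n \<in> N" "x = m + n" using sum by blast
    have "F m = - F n" using Fx by (simp add: mn(3) blinfun.add_right eq_neg_iff_add_eq_0)
    then have "F m \<in> N" using inv(2) mn(2) subspace_neg[OF N(1)] by auto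
    then have "F m = 0" using inv(1) mn(1) MN by blast
    then have "m = 0" using c1(2)[OF mn(1)] c1(1) by (simp add: mult_le_0_iff)
    then show "x \<in> N" using mn by simp
  qed
  have aker: "aff (kernel F)" unfolding kernel_def by (rule aff_kernel[OF F])
  have kernel_fin: "orth_proj (kernel F) \<in> finite_projections A"
    unfolding orth_proj_eq_oproj[OF aff_closed_csubspace[OF aker]] finite_projections_oproj_iff[OF aker]
    by (rule fin_subset[OF aker ker N_fin])

  \<comment> \<open>Modulo \<open>N\<close> the vectors \<open>y\<close> and \<open>m\<close> agree,
    and so do \<open>F y\<close> and \<open>F m\<close>; \<open>y\<close> is no longer than
    \<open>m\<close>, and \<open>c2\<close> bounds the loss in passing from \<open>F m\<close> to
    its component orthogonal to \<open>N\<close>.\<close>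
  have below: "c2 * c1 * norm y \<le> norm (F y)" if y: "y \<in> N\<^sup>\<bottom>" for y
  proof -
    obtain m n where mn: "m \<in> M" "n \<in> N" "y = m + n" using sum by blast
    have "y = oproj (N\<^sup>\<bottom>) m"
      using oproj_id[OF N' y] projN[OF mn(2)] by (simp add: mn(3) blinfun.add_right)
    then have "norm y \<le> norm m" using norm_oproj_le[OF N', of m] by simp
    then have "c2 * (c1 * norm y) \<le> c2 * (c1 * norm m)" using c1(1) c2(1) by simp
    also have "\<dots> \<le> c2 * norm (F m)" using c1(2)[OF mn(1)] c2(1) by simp
    also have "\<dots> \<le> norm (oproj (N\<^sup>\<bottom>) (F m))" using c2(2) inv(1) mn(1) by blast
    also have "oproj (N\<^sup>\<bottom>) (F m) = oproj (N\<^sup>\<bottom>) (F y)"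
      using projN[of "F n"] inv(2) mn(2) by (auto simp: mn(3) blinfun.add_right)
    also have "norm \<dots> \<le> norm (F y)" by (rule norm_oproj_le[OF N'])
    finally show ?thesis by simp
  qed
  define R where "R = F ` (N\<^sup>\<bottom>)"
  have "complete R" unfolding R_def
    by (rule complete_isometric_image[OF _ N'(1) blinfun.bounded_linear_right, of "c2 * c1"])
      (use below N'(2) c1(1) c2(1) in \<open>auto simp: complete_eq_closed\<close>)
  then have "closure R = R" by (simp add: complete_eq_closed)
  then have R: "aff R" using aff_image_closure[OF F aNc] by (simp add: R_def)
  note R' = affD(1,2)[OF R]
  have "emb (R\<^sup>\<bottom>) N"
  proof (rule emb_of_injective[OF oproj_in_alg[OF aN] aff_comp[OF R] _ N(2,1)])
    fix x assume x: "x \<in> R\<^sup>\<bottom>" "oproj N x = 0"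
    then have xN: "n \<bullet> x = 0" if "n \<in> N" for n
      using that by (simp add: oproj_eq_0_iff[OF N] in_orthogonal_comp_iff)
    \<comment> \<open>\<open>x\<close> is the sum of a vector of \<open>R\<close> and two vectors of
      \<open>N\<close>: \<open>m\<close> is \<open>F m'\<close>, and splitting \<open>m'\<close>
      orthogonally along \<open>N\<close> gives one term in \<open>R\<close> and one in
      \<open>F N\<close>. All three are orthogonal to \<open>x\<close>.\<close>
    obtain m n where mn: "m \<in> M" "n \<in> N" "x = m + n" using sum by blast
    have "F ` M = M" using G by (simp add: homeomorphism_def)
    then obtain m' where m': "m = F m'" using mn(1) by blast
    have "m = F (oproj (N\<^sup>\<bottom>) m') + F (oproj N m')"
      by (simp add: m' oproj_comp[OF N] flip: blinfun.add_right)
    then have "x \<bullet> x = F (oproj (N\<^sup>\<bottom>) m') \<bullet> x + F (oproj N m') \<bullet> x + n \<bullet> x"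
      by (metis inner_add_left mn(3))
    moreover have "F (oproj (N\<^sup>\<bottom>) m') \<bullet> x = 0"
      using x(1) oproj_in[OF N', of m'] by (simp add: in_orthogonal_comp_iff R_def)
    moreover have "F (oproj N m') \<bullet> x = 0"
      by (rule xN) (use inv(2) oproj_in[OF N] in blast)
    ultimately show "x = 0" using xN[OF mn(2)] by simp
  next
    show "oproj N ` (R\<^sup>\<bottom>) \<subseteq> N" using oproj_in[OF N] by auto
  qed
  then have "fin (R\<^sup>\<bottom>)" by (rule emb_fin[OF aff_comp[OF R] N_fin])
  then have "oproj (R\<^sup>\<bottom>) \<in> finite_projections A"
    using finite_projections_oproj_iff[OF aff_comp[OF R]] by simp
  moreover have "range (id_blinfun - oproj (R\<^sup>\<bottom>)) \<subseteq> range F"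
  proof clarsimp
    fix x
    have "R \<subseteq> range F" by (auto simp: R_def)
    then have "oproj R x \<in> range F" using oproj_in[OF R'] by blast
    then show "(id_blinfun - oproj (R\<^sup>\<bottom>)) x \<in> range F"
      by (simp add: blinfun.diff_left oproj_comp[OF R'])
  qed
  ultimately show ?thesis
    unfolding breuer_fredholm_def using FA kernel_fin by blast
qed

section \<open>Fredholm operators are generalized Browder\<close>

lemma fin_zero: "fin {0}"
  by (auto simp: fin_def aff_0 blinfun.zero_right)

text \<open>Each power of \<open>z\<close> lies in \<open>alg\<close> and so carries
  \<open>e\<close> to a subspace with finite closure; \<open>fin_sup\<close> collects these one at a
  time.\<close>

lemma fin_iterated_images:
  assumes z: "z \<in> alg" and e: "fin e"
  shows "\<exists>q. fin q \<and> (\<forall>j<n. \<forall>x\<in>e. (blinfun_apply z ^^ j) x \<in> q)"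
proof (induction n)
  case 0
  show ?case using fin_zero by (intro exI[of _ "{0}"]) simp
next
  case (Suc n)
  then obtain q where q: "fin q" "\<And>j x. j < n \<Longrightarrow> x \<in> e \<Longrightarrow> (blinfun_apply z ^^ j) x \<in> q" by blast
  have "\<exists>S\<in>alg. \<forall>x. S x = (blinfun_apply z ^^ n) x"
  proof (induction n)
    case 0
    show ?case using alg_id by (intro bexI[of _ id_blinfun]) auto
  next
    case (Suc n)
    then obtain S where "S \<in> alg" "\<forall>x. S x = (blinfun_apply z ^^ n) x" by blast
    then show ?case using alg_compose[OF z] by (intro bexI[of _ "z o\<^sub>L S"]) auto
  qed
  then obtain S where S: "S \<in> alg" "\<And>x. S x = (blinfun_apply z ^^ n) x" by blast
  obtain q' where q': "fin q'" "q \<subseteq> q'" "closure (S ` e) \<subseteq> q'"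
    by (rule fin_sup[OF q(1) fin_image_closure[OF S(1) e]]) blast
  have "(blinfun_apply z ^^ j) x \<in> q'" if "j < Suc n" "x \<in> e" for j x
  proof (cases "j = n")
    case True
    then show ?thesis using that(2) q'(3) closure_subset[of "S ` e"] by (auto simp flip: S(2))
  next
    case False
    then show ?thesis using that q(2) q'(2) by auto
  qed
  then show ?case using q'(1) by blast
qed

lemma adj_funpow:
  fixes z :: "'a \<Rightarrow>\<^sub>L 'a"
  shows "(blinfun_apply z ^^ j) x \<bullet> y = x \<bullet> (blinfun_apply (adj z) ^^ j) y"
proof (induction j arbitrary: y)
  case (Suc j)
  have "(blinfun_apply z ^^ Suc j) x \<bullet> y = (blinfun_apply z ^^ j) x \<bullet> adj z y" by (simp add: adj_right)
  also have "\<dots> = x \<bullet> (blinfun_apply (adj z) ^^ j) (adj z y)" by (rule Suc.IH)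
  finally show ?case by (simp add: funpow_swap1)
qed simp

text \<open>\<open>1 - \<kappa> F\<close> equals \<open>- \<kappa> (F - \<mu>)\<close>, hence its
  inverse is \<open>- \<mu> G\<close>.\<close>

lemma inverse_one_minus_of_resolvent:
  fixes F :: "'a \<Rightarrow>\<^sub>L 'a"
  assumes F: "F \<in> bounded_clinear_ops" and \<mu>: "\<mu> \<notin> spectrum F" and \<kappa>: "\<kappa> * \<mu> = 1"
  shows "\<exists>X. inverse_one_minus X (\<kappa> *\<^sub>C\<^sub>L F)"
proof -
  obtain G where G: "G \<in> bounded_clinear_ops" "G o\<^sub>L (F - \<mu> *\<^sub>C\<^sub>L id_blinfun) = id_blinfun"
    "(F - \<mu> *\<^sub>C\<^sub>L id_blinfun) o\<^sub>L G = id_blinfun"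
    using \<mu> by (auto simp: spectrum_def)
  have Fc: "F (c *\<^sub>C x) = c *\<^sub>C F x" and Gc: "G (c *\<^sub>C x) = c *\<^sub>C G x" for c x
    using F G(1) by (auto simp: bounded_clinear_ops_iff)
  have GF: "G (F v) = v + \<mu> *\<^sub>C G v" for v
  proof -
    have "(G o\<^sub>L (F - \<mu> *\<^sub>C\<^sub>L id_blinfun)) v = v" unfolding G(2) by simp
    then show ?thesis by (simp add: blinfun.diff_left blinfun.diff_right Gc algebra_simps)
  qed
  have FG: "F (G v) = v + \<mu> *\<^sub>C G v" for v
  proof -
    have "((F - \<mu> *\<^sub>C\<^sub>L id_blinfun) o\<^sub>L G) v = v" unfolding G(3) by simp
    then show ?thesis by (simp add: blinfun.diff_left algebra_simps)
  qed
  have "inverse_one_minus (- (\<mu> *\<^sub>C\<^sub>L G)) (\<kappa> *\<^sub>C\<^sub>L F)"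
    unfolding inverse_one_minus_def
    using \<kappa> by (simp add: blinfun.minus_left blinfun.minus_right Gc Fc GF FG scaleC_scaleC scaleC_one mult.commute)
  then show ?thesis by blast
qed

lemma bounded_below_surjective_homeomorphism:
  fixes F :: "'a \<Rightarrow>\<^sub>L 'a"
  assumes M: "subspace M" and c: "c > 0" "\<And>x. x \<in> M \<Longrightarrow> c * norm x \<le> norm (F x)" and onto: "F ` M = M"
  shows "\<exists>G. homeomorphism M M F G"
proof -
  have diff: "c * norm (x - y) \<le> norm (F x - F y)" if "x \<in> M" "y \<in> M" for x y
    using c(2)[OF subspace_diff[OF M that]] by (simp add: blinfun.diff_right)
  have inj: "inj_on F M"
    using diff c(1) by (intro inj_onI) (force simp: mult_le_0_iff)
  define G where "G = inv_into M F"
  have FG: "F (G y) = y" and GM: "G y \<in> M" if "y \<in> M" for y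
    using that onto by (auto simp: G_def f_inv_into_f inv_into_into)
  have GF: "G (F x) = x" if "x \<in> M" for x using that inj by (simp add: G_def)
  have "continuous_on M G"
    unfolding continuous_on_iff
  proof (intro ballI allI impI)
    fix x e :: real and x' :: 'a assume x': "x' \<in> M" and e: "0 < e"
    show "\<exists>d>0. \<forall>y\<in>M. dist y x' < d \<longrightarrow> dist (G y) (G x') < e"
    proof (intro exI[of _ "c * e"] conjI ballI impI)
      fix y assume y: "y \<in> M" "dist y x' < c * e"
      have "c * norm (G y - G x') \<le> norm (y - x')"
        using diff[OF GM[OF y(1)] GM[OF x']] by (simp add: FG x' y(1))
      also have "\<dots> < c * e" using y(2) by (simp add: dist_norm)
      finally show "dist (G y) (G x') < e" using c(1) by (simp add: dist_norm)
    qed (use c(1) e in simp)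
  qed
  then have "homeomorphism M M F G"
    using onto FG GM GF by (intro homeomorphismI blinfun.continuous_on continuous_on_const continuous_on_id) auto
  then show ?thesis by blast
qed

lemma fredholm_imp_generalized_browder:
  assumes fred: "breuer_fredholm A F" and iso: "0 isolated_in spectrum F"
  shows "generalized_browder A F"
proof -
  obtain E where FA: "F \<in> A" and E: "E \<in> finite_projections A" "range (id_blinfun - E) \<subseteq> range F"
    using fred unfolding breuer_fredholm_def by blast
  have F: "F \<in> alg" using FA by (simp add: alg_eq)
  obtain e where e: "fin e" "E = oproj e" by (rule finite_projectionE[OF E(1)])
  note e' = affD(1,2)[OF fin_aff[OF e(1)]]
  have "e\<^sup>\<bottom> \<subseteq> range F"
  proof
    fix x assume "x \<in> e\<^sup>\<bottom>"
    then have "(id_blinfun - E) x = x"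
      by (simp add: e(2) blinfun.diff_left flip: oproj_eq_0_iff[OF e'])
    then show "x \<in> range F" using E(2) by (metis rangeI subsetD)
  qed
  then obtain c where c: "c > 0" "\<And>y. y \<in> e\<^sup>\<bottom> \<Longrightarrow> c * norm y \<le> norm (adj F y)"
    by (rule adj_bounded_below[OF subspace_orthogonal_comp closed_orthogonal_comp]) blast
  obtain \<epsilon> where \<epsilon>: "\<epsilon> > 0" "\<And>\<mu>. \<mu> \<in> spectrum F \<Longrightarrow> cmod \<mu> < \<epsilon> \<Longrightarrow> \<mu> = 0"
    using iso unfolding isolated_in_dist_Ex_iff by (auto simp: dist_norm)
  \<comment> \<open>\<open>r \<le> c\<close> makes \<open>adj z\<close> norm-nondecreasing on
    \<open>e\<^sup>\<bottom>\<close>; \<open>\<epsilon> / 2\<close> keeps the circle of radius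
    \<open>r\<close> inside the punctured disc that is free of spectrum.\<close>
  define r where "r = min c (\<epsilon> / 2)"
  have r: "r > 0" "r \<le> c" "r < \<epsilon>" using c(1) \<epsilon>(1) by (auto simp: r_def)
  define z where "z = (1/r) *\<^sub>R F"
  have zx: "z x = (1/r) *\<^sub>R F x" for x by (simp add: z_def blinfun.scaleR_left)
  have Fz: "F x = r *\<^sub>R z x" for x using r(1) by (simp add: zx)
  have z: "z \<in> alg" unfolding z_def by (rule alg_scaleR[OF F])
  have zc: "z \<in> bounded_clinear_ops" using z A_clinear by (simp add: alg_eq)
  \<comment> \<open>The value of \<open>\<mu>\<close> matching the coefficient
    \<open>\<zeta> / r\<close> is \<open>r * cnj \<zeta>\<close>, since the inverse of
    \<open>\<zeta>\<close> is its conjugate.\<close>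
  have ex: "\<exists>X. inverse_one_minus X (\<zeta> *\<^sub>C\<^sub>L z)" if \<zeta>: "cmod \<zeta> = 1" for \<zeta>
  proof -
    have one: "\<zeta> * cnj \<zeta> = 1" using \<zeta> by (simp flip: complex_norm_square)
    have "cmod (of_real r * cnj \<zeta>) = r" using \<zeta> r(1) by (simp add: norm_mult)
    then have "of_real r * cnj \<zeta> \<notin> spectrum F" using \<epsilon>(2)[of "of_real r * cnj \<zeta>"] r by auto
    moreover have "(\<zeta> * of_real (1/r)) * (of_real r * cnj \<zeta>) = 1" using one r(1) by simp
    ultimately have "\<exists>X. inverse_one_minus X ((\<zeta> * of_real (1/r)) *\<^sub>C\<^sub>L F)"
      by (rule inverse_one_minus_of_resolvent[OF A_clinear[OF FA]])
    moreover have "(\<zeta> * of_real (1/r)) *\<^sub>C\<^sub>L F = \<zeta> *\<^sub>C\<^sub>L z"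
      by (rule blinfun_eqI) (simp add: zx scaleR_scaleC scaleC_scaleC)
    ultimately show ?thesis by simp
  qed
  obtain P n d where PP: "\<And>x. blinfun_apply P (P x) = P x"
    and PS: "\<And>S. S o\<^sub>L z = z o\<^sub>L S \<Longrightarrow> S o\<^sub>L P = P o\<^sub>L S"
    and decay: "\<And>x. norm ((blinfun_apply z ^^ n) (P x)) \<le> 1/2 * norm x"
    and d: "d > 0" "\<And>x. P x = 0 \<Longrightarrow> d * norm x \<le> norm (z x)"
    and onto: "\<And>x. P x = 0 \<Longrightarrow> \<exists>y. P y = 0 \<and> z y = x"
    by (rule spectral_idempotent[OF zc ex], assumption) (rule that)
  have Pcomm: "S (P x) = P (S x)" if "\<And>v. blinfun_apply S (z v) = z (S v)" for S x
  proof -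
    have "S o\<^sub>L z = z o\<^sub>L S" by (rule blinfun_eqI) (simp add: that)
    then have "(S o\<^sub>L P) x = (P o\<^sub>L S) x" by (simp only: PS)
    then show ?thesis by simp
  qed
  have P: "P \<in> alg" unfolding alg_def
  proof (intro CollectI ballI allI)
    fix s x assume "s \<in> commutant A"
    then show "P (s x) = s (P x)" by (intro Pcomm[symmetric] algD[OF z, symmetric])
  qed
  have Pz: "P (z x) = z (P x)" for x by (rule Pcomm[symmetric]) simp
  have PF: "P (F x) = F (P x)" for x by (simp add: Fz Pz blinfun.scaleR_right)
  define M where "M = {x. P x = 0}"
  define N where "N = {x. (id_blinfun - P) x = 0}"
  have N_iff: "x \<in> N \<longleftrightarrow> P x = x" for x by (auto simp: N_def blinfun.diff_left)
  have M: "aff M" and N: "aff N" unfolding M_def N_def by (intro aff_kernel alg_diff alg_id P)+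

  have dec: "direct_decomposition M N"
    unfolding direct_decomposition_def
  proof (intro conjI aff_closed_csubspace M N)
    show "M \<inter> N = {0}" by (auto simp: M_def N_iff blinfun.zero_right)
    have "\<exists>x y. v = x + y \<and> x \<in> M \<and> y \<in> N" for v
      by (rule exI[of _ "v - P v"], rule exI[of _ "P v"]) (simp add: M_def N_iff blinfun.diff_right PP)
    then show "{x + y |x y. x \<in> M \<and> y \<in> N} = UNIV" by auto
  qed
  have FM: "F ` M \<subseteq> M" and FN: "F ` N \<subseteq> N"
    by (auto simp: M_def N_iff PF blinfun.zero_right)
  have "F ` M = M"
  proof (rule antisym[OF FM], rule subsetI)
    fix x assume "x \<in> M"
    then obtain y where y: "P y = 0" "z y = x" using onto by (auto simp: M_def)
    then have "F ((1/r) *\<^sub>R y) = x" using r(1) by (simp add: Fz blinfun.scaleR_right)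
    moreover have "(1/r) *\<^sub>R y \<in> M" using y(1) by (simp add: M_def blinfun.scaleR_right)
    ultimately show "x \<in> F ` M" by blast
  qed
  then have homeo: "\<exists>G. homeomorphism M M F G"
  proof (rule bounded_below_surjective_homeomorphism[OF affD(1)[OF M], rotated 2])
    show "r * d > 0" using r(1) d(1) by simp
    show "r * d * norm x \<le> norm (F x)" if "x \<in> M" for x
      using d(2)[of x] that r(1) by (simp add: M_def Fz)
  qed

  \<comment> \<open>\<open>n\<close> is the exponent of the decay estimate: if \<open>y\<close> is
    orthogonal to \<open>q\<close>, then the \<open>j\<close>-th iterate of \<open>adj z\<close> on
    \<open>y\<close> is orthogonal to \<open>e\<close> for all \<open>j < n\<close>.\<close>
  obtain q where q: "fin q" "\<forall>j<n. \<forall>x\<in>e. (blinfun_apply z ^^ j) x \<in> q"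
    using fin_iterated_images[OF z e(1), of n] by (elim exE conjE)
  note q' = affD(1,2)[OF fin_aff[OF q(1)]]
  define N' where "N' = {x. (id_blinfun - adj P) x = 0}"
  have N'_iff: "x \<in> N' \<longleftrightarrow> adj P x = x" for x by (auto simp: N'_def blinfun.diff_left)
  have N': "aff N'" unfolding N'_def by (intro aff_kernel alg_diff alg_id alg_adj P)
  let ?b = "blinfun_apply (adj z)"
  have "emb N' q"
  proof (rule emb_of_injective[OF oproj_in_alg[OF fin_aff[OF q(1)]] N' _ q'(2,1)])
    fix y assume y: "y \<in> N'" "oproj q y = 0"
    have yq: "x \<bullet> y = 0" if "x \<in> q" for x
      using y(2) that by (simp add: oproj_eq_0_iff[OF q'] in_orthogonal_comp_iff)
    have grow: "j \<le> n \<Longrightarrow> norm y \<le> norm ((?b ^^ j) y)" for j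
    proof (induction j)
      case (Suc j)
      have "(?b ^^ j) y \<in> e\<^sup>\<bottom>"
        using q(2) yq Suc.prems by (simp add: in_orthogonal_comp_iff flip: adj_funpow)
      then have "c * norm ((?b ^^ j) y) \<le> norm (adj F ((?b ^^ j) y))" by (rule c(2))
      also have "adj F ((?b ^^ j) y) = r *\<^sub>R (?b ^^ Suc j) y"
        using r(1) by (simp add: z_def adj_scaleR blinfun.scaleR_left)
      finally have "c * norm ((?b ^^ j) y) \<le> r * norm ((?b ^^ Suc j) y)" using r(1) by simp
      moreover have "r * norm ((?b ^^ j) y) \<le> c * norm ((?b ^^ j) y)"
        using r(2) by (intro mult_right_mono) auto
      ultimately have "r * norm ((?b ^^ j) y) \<le> r * norm ((?b ^^ Suc j) y)" by linarith
      then have "norm ((?b ^^ j) y) \<le> norm ((?b ^^ Suc j) y)" using r(1) by (simp only: mult_le_cancel_left_pos)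
      then show ?case using Suc by simp
    qed simp
    let ?u = "(?b ^^ n) y"
    have Pzn: "P ((blinfun_apply z ^^ j) x) = (blinfun_apply z ^^ j) (P x)" for j x
      by (induction j) (simp_all add: Pz)
    \<comment> \<open>Moving the \<open>n\<close> adjoints back and using \<open>adj P y = y\<close>
      brings in \<open>z^n\<close> on the range of \<open>P\<close>; its factor \<open>1/2\<close>
      contradicts the growth unless \<open>y = 0\<close>.\<close>
    have "?u \<bullet> ?u = (blinfun_apply z ^^ n) ?u \<bullet> adj P y"
      using y(1) by (simp add: adj_funpow N'_iff)
    also have "\<dots> = (blinfun_apply z ^^ n) (P ?u) \<bullet> y" by (simp add: Pzn flip: adj_right)
    also have "\<dots> \<le> norm ((blinfun_apply z ^^ n) (P ?u)) * norm y" by (rule norm_cauchy_schwarz)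
    also have "\<dots> \<le> (1/2 * norm ?u) * norm y" by (intro mult_right_mono decay) auto
    finally have "norm ?u * norm ?u \<le> (1/2 * norm y) * norm ?u"
      by (simp add: mult.commute flip: power2_norm_eq_inner power2_eq_square)
    then have "norm ?u \<le> 1/2 * norm y \<or> norm ?u = 0"
      using mult_right_le_imp_le[of "norm ?u" "norm ?u" "1/2 * norm y"] norm_ge_zero[of ?u] by force
    then have "norm y \<le> 0" using grow[of n] norm_ge_zero[of y] by linarith
    then show "y = 0" by simp
  next
    show "oproj q ` N' \<subseteq> q" using oproj_in[OF q'] by auto
  qed
  then have N'_fin: "fin N'" by (rule emb_fin[OF N' q(1)])
  \<comment> \<open>For \<open>x\<close> fixed by \<open>P\<close>,
    \<open>x \<bullet> x = x \<bullet> adj P x\<close>, so \<open>adj P\<close> kills no nonzero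
    vector of \<open>N\<close>.\<close>
  have "emb N N'"
  proof (rule emb_of_injective[OF alg_adj[OF P] N _ affD(2,1)[OF N']])
    fix x assume x: "x \<in> N" "adj P x = 0"
    then have "x \<bullet> x = P x \<bullet> x" by (simp add: N_iff)
    also have "\<dots> = 0" by (simp add: adj_right x(2))
    finally show "x = 0" by simp
  next
    have "P o\<^sub>L P = P" by (rule blinfun_eqI) (simp add: PP)
    then have "adj P o\<^sub>L adj P = adj P" by (simp flip: adj_compose)
    then have "adj P (adj P x) = adj P x" for x by (metis blinfun_apply_blinfun_compose)
    then show "adj P ` N \<subseteq> N'" by (auto simp: N'_iff)
  qed
  then have "fin N" by (rule emb_fin[OF N N'_fin])
  then have "orth_proj N \<in> finite_projections A"
    by (simp add: orth_proj_eq_oproj aff_closed_csubspace N finite_projections_oproj_iff)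
  then show ?thesis
    unfolding generalized_browder_def using FA dec FM FN homeo by blast
qed

end

theorem corollary4p7:
  fixes A :: "('a::chilbert_space \<Rightarrow>\<^sub>L 'a) set" and F :: "'a \<Rightarrow>\<^sub>L 'a"
  assumes "von_neumann_algebra A"
    and "properly_infinite A"
    and "F \<in> A"
    and "0 isolated_in spectrum F"
  shows "breuer_fredholm A F \<longleftrightarrow> generalized_browder A F"
proof -
  interpret von_neumann A by (rule von_neumann.intro) (rule assms(1))
  show ?thesis
    using fredholm_imp_generalized_browder[OF _ assms(4)] generalized_browder_imp_fredholm by blast
qed

end
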